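(* Let $\mathbb F$ be a finite field with $q$ elements, $A=\mathbb F[t]$, let $F$ be a finite field equipped with a ring homomorphism $\gamma:A\to F$, let $\mathfrak p$ be the monic generator of $\ker\gamma$ and $d=\deg\mathfrak p=[F:\mathbb F]$. Let $\phi:A\to F\{\tau\}$ be a Drinfeld module, $\phi_t=\gamma(t)+g_1\tau+\cdots+g_r\tau^r$ with $g_r\ne0$, and let $\phi^\sim$ be its $T$-twisted form. Then $$P\big(\mathbb M(\phi)^\vee;T\big)=\mathfrak p^{-1}\cdot|\phi^\sim(F)|.$$
   Context: $F\{\tau\}$ is the ring of twisted polynomials over $F$ with $\tau c=c^q\tau$. A Drinfeld module here is an $\mathbb F$-algebra homomorphism $\phi:A\to F\{\tau\}$, $a\mapsto\phi_a$, with $\phi_t=\gamma(t)+g_1\tau+\cdots+g_r\tau^r$, $r\ge1$, $g_r\ne0$. $T$-twist: $\phi^\sim:A\to F[T]\{\tau\}$ is the $\mathbb F$-algebra homomorphism with $\phi^\sim_t=\gamma(t)+g_1T\tau+\cdots+g_rT^r\tau^r$ ($\tau$ commuting with $T$), acting on $F[T]$ with $\tau(\sum c_jT^j)=\sum c_j^qT^j$. Define $|\phi^\sim(F)|:=\det_{A[T]}\big(t-\phi^\sim_t\mid A\otimes_{\mathbb F}F[T]\big)\in A[T]$, where $t$ acts on the factor $A$ and $\phi^\sim_t$ on the factor $F[T]$. Anderson motives: $A_F:=A\otimes_{\mathbb F}F\cong F[t]$, $\theta:=1\otimes\gamma(t)$, and $\tau:A_F\to A_F$, $a\otimes x\mapsto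 a\otimes x^q$. For an $A_F$-module $M$, $\tau^*M:=A_F\otimes_{\tau,A_F}M$ and $\tau^*x:=1\otimes x$. An Anderson motive is a finite free $A_F$-module $M$ with an $A_F$-linear isomorphism $\tau_M:\tau^*M[\frac1{t-\theta}]\to M[\frac1{t-\theta}]$. The motive $\mathbb M(\phi)$ is $F\{\tau\}$ with $A_F$-module structure $(a\otimes x)\bullet f:=xf\phi_a$ and $\tau_{\mathbb M(\phi)}(\tau^*f):=f\tau$ (right multiplication); it is free with basis $u_i=\tau^i$, $0\le i<r$. The dual $M^\vee:=\mathrm{Hom}_{A_F}(M,A_F)$ carries $\tau_{M^\vee}$ defined, for $f\in\tau^*M^\vee=\mathrm{Hom}_{A_F}(\tau^*M,\tau^*A_F)$, as the unique map with $\tau_{M^\vee}(f)\circ\tau_M=\tau\circ f$ on $\tau^*M[\frac1{t-\theta}]$ (here $\tau:\tau^*A_F\to A_F$ is the linearized Frobenius). Euler factor: since $t-\theta$ is invertible in $A[\frac1{\mathfrak p}]\otimes_{\mathbb F}F$ and $\tau^d$ is the identity on $A_F$, the $d$-fold iterate $\tau_M^d$ induces an $A[\frac1{\mathfrak p}]\otimes F$-linear endomorphism of $A[\frac1{\mathfrak p},T]\otimes_AM$, and $P(M;T):=\det_{A[\frac1{\mathfrak p},T]\otimes F}\big(1-T^d\tau_M^d\mid A[\frac1{\mathfrak p},T]\otimes_AM\big)$.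
   Formalization: The map τ_{M(φ)}(τ^*f):=fτ (right multiplication) is ill-defined when F≠𝔽, since τ^*(xf)=x^q τ^*f but (xf)τ=x(fτ); the formal theorem uses τ_{M(φ)}(τ^*f):=τf, which has the same values on the basis u_i=τ^i. *)

theory Defs
  imports
    "HOL-Algebra.Free_Abelian_Groups"
    "HOL-Algebra.Module"
    "HOL-Computational_Algebra.Polynomial_Factorial"
    "HOL-Library.Cardinality"
    "Jordan_Normal_Form.Determinant"
begin

section \<open>Modules over subrings of a commutative ring type\<close>

text \<open>
  Coefficient rings are subsets \<open>S\<close> of a type of class \<^class>\<open>comm_ring_1\<close> that are closed under the
  ring operations; modules are records of type \<^typ>\<open>('s, 'm) module\<close>, whose fields \<open>mult\<close> and
  \<open>one\<close> are irrelevant and left undefined. Linear maps are extensional, that is, \<open>undefined\<close> outside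
  the carrier of their domain, so that the descriptions by THE below determine them as functions.
\<close>

definition semilinear_maps ::
  "'s set \<Rightarrow> ('s \<Rightarrow> 't) \<Rightarrow> ('s, 'm) module \<Rightarrow> ('t, 'n) module \<Rightarrow> ('m \<Rightarrow> 'n) set" where
  "semilinear_maps S h M N = {f \<in> carrier M \<rightarrow>\<^sub>E carrier N.
     (\<forall>x\<in>carrier M. \<forall>y\<in>carrier M. f (x \<oplus>\<^bsub>M\<^esub> y) = f x \<oplus>\<^bsub>N\<^esub> f y) \<and>
     (\<forall>s\<in>S. \<forall>x\<in>carrier M. f (s \<odot>\<^bsub>M\<^esub> x) = h s \<odot>\<^bsub>N\<^esub> f x)}"

abbreviation linear_maps ::
  "'s set \<Rightarrow> ('s, 'm) module \<Rightarrow> ('s, 'n) module \<Rightarrow> ('m \<Rightarrow> 'n) set" where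
  "linear_maps S \<equiv> semilinear_maps S (\<lambda>s. s)"

definition regular_module :: "'s::comm_ring_1 set \<Rightarrow> ('s, 's) module" where
  "regular_module S = \<lparr>carrier = S, monoid.mult = undefined, one = undefined, zero = 0, add = (+),
     module.smult = (*)\<rparr>"

definition dual_module :: "'s::comm_ring_1 set \<Rightarrow> ('s, 'm) module \<Rightarrow> ('s, 'm \<Rightarrow> 's) module" where
  "dual_module S M = \<lparr>carrier = linear_maps S M (regular_module S), monoid.mult = undefined,
     one = undefined, zero = (\<lambda>x\<in>carrier M. 0), add = (\<lambda>f g. \<lambda>x\<in>carrier M. f x + g x),
     module.smult = (\<lambda>s f. \<lambda>x\<in>carrier M. s * f x)\<rparr>"

definition is_basis ::
  "'s set \<Rightarrow> ('s, 'm) module \<Rightarrow> nat \<Rightarrow> (nat \<Rightarrow> 'm) \<Rightarrow> bool" where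
  "is_basis S M n b \<longleftrightarrow> b \<in> {..<n} \<rightarrow> carrier M \<and>
     (\<forall>x\<in>carrier M. \<exists>!c. c \<in> {..<n} \<rightarrow>\<^sub>E S \<and> x = (\<Oplus>\<^bsub>M\<^esub>i\<in>{..<n}. c i \<odot>\<^bsub>M\<^esub> b i))"

text \<open>Determinant of an endomorphism of a finite free module, via its matrix in any basis.\<close>

definition endo_det ::
  "'s::comm_ring_1 set \<Rightarrow> ('s, 'm) module \<Rightarrow> ('m \<Rightarrow> 'm) \<Rightarrow> 's" where
  "endo_det S M f = (THE D. \<exists>n b C. is_basis S M n b \<and> C \<in> carrier_mat n n \<and>
     (\<forall>i<n. \<forall>j<n. C $$ (i, j) \<in> S) \<and>
     (\<forall>j<n. f (b j) = (\<Oplus>\<^bsub>M\<^esub>i\<in>{..<n}. C $$ (i, j) \<odot>\<^bsub>M\<^esub> b i)) \<and> D = det C)"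


section \<open>Base change\<close>

text \<open>
  For a ring homomorphism \<open>h\<close> from the whole type \<^typ>\<open>'r\<close> to \<open>S\<close> and an \<^typ>\<open>'r\<close>-module \<open>M\<close>,
  the tensor product of \<open>S\<close> and \<open>M\<close> over \<open>h\<close> is the free abelian group on pairs modulo the subgroup
  generated by the usual relations, with \<open>S\<close> acting on the left factor.
\<close>

definition tensor_rels ::
  "('r \<Rightarrow> 's) \<Rightarrow> 's::comm_ring_1 set \<Rightarrow> ('r, 'm) module \<Rightarrow> ('s \<times> 'm \<Rightarrow>\<^sub>0 int) set" where
  "tensor_rels h S M =
     {frag_of (s + s', m) - frag_of (s, m) - frag_of (s', m) |s s' m.
        s \<in> S \<and> s' \<in> S \<and> m \<in> carrier M} \<union>
     {frag_of (s, m \<oplus>\<^bsub>M\<^esub> m') - frag_of (s, m) - frag_of (s, m') |s m m'.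
        s \<in> S \<and> m \<in> carrier M \<and> m' \<in> carrier M} \<union>
     {frag_of (s * h r, m) - frag_of (s, r \<odot>\<^bsub>M\<^esub> m) |s r m. s \<in> S \<and> m \<in> carrier M}"

definition tensor_free ::
  "'s::comm_ring_1 set \<Rightarrow> ('r, 'm) module \<Rightarrow> ('s \<times> 'm \<Rightarrow>\<^sub>0 int) monoid" where
  "tensor_free S M = free_Abelian_group (S \<times> carrier M)"

definition tensor_ker ::
  "('r \<Rightarrow> 's) \<Rightarrow> 's::comm_ring_1 set \<Rightarrow> ('r, 'm) module \<Rightarrow> ('s \<times> 'm \<Rightarrow>\<^sub>0 int) set" where
  "tensor_ker h S M = generate (tensor_free S M) (tensor_rels h S M)"

definition base_change ::
  "('r \<Rightarrow> 's) \<Rightarrow> 's::comm_ring_1 set \<Rightarrow> ('r, 'm) module \<Rightarrow> ('s, ('s \<times> 'm \<Rightarrow>\<^sub>0 int) set) module" where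
  "base_change h S M = (let G = tensor_free S M; K = tensor_ker h S M in
     \<lparr>carrier = carrier (G Mod K), monoid.mult = undefined, one = undefined,
      zero = one (G Mod K), add = monoid.mult (G Mod K),
      module.smult = (\<lambda>s X. \<Union>x\<in>X. K #>\<^bsub>G\<^esub> frag_extend (\<lambda>(u, m). frag_of (s * u, m)) x)\<rparr>)"

definition pure_tensor ::
  "('r \<Rightarrow> 's) \<Rightarrow> 's::comm_ring_1 set \<Rightarrow> ('r, 'm) module \<Rightarrow> 's \<Rightarrow> 'm \<Rightarrow> ('s \<times> 'm \<Rightarrow>\<^sub>0 int) set" where
  "pure_tensor h S M s m = tensor_ker h S M #>\<^bsub>tensor_free S M\<^esub> frag_of (s, m)"

text \<open>
  The \<open>S\<close>-bilinear extension of a bilinear pairing \<open>B\<close> of \<open>M\<close> and \<open>N\<close> with values in \<^typ>\<open>'r\<close>: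
  \<open>(s \<otimes> m, u \<otimes> n)\<close> goes to \<open>s * u * h (B m n)\<close>. For the evaluation pairing of \<open>M\<close> with its dual
  this is the identification of the base change of the dual with the dual of the base change.
\<close>

definition pairing_base_change ::
  "('r \<Rightarrow> 's) \<Rightarrow> 's::comm_ring_1 set \<Rightarrow> ('r, 'm) module \<Rightarrow> ('r, 'n) module \<Rightarrow> ('m \<Rightarrow> 'n \<Rightarrow> 'r) \<Rightarrow>
     ('s \<times> 'm \<Rightarrow>\<^sub>0 int) set \<Rightarrow> ('s \<times> 'n \<Rightarrow>\<^sub>0 int) set \<Rightarrow> 's" where
  "pairing_base_change h S M N B =
     (THE B'. B' \<in> linear_maps S (base_change h S M) (dual_module S (base_change h S N)) \<and>
        (\<forall>m\<in>carrier M. \<forall>n\<in>carrier N.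
           B' (pure_tensor h S M 1 m) (pure_tensor h S N 1 n) = h (B m n)))"


section \<open>Twisted polynomials and Drinfeld modules\<close>

definition type_ring :: "'a::comm_ring_1 ring" where
  "type_ring = \<lparr>carrier = UNIV, monoid.mult = (*), one = 1, zero = 0, add = (+)\<rparr>"

text \<open>
  The twisted polynomial \<open>\<Sum>\<^sub>i c\<^sub>i \<tau>\<^sup>i\<close>, where \<open>\<tau> c = \<sigma>(c) \<tau>\<close>, is represented by the
  ordinary polynomial with coefficients \<open>c\<^sub>i\<close>; only the multiplication differs.
\<close>

definition tmult :: "('a \<Rightarrow> 'a) \<Rightarrow> 'a::comm_ring_1 poly \<Rightarrow> 'a poly \<Rightarrow> 'a poly" where
  "tmult \<sigma> u v =
     (\<Sum>i\<le>degree u. \<Sum>j\<le>degree v. monom (coeff u i * (\<sigma> ^^ i) (coeff v j)) (i + j))"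

definition twisted_ring :: "('a \<Rightarrow> 'a) \<Rightarrow> 'a::comm_ring_1 poly ring" where
  "twisted_ring \<sigma> = \<lparr>carrier = UNIV, monoid.mult = tmult \<sigma>, one = 1, zero = 0, add = (+)\<rparr>"

definition tact :: "('a \<Rightarrow> 'a) \<Rightarrow> 'a::comm_ring_1 poly \<Rightarrow> 'a \<Rightarrow> 'a" where
  "tact \<sigma> u x = (\<Sum>i\<le>degree u. coeff u i * (\<sigma> ^^ i) x)"

text \<open>
  Throughout, \<^typ>\<open>'k\<close> is the field \<open>\<bbbF>\<close> with \<open>q = CARD('k)\<close> elements, \<open>A\<close> is \<^typ>\<open>'k poly\<close> in the
  variable \<open>t\<close>, and \<open>\<gamma>\<close> makes \<^typ>\<open>'f\<close> an \<open>A\<close>-algebra, hence via constant polynomials an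
  \<open>\<bbbF>\<close>-algebra. The ring \<open>A\<^sub>F = A \<otimes> F\<close> is \<^typ>\<open>'f poly\<close>, again in the variable \<open>t\<close>.
\<close>

abbreviation tvar :: "'a::comm_ring_1 poly" where
  "tvar \<equiv> [:0, 1:]"

definition struct_map :: "('k::field poly \<Rightarrow> 'f::field) \<Rightarrow> 'k \<Rightarrow> 'f" where
  "struct_map \<gamma> c = \<gamma> [:c:]"

text \<open>The \<open>q\<close>-Frobenius of \<open>F\<close>, and its extension to polynomials over \<open>F\<close> fixing the variable.\<close>

definition frob :: "nat \<Rightarrow> 'f::field \<Rightarrow> 'f" where
  "frob q x = x ^ q"

definition frob_poly :: "nat \<Rightarrow> 'f::field poly \<Rightarrow> 'f poly" where
  "frob_poly q = map_poly (frob q)"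

definition drinfeld_module ::
  "('k::{field,finite} poly \<Rightarrow> 'f::{field,finite}) \<Rightarrow> ('k poly \<Rightarrow> 'f poly) \<Rightarrow> bool" where
  "drinfeld_module \<gamma> \<phi> \<longleftrightarrow>
     \<phi> \<in> ring_hom type_ring (twisted_ring (frob CARD('k))) \<and>
     (\<forall>c. \<phi> [:c:] = [:struct_map \<gamma> c:]) \<and>
     coeff (\<phi> tvar) 0 = \<gamma> tvar \<and> degree (\<phi> tvar) \<ge> 1"

text \<open>Here \<open>F[T]\<close> is \<^typ>\<open>'f poly\<close>, and \<open>F[T]{\<tau>}\<close> is \<^typ>\<open>'f poly poly\<close> with outer variable \<open>\<tau>\<close>.\<close>

definition T_twist ::
  "('k::{field,finite} poly \<Rightarrow> 'f::{field,finite}) \<Rightarrow> ('k poly \<Rightarrow> 'f poly) \<Rightarrow>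
     ('k poly \<Rightarrow> 'f poly poly) \<Rightarrow> bool" where
  "T_twist \<gamma> \<phi> \<psi> \<longleftrightarrow>
     \<psi> \<in> ring_hom type_ring (twisted_ring (frob_poly CARD('k))) \<and>
     (\<forall>c. \<psi> [:c:] = [:[:struct_map \<gamma> c:]:]) \<and>
     \<psi> tvar = (\<Sum>i\<le>degree (\<phi> tvar). monom (monom (coeff (\<phi> tvar) i) i) i)"

text \<open>
  The module \<open>A \<otimes> F[T]\<close> over \<open>A[T]\<close>. It is \<^typ>\<open>'f poly poly\<close> with outer variable \<open>t\<close> and inner
  variable \<open>T\<close>, so that \<open>id \<otimes> u\<close> is \<open>map_poly u\<close> for an additive endomorphism \<open>u\<close> of \<open>F[T]\<close>.
  On the other hand \<open>A[T]\<close> is \<^typ>\<open>'k poly poly\<close> with outer variable \<open>T\<close>; a scalar is therefore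
  mapped to \<open>A \<otimes> F[T]\<close> by embedding its coefficients and evaluating at \<open>T\<close>.
\<close>

definition twist_module ::
  "('k::field poly \<Rightarrow> 'f::field) \<Rightarrow> ('k poly poly, 'f poly poly) module" where
  "twist_module \<gamma> = \<lparr>carrier = UNIV, monoid.mult = undefined, one = undefined, zero = 0, add = (+),
     module.smult = (\<lambda>a x. poly (map_poly (map_poly (\<lambda>c. [:struct_map \<gamma> c:])) a) [:[:0, 1:]:] * x)\<rparr>"

text \<open>The element \<open>|\<phi>\<^sup>\<sim>(F)|\<close> of \<open>A[T]\<close>.\<close>

definition twist_size ::
  "('k::{field,finite} poly \<Rightarrow> 'f::{field,finite}) \<Rightarrow> ('k poly \<Rightarrow> 'f poly poly) \<Rightarrow> 'k poly poly" where
  "twist_size \<gamma> \<psi> = endo_det UNIV (twist_module \<gamma>)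
     (\<lambda>x. tvar * x - map_poly (tact (frob_poly CARD('k)) (\<psi> tvar)) x)"


section \<open>Anderson motives\<close>

definition scalar_ext :: "('k::field poly \<Rightarrow> 'f::field) \<Rightarrow> 'k poly \<Rightarrow> 'f poly" where
  "scalar_ext \<gamma> = map_poly (struct_map \<gamma>)"

text \<open>The rings \<open>A\<^sub>F[1/(t - \<theta>)]\<close>, \<open>A[1/\<pp>, T]\<close> and \<open>A[1/\<pp>, T] \<otimes> F\<close>, the first one inside
  \<open>F(t)\<close>, the other two inside \<open>F(t)[T]\<close>.\<close>

definition localized_at :: "'f::field poly \<Rightarrow> 'f poly fract set" where
  "localized_at s = {to_fract a / to_fract s ^ n |a n. True}"

definition ring_theta :: "('k::field poly \<Rightarrow> 'f::field) \<Rightarrow> 'f poly fract set" where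
  "ring_theta \<gamma> = localized_at (tvar - [:\<gamma> tvar:])"

definition ring_ApT :: "('k::field poly \<Rightarrow> 'f::field) \<Rightarrow> 'k poly \<Rightarrow> 'f poly fract poly set" where
  "ring_ApT \<gamma> \<pp> = {P. \<forall>i. \<exists>a n. coeff P i = to_fract (scalar_ext \<gamma> a) / to_fract (scalar_ext \<gamma> \<pp>) ^ n}"

definition ring_ApTF :: "('k::field poly \<Rightarrow> 'f::field) \<Rightarrow> 'k poly \<Rightarrow> 'f poly fract poly set" where
  "ring_ApTF \<gamma> \<pp> = {P. \<forall>i. coeff P i \<in> localized_at (scalar_ext \<gamma> \<pp>)}"

text \<open>
  The data of an Anderson motive are an \<open>A\<^sub>F\<close>-module \<open>M\<close> and an \<open>A\<^sub>F[1/(t - \<theta>)]\<close>-linear map from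
  \<open>frob_pullback M\<close> localized at \<open>t - \<theta>\<close> to \<open>M\<close> localized at \<open>t - \<theta>\<close>.
\<close>

abbreviation frob_pullback ::
  "nat \<Rightarrow> ('f::field poly, 'm) module \<Rightarrow> ('f poly, ('f poly \<times> 'm \<Rightarrow>\<^sub>0 int) set) module" where
  "frob_pullback q M \<equiv> base_change (frob_poly q) UNIV M"

abbreviation frob_elem ::
  "nat \<Rightarrow> ('f::field poly, 'm) module \<Rightarrow> 'm \<Rightarrow> ('f poly \<times> 'm \<Rightarrow>\<^sub>0 int) set" where
  "frob_elem q M x \<equiv> pure_tensor (frob_poly q) UNIV M 1 x"

abbreviation loc_theta ::
  "('k::field poly \<Rightarrow> 'f::field) \<Rightarrow> ('f poly, 'm) module \<Rightarrow>
     ('f poly fract, ('f poly fract \<times> 'm \<Rightarrow>\<^sub>0 int) set) module" where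
  "loc_theta \<gamma> M \<equiv> base_change to_fract (ring_theta \<gamma>) M"

abbreviation loc_elem ::
  "('k::field poly \<Rightarrow> 'f::field) \<Rightarrow> ('f poly, 'm) module \<Rightarrow> 'm \<Rightarrow>
     ('f poly fract \<times> 'm \<Rightarrow>\<^sub>0 int) set" where
  "loc_elem \<gamma> M x \<equiv> pure_tensor to_fract (ring_theta \<gamma>) M 1 x"

type_synonym ('f, 'm) motive_map =
  "('f poly fract \<times> ('f poly \<times> 'm \<Rightarrow>\<^sub>0 int) set \<Rightarrow>\<^sub>0 int) set \<Rightarrow> ('f poly fract \<times> 'm \<Rightarrow>\<^sub>0 int) set"

text \<open>The action \<open>(a \<otimes> x) \<bullet> f = x f \<phi>\<^sub>a\<close>, extended additively from \<open>t\<^sup>i \<otimes> x\<close>.\<close>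

definition drinfeld_motive ::
  "('k::{field,finite} poly \<Rightarrow> 'f::{field,finite} poly) \<Rightarrow> ('f poly, 'f poly) module" where
  "drinfeld_motive \<phi> = \<lparr>carrier = UNIV, monoid.mult = undefined, one = undefined, zero = 0, add = (+),
     module.smult = (\<lambda>p f. \<Sum>i\<le>degree p.
       tmult (frob CARD('k)) (tmult (frob CARD('k)) [:coeff p i:] f) (\<phi> (monom 1 i)))\<rparr>"

text \<open>
  The linear map with \<open>\<tau>\<^sup>* f \<mapsto> \<tau> f\<close>. The multiplication by \<open>\<tau>\<close> has to be on the left: since
  \<open>\<tau> (x f \<phi>\<^sub>a) = x\<^sup>q (\<tau> f) \<phi>\<^sub>a\<close>, it is Frobenius-semilinear, whereas \<open>f \<mapsto> f \<tau>\<close> is not, as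
  \<open>(x f) \<tau> = x (f \<tau>)\<close>. On the basis \<open>\<tau>\<^sup>i\<close>, \<open>i < r\<close>, both have the same values \<open>\<tau>\<^sup>i\<^sup>+\<^sup>1\<close>.
\<close>

definition drinfeld_motive_map ::
  "('k::{field,finite} poly \<Rightarrow> 'f::{field,finite}) \<Rightarrow> ('k poly \<Rightarrow> 'f poly) \<Rightarrow>
     ('f, 'f poly) motive_map" where
  "drinfeld_motive_map \<gamma> \<phi> = (let M = drinfeld_motive \<phi>; q = CARD('k); M' = frob_pullback q M in
     THE g. g \<in> linear_maps (ring_theta \<gamma>) (loc_theta \<gamma> M') (loc_theta \<gamma> M) \<and>
       (\<forall>f. g (loc_elem \<gamma> M' (frob_elem q M f)) = loc_elem \<gamma> M (tmult (frob q) (monom 1 1) f)))"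

text \<open>
  The map of the dual motive. In \<open>g f \<circ> \<tau>\<^sub>M = \<tau> \<circ> f\<close> the composition on the left is the
  evaluation pairing of the localizations of the dual and of \<open>M\<close>. On the right, the pairing
  \<open>E'\<close> of the Frobenius pullbacks already includes the linearized Frobenius
  \<open>a \<otimes> b \<mapsto> a \<tau>(b)\<close>, since \<open>(a \<otimes> f, b \<otimes> x)\<close> goes to \<open>a b \<tau>(f x)\<close>.
\<close>

definition dual_motive_map ::
  "('k::{field,finite} poly \<Rightarrow> 'f::{field,finite}) \<Rightarrow> ('f poly, 'm) module \<Rightarrow>
     ('f, 'm) motive_map \<Rightarrow> ('f, 'm \<Rightarrow> 'f poly) motive_map" where
  "dual_motive_map \<gamma> M \<tau>M = (let
       q = CARD('k); R = ring_theta \<gamma>; D = dual_module UNIV M;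
       M' = frob_pullback q M; D' = frob_pullback q D;
       E = (\<lambda>f x. f x); E' = pairing_base_change (frob_poly q) UNIV D M E
     in THE g. g \<in> linear_maps R (loc_theta \<gamma> D') (loc_theta \<gamma> D) \<and>
       (\<forall>f\<in>carrier (loc_theta \<gamma> D'). \<forall>x\<in>carrier (loc_theta \<gamma> M').
          pairing_base_change to_fract R D M E (g f) (\<tau>M x) =
          pairing_base_change to_fract R D' M' E' f x))"


section \<open>Euler factors\<close>

text \<open>
  \<open>A[1/\<pp>, T] \<otimes>\<^sub>A M\<close>, as a module over \<open>A[1/\<pp>, T] \<otimes> F\<close>: it is the base change of \<open>M\<close> along
  \<open>A \<otimes> F \<rightarrow> A[1/\<pp>, T] \<otimes> F\<close>.
\<close>

abbreviation to_ApTF :: "'f::field poly \<Rightarrow> 'f poly fract poly" where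
  "to_ApTF a \<equiv> [:to_fract a:]"

abbreviation euler_module ::
  "('k::field poly \<Rightarrow> 'f::field) \<Rightarrow> 'k poly \<Rightarrow> ('f poly, 'm) module \<Rightarrow>
     ('f poly fract poly, ('f poly fract poly \<times> 'm \<Rightarrow>\<^sub>0 int) set) module" where
  "euler_module \<gamma> \<pp> M \<equiv> base_change to_ApTF (ring_ApTF \<gamma> \<pp>) M"

abbreviation euler_elem ::
  "('k::field poly \<Rightarrow> 'f::field) \<Rightarrow> 'k poly \<Rightarrow> ('f poly, 'm) module \<Rightarrow> 'm \<Rightarrow>
     ('f poly fract poly \<times> 'm \<Rightarrow>\<^sub>0 int) set" where
  "euler_elem \<gamma> \<pp> M x \<equiv> pure_tensor to_ApTF (ring_ApTF \<gamma> \<pp>) M 1 x"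

text \<open>The natural map from \<open>M\<close> localized at \<open>t - \<theta>\<close>; it exists because \<open>t - \<theta>\<close> divides \<open>\<pp>\<close>.\<close>

definition loc_to_euler ::
  "('k::field poly \<Rightarrow> 'f::field) \<Rightarrow> 'k poly \<Rightarrow> ('f poly, 'm) module \<Rightarrow>
     ('f poly fract \<times> 'm \<Rightarrow>\<^sub>0 int) set \<Rightarrow> ('f poly fract poly \<times> 'm \<Rightarrow>\<^sub>0 int) set" where
  "loc_to_euler \<gamma> \<pp> M = (THE j.
     j \<in> semilinear_maps (ring_theta \<gamma>) (\<lambda>u. [:u:]) (loc_theta \<gamma> M) (euler_module \<gamma> \<pp> M) \<and>
     (\<forall>m\<in>carrier M. j (loc_elem \<gamma> M m) = euler_elem \<gamma> \<pp> M m))"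

text \<open>The \<open>A[1/\<pp>, T]\<close>-linear extension of \<open>m \<mapsto> \<tau>\<^sub>M (\<tau>\<^sup>* m)\<close>, which is linear only over \<open>A\<close>.\<close>

definition euler_map ::
  "('k::{field,finite} poly \<Rightarrow> 'f::{field,finite}) \<Rightarrow> 'k poly \<Rightarrow> ('f poly, 'm) module \<Rightarrow>
     ('f, 'm) motive_map \<Rightarrow>
     ('f poly fract poly \<times> 'm \<Rightarrow>\<^sub>0 int) set \<Rightarrow> ('f poly fract poly \<times> 'm \<Rightarrow>\<^sub>0 int) set" where
  "euler_map \<gamma> \<pp> M \<tau>M = (let q = CARD('k); M' = frob_pullback q M; L = euler_module \<gamma> \<pp> M in
     THE \<Phi>. \<Phi> \<in> linear_maps (ring_ApT \<gamma> \<pp>) L L \<and>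
       (\<forall>m\<in>carrier M. \<Phi> (euler_elem \<gamma> \<pp> M m) =
          loc_to_euler \<gamma> \<pp> M (\<tau>M (loc_elem \<gamma> M' (frob_elem q M m)))))"

definition euler_factor ::
  "('k::{field,finite} poly \<Rightarrow> 'f::{field,finite}) \<Rightarrow> 'k poly \<Rightarrow> ('f poly, 'm) module \<Rightarrow>
     ('f, 'm) motive_map \<Rightarrow> 'f poly fract poly" where
  "euler_factor \<gamma> \<pp> M \<tau>M = (let d = degree \<pp>; L = euler_module \<gamma> \<pp> M in
     endo_det (ring_ApTF \<gamma> \<pp>) L
       (\<lambda>x. x \<ominus>\<^bsub>L\<^esub> monom 1 d \<odot>\<^bsub>L\<^esub> (euler_map \<gamma> \<pp> M \<tau>M ^^ d) x))"

text \<open>The inclusion of \<open>A[T]\<close> into \<open>A[1/\<pp>, T] \<otimes> F\<close>.\<close>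

definition AT_to_ApTF :: "('k::field poly \<Rightarrow> 'f::field) \<Rightarrow> 'k poly poly \<Rightarrow> 'f poly fract poly" where
  "AT_to_ApTF \<gamma> = map_poly (\<lambda>a. to_fract (scalar_ext \<gamma> a))"

end

theory Submission
  imports Defs "Jordan_Normal_Form.Char_Poly"
begin

text \<open>
  Let \<open>\<sigma>\<close> be the Frobenius of \<open>F\<close>, extended by fixing \<open>t\<close> and \<open>T\<close>, and \<open>\<theta> = \<gamma>(t)\<close>. In the basis
  dual to \<open>\<tau>\<^sup>i\<close>, \<open>i < r\<close>, the map of the dual motive is \<open>\<Psi> \<circ> \<sigma>\<close>, where \<open>\<Psi>\<close> is the companion matrix
  with first row \<open>g\<^sub>j / (t - \<theta>)\<close>. Hence the Euler factor is
  \<open>det (1 - T\<^sup>d \<Psi> \<sigma>(\<Psi>) \<dots> \<sigma>\<^sup>d\<^sup>-\<^sup>1(\<Psi>))\<close>. On the other side, \<open>1, \<theta>, \<dots>, \<theta>\<^sup>d\<^sup>-\<^sup>1\<close> is a basis of \<open>F\<close>;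
  conjugating with the Vandermonde matrix of the conjugates \<open>\<theta>\<^sub>m = \<sigma>\<^sup>m(\<theta>)\<close> turns \<open>t - \<phi>\<^sup>\<sim>\<^sub>t\<close> into the
  \<open>d \<times> d\<close> matrix with entries \<open>t - \<theta>\<^sub>m\<close> on the diagonal from which \<open>\<sigma>\<^sup>m(g\<^sub>j) T\<^sup>j\<close> is subtracted at
  \<open>(m, m + j mod d)\<close>. Dividing the rows by \<open>t - \<theta>\<^sub>m\<close> costs the factor \<open>\<Prod>\<^sub>m (t - \<theta>\<^sub>m) = \<pp>\<close>. The two
  remaining determinants agree, because they are obtained from one system of size \<open>r d\<close> by block
  elimination, once with \<open>r\<close> blocks of size \<open>d\<close> and once with \<open>d\<close> blocks of size \<open>r\<close>.
\<close>


section \<open>Determinants over a finite index set\<close>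

text \<open>The objects of the statement are given by unique descriptions: determinants through an
  arbitrary basis, tensor products as quotients of free abelian groups, the maps of the motive, of
  its dual and of the Euler factor by characteristic properties. None can be computed before
  existence and uniqueness are known. One device serves throughout: a free module is handled through
  an additive bijection onto vectors, which passes to base changes and duals, so that maps become
  matrices and pairings become dot products. The entries g_j / (t - \<theta>) arise by transposing
  and inverting the matrix of tau, whose last column expresses tau^r through t = phi_t. The Euler
  map is only required to be linear over A[1/p, T], so its values on a basis do not determine it;
  its values on all elements 1 \<otimes> m do. The system of size r d consists of the equations X_m
  = T \<Psi>_m X_(m+1) on a cycle of length d. Its determinant is taken over a set of pairs, because
  neither order of the two indices is preferred. Both sides are compared in F(t)[T], to which the
  Frobenius extends and where its d-th power is trivial.\<close>

definition index_det :: "'i set \<Rightarrow> ('i \<Rightarrow> 'i \<Rightarrow> 'a::comm_ring_1) \<Rightarrow> 'a" where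
  "index_det I f = (\<Sum>p | p permutes I. of_int (sign p) * (\<Prod>i\<in>I. f i (p i)))"

lemma det_eq_index_det:
  assumes "A \<in> carrier_mat n n"
  shows "det A = index_det {..<n} (\<lambda>i j. A $$ (i, j))"
  unfolding det_def'[OF assms] index_det_def atLeast0LessThan by simp

lemma index_det_eq_det: "index_det {..<n} f = det (mat n n (\<lambda>(i, j). f i j))"
proof -
  have "det (mat n n (\<lambda>(i, j). f i j)) =
      index_det {..<n} (\<lambda>i j. mat n n (\<lambda>(i, j). f i j) $$ (i, j))"
    by (rule det_eq_index_det) simp
  also have "\<dots> = index_det {..<n} f"
    unfolding index_det_def
  proof (rule sum.cong[OF refl])
    fix p :: "nat \<Rightarrow> nat" assume "p \<in> {p. p permutes {..<n}}"
    then have "p i < n" if "i < n" for i using that permutes_in_image[of p "{..<n}" i] by auto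
    then show "of_int (sign p) * (\<Prod>i\<in>{..<n}. mat n n (\<lambda>(i, j). f i j) $$ (i, p i)) =
        of_int (sign p) * (\<Prod>i\<in>{..<n}. f i (p i))"
      by (intro arg_cong[of _ _ "\<lambda>z. _ * z"] prod.cong) auto
  qed
  finally show ?thesis by simp
qed

lemma index_det_cong:
  assumes "\<And>i j. i \<in> I \<Longrightarrow> j \<in> I \<Longrightarrow> f i j = g i j"
  shows "index_det I f = index_det I g"
  unfolding index_det_def
  by (rule sum.cong[OF refl], rule arg_cong[of _ _ "\<lambda>z. _ * z"], rule prod.cong)
     (auto simp: assms permutes_in_image)

text \<open>Transport along \<open>e\<close> is a sign preserving bijection between the permutations
  of \<open>I\<close> and those of \<open>J\<close>, so the two Leibniz sums agree term by
  term.\<close>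

lemma index_det_reindex:
  assumes "bij_betw e I J" "finite I"
  shows "index_det J f = index_det I (\<lambda>i j. f (e i) (e j))"
proof -
  have inj: "inj_on e I" and J: "e ` I = J" using assms(1) by (auto simp: bij_betw_def)
  define g where "g = inv_into I e"
  have ge: "g (e x) = x" if "x \<in> I" for x using inj that by (simp add: g_def)
  have bg: "bij_betw g J I" unfolding g_def by (rule bij_betw_inv_into[OF assms(1)])
  have eg: "e (g x) = x" if "x \<in> J" for x using that J by (auto simp: g_def f_inv_into_f)
  show ?thesis
    unfolding index_det_def
  proof (rule sum.reindex_bij_witness[of _ "map_permutation I e" "map_permutation J g"])
    fix p assume p: "p \<in> {p. p permutes J}"
    show "map_permutation I e (map_permutation J g p) = p"
      using map_permutation_compose_inv[OF bg] p eg by blast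
    show "map_permutation J g p \<in> {p. p permutes I}"
      using map_permutation_permutes[OF bg] p by blast
    have fJ: "finite J" using assms(2) J by blast
    have gJ: "inj_on g J" using bg by (simp add: bij_betw_def)
    have "(\<Prod>i\<in>J. f i (p i)) = (\<Prod>i\<in>I. f (e i) (p (e i)))"
      by (rule prod.reindex_bij_betw[OF assms(1), symmetric])
    also have "\<dots> = (\<Prod>i\<in>I. f (e i) (e (map_permutation J g p i)))"
    proof (rule prod.cong[OF refl])
      fix i assume i: "i \<in> I"
      have ei: "e i \<in> J" using J i by blast
      have "map_permutation J g p (g (e i)) = g (p (e i))"
        by (rule map_permutation_apply[OF gJ ei])
      moreover have "p (e i) \<in> J" using p ei permutes_in_image by fastforce
      ultimately show "f (e i) (p (e i)) = f (e i) (e (map_permutation J g p i))"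
        using ge[OF i] eg by simp
    qed
    finally show "of_int (sign (map_permutation J g p)) *
        (\<Prod>i\<in>I. f (e i) (e (map_permutation J g p i))) = of_int (sign p) * (\<Prod>i\<in>J. f i (p i))"
      using sign_map_permutation[OF gJ _ fJ, of p] p by simp
  next
    fix p assume p: "p \<in> {p. p permutes I}"
    show "map_permutation J g (map_permutation I e p) = p"
      using map_permutation_compose_inv[OF assms(1)] p ge by blast
    show "map_permutation I e p \<in> {p. p permutes J}"
      using map_permutation_permutes[OF assms(1)] p by blast
  qed
qed

text \<open>An enumeration of \<open>I\<close> turns both families into ordinary matrices, for which
  the determinant is multiplicative.\<close>

lemma index_det_mult:
  assumes "finite I"
  shows "index_det I (\<lambda>i j. \<Sum>k\<in>I. f i k * g k j) = index_det I f * index_det I g"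
proof -
  define n where "n = card I"
  obtain e where e: "bij_betw e {..<n} I"
    using ex_bij_betw_nat_finite[OF assms] by (auto simp: n_def atLeast0LessThan)
  define F where "F = mat n n (\<lambda>(i, j). f (e i) (e j))"
  define G where "G = mat n n (\<lambda>(i, j). g (e i) (e j))"
  have "index_det I (\<lambda>i j. \<Sum>k\<in>I. f i k * g k j) =
      index_det {..<n} (\<lambda>i j. \<Sum>k\<in>I. f (e i) k * g k (e j))"
    by (rule index_det_reindex[OF e]) simp
  also have "\<dots> = index_det {..<n} (\<lambda>i j. (F * G) $$ (i, j))"
    by (rule index_det_cong)
       (simp add: F_def G_def scalar_prod_def atLeast0LessThan sum.reindex_bij_betw[OF e, symmetric])
  also have "\<dots> = det (F * G)"
    by (rule det_eq_index_det[symmetric], rule mult_carrier_mat[of _ n n]) (simp_all add: F_def G_def)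
  also have "\<dots> = det F * det G"
    by (rule det_mult[of _ n]) (simp_all add: F_def G_def)
  also have "det F = index_det I f"
    unfolding F_def index_det_reindex[OF e finite_lessThan] index_det_eq_det ..
  also have "det G = index_det I g"
    unfolding G_def index_det_reindex[OF e finite_lessThan] index_det_eq_det ..
  finally show ?thesis .
qed

text \<open>The rows outside \<open>I0\<close> are those of the identity, so a permutation that
  moves a point outside \<open>I0\<close> picks up a zero factor, and all others contribute factors
  1 there.\<close>

lemma index_det_restrict:
  assumes "finite I" "I0 \<subseteq> I"
    and "\<And>i j. i \<in> I - I0 \<Longrightarrow> j \<in> I \<Longrightarrow> f i j = (if i = j then 1 else 0)"
  shows "index_det I f = index_det I0 f"
proof -
  have fin: "finite {p. p permutes I}" by (rule finite_permutations[OF assms(1)])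
  have sub: "{p. p permutes I0} \<subseteq> {p. p permutes I}"
    using permutes_subset[OF _ assms(2)] by blast
  have "index_det I f = (\<Sum>p | p permutes I0. of_int (sign p) * (\<Prod>i\<in>I. f i (p i)))"
    unfolding index_det_def
  proof (rule sum.mono_neutral_right[OF fin sub], rule ballI)
    fix p assume "p \<in> {p. p permutes I} - {p. p permutes I0}"
    then have p: "p permutes I" "\<not> p permutes I0" by auto
    have "\<exists>i\<in>I - I0. p i \<noteq> i"
    proof (rule ccontr)
      assume "\<not> (\<exists>i\<in>I - I0. p i \<noteq> i)"
      then have "p permutes I0" by (intro permutes_superset[OF p(1)]) auto
      with p(2) show False ..
    qed
    then obtain i where i: "i \<in> I - I0" "p i \<noteq> i" by blast
    then have "f i (p i) = 0" using assms(3)[of i "p i"] p(1) by (auto simp: permutes_in_image)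
    then have "(\<Prod>i\<in>I. f i (p i)) = 0"
      using i(1) assms(1) by (intro prod_zero) auto
    then show "of_int (sign p) * (\<Prod>i\<in>I. f i (p i)) = 0" by simp
  qed
  also have "\<dots> = index_det I0 f"
    unfolding index_det_def
  proof (rule sum.cong[OF refl])
    fix p assume "p \<in> {p. p permutes I0}"
    then have p: "p permutes I0" by simp
    have "(\<Prod>i\<in>I. f i (p i)) = (\<Prod>i\<in>I0. f i (p i))"
      by (rule prod.mono_neutral_right[OF assms(1,2)])
         (use assms(2,3) permutes_not_in[OF p] in auto)
    then show "of_int (sign p) * (\<Prod>i\<in>I. f i (p i)) = of_int (sign p) * (\<Prod>i\<in>I0. f i (p i))"
      by simp
  qed
  finally show ?thesis .
qed

text \<open>Ties of \<open>rank\<close> are allowed, as block matrices need: all positions of a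
  block share its rank. A permutation other than the identity moves some \<open>i\<close> without
  lowering its rank, because the sum of all ranks is invariant, and the factor at this
  \<open>i\<close> vanishes.\<close>

lemma index_det_unitriangular:
  fixes rank :: "'i \<Rightarrow> nat"
  assumes "finite I" "\<And>i. i \<in> I \<Longrightarrow> f i i = 1"
    and "\<And>i j. i \<in> I \<Longrightarrow> j \<in> I \<Longrightarrow> i \<noteq> j \<Longrightarrow> rank i \<le> rank j \<Longrightarrow> f i j = 0"
  shows "index_det I f = 1"
proof -
  have fin: "finite {p. p permutes I}" by (rule finite_permutations[OF assms(1)])
  have "index_det I f = (\<Sum>p\<in>{id}. of_int (sign p) * (\<Prod>i\<in>I. f i (p i)))"
    unfolding index_det_def
  proof (rule sum.mono_neutral_right[OF fin])
    show "{id} \<subseteq> {p. p permutes I}" by (simp add: permutes_id)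
    show "\<forall>p\<in>{p. p permutes I} - {id}. of_int (sign p) * (\<Prod>i\<in>I. f i (p i)) = 0"
    proof
      fix p assume "p \<in> {p. p permutes I} - {id}"
      then have p: "p permutes I" "p \<noteq> id" by auto
      have "\<exists>i\<in>I. p i \<noteq> i \<and> rank i \<le> rank (p i)"
      proof (rule ccontr)
        assume *: "\<not> ?thesis"
        then have le: "rank (p i) \<le> rank i" if "i \<in> I" for i
          using that by (metis order_refl nat_le_linear)
        have "\<exists>i\<in>I. p i \<noteq> i"
          using p by (metis eq_id_iff permutes_not_in)
        then obtain i where i: "i \<in> I" "p i \<noteq> i" by blast
        with * have "rank (p i) < rank i" by fastforce
        then have "(\<Sum>i\<in>I. rank (p i)) < (\<Sum>i\<in>I. rank i)"
          by (intro sum_strict_mono_ex1[OF assms(1)]) (use le i in auto)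
        moreover have "(\<Sum>i\<in>I. rank (p i)) = (\<Sum>i\<in>I. rank i)"
          by (rule sum.reindex_bij_betw[OF permutes_imp_bij[OF p(1)]])
        ultimately show False by simp
      qed
      then obtain i where i: "i \<in> I" "p i \<noteq> i" "rank i \<le> rank (p i)" by blast
      then have "f i (p i) = 0" using assms(3)[of i "p i"] p(1) by (auto simp: permutes_in_image)
      then have "(\<Prod>i\<in>I. f i (p i)) = 0"
        using i(1) assms(1) by (intro prod_zero) auto
      then show "of_int (sign p) * (\<Prod>i\<in>I. f i (p i)) = 0" by simp
    qed
  qed
  also have "\<dots> = 1" by (simp add: assms(2))
  finally show ?thesis .
qed


section \<open>Block companion matrices\<close>

primrec down_prod :: "nat \<Rightarrow> (nat \<Rightarrow> 'a::comm_ring_1 mat) \<Rightarrow> nat \<Rightarrow> nat \<Rightarrow> 'a mat" where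
  "down_prod k S l 0 = 1\<^sub>m k"
| "down_prod k S l (Suc e) = S (Suc (l + e)) * down_prod k S l e"

lemma down_prod_carrier:
  assumes "\<And>i. S i \<in> carrier_mat k k"
  shows "down_prod k S l e \<in> carrier_mat k k"
  by (induction e) (auto intro: mult_carrier_mat[OF assms])

text \<open>Positions are pairs (block, place in the block). The matrix belongs to the equations x_i
  = S_i x_(i-1) for i > 0, closed up by one further block equation with coefficients
  \<open>A\<close>. Identity blocks are built in only below the first block row; an identity in the
  first row has to be part of \<open>A 0\<close>.\<close>

definition block_companion ::
  "(nat \<Rightarrow> 'a::comm_ring_1 mat) \<Rightarrow> (nat \<Rightarrow> 'a mat) \<Rightarrow> nat \<times> nat \<Rightarrow> nat \<times> nat \<Rightarrow> 'a" where
  "block_companion A S u v = (if fst u = 0 then A (fst v) $$ (snd u, snd v)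
     else (if u = v then 1 else 0) - (if Suc (fst v) = fst u then S (fst u) $$ (snd u, snd v) else 0))"

lemma mat_mult_index_sum:
  assumes "A \<in> carrier_mat k k" "B \<in> carrier_mat k k" "x < k" "y < k"
  shows "(\<Sum>z<k. A $$ (x, z) * B $$ (z, y)) = (A * B) $$ (x, y)"
  using assms by (simp add: scalar_prod_def atLeast0LessThan)

text \<open>
  Right multiplication by the block unitriangular matrix whose \<open>(i, l)\<close> block is
  \<open>S i * \<dots> * S (l + 1)\<close> clears all blocks below the first block row except the identities on the
  diagonal.
\<close>

lemma index_det_block_companion:
  assumes A: "\<And>i. A i \<in> carrier_mat k k" and S: "\<And>i. S i \<in> carrier_mat k k" and n: "n > 0"
  shows "index_det ({..<n} \<times> {..<k}) (block_companion A S) =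
    det (mat k k (\<lambda>(x, y). \<Sum>j<n. (A j * down_prod k S 0 j) $$ (x, y)))"
proof -
  let ?I = "{..<n} \<times> {..<k}"
  define U where "U u v = (if fst v \<le> fst u
      then down_prod k S (fst v) (fst u - fst v) $$ (snd u, snd v) else 0)" for u v :: "nat \<times> nat"
  note Q = down_prod_carrier[OF S]
  define W where "W u v = (\<Sum>w\<in>?I. block_companion A S u w * U w v)" for u v
  have detU: "index_det ?I U = 1"
  proof (rule index_det_unitriangular[where rank = fst])
    show "U i i = 1" if "i \<in> ?I" for i using that by (auto simp: U_def)
    show "U i j = 0" if "i \<in> ?I" "j \<in> ?I" "i \<noteq> j" "fst i \<le> fst j" for i j
      using that by (auto simp: U_def one_mat_def split: if_splits)
  qed simp
  have W_split: "W u v = (\<Sum>j<n. \<Sum>z<k. block_companion A S u (j, z) * U (j, z) v)" for u v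
    by (simp add: W_def sum.cartesian_product)
  have W0: "W (0, x) (0, y) = (\<Sum>j<n. (A j * down_prod k S 0 j) $$ (x, y))"
    if "x < k" "y < k" for x y
    unfolding W_split
    by (rule sum.cong[OF refl])
       (simp add: block_companion_def U_def mat_mult_index_sum[OF A Q that])
  \<comment> \<open>Block row i > 0 of the product is row i of \<open>U\<close> minus S_i times row
    i - 1 of \<open>U\<close>. By the recursion of \<open>down_prod\<close> the two cancel for l <
    i, and for l = i only the identity block of \<open>U\<close> is left.\<close>
  have Wi: "W (i, x) (l, y) = (if (i, x) = (l, y) then 1 else 0)"
    if i: "0 < i" "i < n" and l: "l < n" and xy: "x < k" "y < k" for i x l y
  proof -
    have "W (i, x) (l, y) = (\<Sum>j<n. \<Sum>z<k. ((if (i, x) = (j, z) then U (j, z) (l, y) else 0)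
         - (if Suc j = i then S i $$ (x, z) * U (j, z) (l, y) else 0)))"
      unfolding W_split using i
      by (intro sum.cong refl) (auto simp: block_companion_def)
    also have "\<dots> = (\<Sum>j<n. \<Sum>z<k. (if (i, x) = (j, z) then U (j, z) (l, y) else 0))
         - (\<Sum>j<n. if j = i - 1 then \<Sum>z<k. S i $$ (x, z) * U (j, z) (l, y) else 0)"
      unfolding sum_subtractf
      by (intro arg_cong2[of _ _ _ _ "(-)"] refl sum.cong) (use i in \<open>auto intro!: sum.neutral\<close>)
    also have "(\<Sum>j<n. \<Sum>z<k. (if (i, x) = (j, z) then U (j, z) (l, y) else 0)) =
        (\<Sum>j<n. if j = i then \<Sum>z<k. if z = x then U (j, z) (l, y) else 0 else 0)"
      by (intro sum.cong refl) (auto intro!: sum.cong sum.neutral)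
    also have "\<dots> = U (i, x) (l, y)" using i xy by (simp add: sum.delta)
    also have "(\<Sum>j<n. if j = i - 1 then \<Sum>z<k. S i $$ (x, z) * U (j, z) (l, y) else 0) =
        (\<Sum>z<k. S i $$ (x, z) * U (i - 1, z) (l, y))"
      using i by (simp add: sum.delta)
    also have "\<dots> = (if l < i then U (i, x) (l, y) else 0)"
    proof (cases "l < i")
      case True
      then obtain e where e: "i = Suc (l + e)" using less_imp_Suc_add by blast
      have "(\<Sum>z<k. S i $$ (x, z) * U (i - 1, z) (l, y)) =
          (\<Sum>z<k. S i $$ (x, z) * down_prod k S l e $$ (z, y))"
        by (simp add: U_def e)
      also have "\<dots> = (S i * down_prod k S l e) $$ (x, y)"
        by (rule mat_mult_index_sum[OF S Q xy])
      also have "\<dots> = U (i, x) (l, y)" by (simp add: U_def e Suc_diff_le)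
      finally show ?thesis using True by simp
    qed (use i in \<open>auto simp: U_def intro!: sum.neutral\<close>)
    also have "U (i, x) (l, y) - (if l < i then U (i, x) (l, y) else 0) =
        (if (i, x) = (l, y) then 1 else 0)"
      using xy by (auto simp: U_def)
    finally show ?thesis .
  qed
  have "index_det ?I (block_companion A S) = index_det ?I W"
    using index_det_mult[of ?I "block_companion A S" U] detU by (simp add: W_def[abs_def])
  also have "\<dots> = index_det ({0} \<times> {..<k}) W"
  proof (rule index_det_restrict)
    show "W u v = (if u = v then 1 else 0)" if "u \<in> ?I - {0} \<times> {..<k}" "v \<in> ?I" for u v
      using that Wi[of "fst u" "fst v" "snd u" "snd v"] by (cases u; cases v) auto
  qed (use n in auto)
  also have "\<dots> = index_det {..<k} (\<lambda>x y. W (0, x) (0, y))"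
    by (rule index_det_reindex) (auto simp: bij_betw_def inj_on_def)
  also have "\<dots> = det (mat k k (\<lambda>(x, y). W (0, x) (0, y)))"
    by (rule index_det_eq_det)
  also have "mat k k (\<lambda>(x, y). W (0, x) (0, y)) =
      mat k k (\<lambda>(x, y). \<Sum>j<n. (A j * down_prod k S 0 j) $$ (x, y))"
    by (rule eq_matI) (auto simp: W0)
  finally show ?thesis .
qed


section \<open>The determinant of a cyclic recurrence\<close>

lemma smult_smult_mat: "(a::'a::semigroup_mult) \<cdot>\<^sub>m (b \<cdot>\<^sub>m A) = (a * b) \<cdot>\<^sub>m A"
  by (rule eq_matI) (simp_all add: mult.assoc)

text \<open>New factors go to the right, as in the iterates of a semilinear map: the powers of
  \<Psi> sigma are \<Psi> sigma(\<Psi>) sigma^2(\<Psi>) ... followed by a power of sigma.\<close>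

primrec seq_prod :: "nat \<Rightarrow> (nat \<Rightarrow> 'a::comm_ring_1 mat) \<Rightarrow> nat \<Rightarrow> 'a mat" where
  "seq_prod r \<Psi> 0 = 1\<^sub>m r"
| "seq_prod r \<Psi> (Suc m) = seq_prod r \<Psi> m * \<Psi> m"

lemma seq_prod_carrier:
  assumes "\<And>m. \<Psi> m \<in> carrier_mat r r"
  shows "seq_prod r \<Psi> m \<in> carrier_mat r r"
  by (induction m) (auto intro: mult_carrier_mat[OF _ assms])

text \<open>One step of a linear recurrence on the last \<open>r\<close> values: entry 0 receives
  the combination with coefficients a_1, ..., a_r, and the old entries move down by one
  place.\<close>

definition recurrence_mat :: "nat \<Rightarrow> (nat \<Rightarrow> 'a::comm_ring_1) \<Rightarrow> 'a mat" where
  "recurrence_mat r a =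
     mat r r (\<lambda>(i, j). if i = 0 then a (Suc j) else if i = Suc j then 1 else 0)"

lemma recurrence_mat_carrier [simp]: "recurrence_mat r a \<in> carrier_mat r r"
  by (simp add: recurrence_mat_def)

text \<open>The matrix of the equations X_m = T R_m X_(m+1) for vectors of length \<open>r\<close>
  on a cycle of length \<open>d\<close>, with R_m the recurrence matrix at m. The position (i, m) is
  entry i of X_m.\<close>

definition cyclic_system ::
  "nat \<Rightarrow> nat \<Rightarrow> 'a::comm_ring_1 \<Rightarrow> (nat \<Rightarrow> nat \<Rightarrow> 'a) \<Rightarrow> nat \<times> nat \<Rightarrow> nat \<times> nat \<Rightarrow> 'a" where
  "cyclic_system d r T a u v = (if u = v then 1 else 0) -
     (if snd v = Suc (snd u) mod d
      then T * recurrence_mat r (\<lambda>j. a j (snd u)) $$ (fst u, fst v) else 0)"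

text \<open>For i > 0 the equations read x(i, m) = T x(i-1, m+1), so elimination with blocks of size
  \<open>d\<close> keeps i = 0 alone. The block \<open>S\<close> is T times the cyclic shift; j
  steps give T^j times the shift by j.\<close>

lemma index_det_cyclic_system_eq_shift:
  fixes a :: "nat \<Rightarrow> nat \<Rightarrow> 'a::comm_ring_1"
  assumes d: "d > 0" and r: "r > 0"
  shows "index_det ({..<r} \<times> {..<d}) (cyclic_system d r T a) =
    det (mat d d (\<lambda>(m, m'). (if m = m' then 1 else 0) -
      (\<Sum>j<r. if m' = (m + Suc j) mod d then T ^ Suc j * a (Suc j) m else 0)))"
proof -
  \<comment> \<open>The left side x(0, m) of the remaining equation sits in block 0. For d = 1 it
    shares its place with the coefficient of x(0, m+1), hence a difference of two
    conditionals.\<close>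
  define A where "A j = mat d d (\<lambda>(m, m'). (if j = 0 \<and> m = m' then 1 else 0) -
    (if m' = Suc m mod d then T * a (Suc j) m else 0))" for j
  define S where "S = (\<lambda>i::nat. mat d d (\<lambda>(m, m'). if m' = Suc m mod d then T else 0))"
  have Ac: "A j \<in> carrier_mat d d" for j by (simp add: A_def)
  have Sc: "S j \<in> carrier_mat d d" for j by (simp add: S_def)
  have S_index: "S i $$ (m, z) = (if z = Suc m mod d then T else 0)" if "m < d" "z < d" for i m z
    using that by (simp add: S_def)
  have P: "down_prod d S 0 j = mat d d (\<lambda>(m, m'). if m' = (m + j) mod d then T ^ j else 0)" for j
  proof (induction j)
    case 0
    show ?case by (rule eq_matI) auto
  next
    case (Suc j)
    show ?case
    proof (rule eq_matI)
      fix m m' assume "m < dim_row (mat d d (\<lambda>(m, m'). if m' = (m + Suc j) mod d then T ^ Suc j else 0))"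
        "m' < dim_col (mat d d (\<lambda>(m, m'). if m' = (m + Suc j) mod d then T ^ Suc j else 0))"
      then have m: "m < d" "m' < d" by auto
      have "down_prod d S 0 (Suc j) $$ (m, m') =
          (\<Sum>z<d. S (Suc j) $$ (m, z) * down_prod d S 0 j $$ (z, m'))"
        by (simp add: mat_mult_index_sum[OF Sc down_prod_carrier[OF Sc] m])
      also have "\<dots> = (\<Sum>z<d. if z = Suc m mod d
          then T * (if m' = (z + j) mod d then T ^ j else 0) else 0)"
        by (rule sum.cong) (use m in \<open>auto simp: Suc.IH S_index\<close>)
      also have "\<dots> = T * (if m' = (Suc m mod d + j) mod d then T ^ j else 0)"
        using d by (simp add: sum.delta)
      also have "\<dots> = (if m' = (m + Suc j) mod d then T ^ Suc j else 0)"
        by (simp add: mod_simps)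
      finally show "down_prod d S 0 (Suc j) $$ (m, m') =
          mat d d (\<lambda>(m, m'). if m' = (m + Suc j) mod d then T ^ Suc j else 0) $$ (m, m')"
        using m by simp
    qed (simp_all add: carrier_matD[OF down_prod_carrier[OF Sc]] del: down_prod.simps)
  qed
  have AP: "(A j * down_prod d S 0 j) $$ (m, m') = (if j = 0 \<and> m = m' then 1 else 0) -
      (if m' = (m + Suc j) mod d then T ^ Suc j * a (Suc j) m else 0)"
    if m: "m < d" "m' < d" for j m m'
  proof -
    have "(A j * down_prod d S 0 j) $$ (m, m') = (\<Sum>z<d. A j $$ (m, z) * down_prod d S 0 j $$ (z, m'))"
      by (simp add: mat_mult_index_sum[OF Ac down_prod_carrier[OF Sc] m])
    also have "\<dots> = (\<Sum>z<d. (if z = m then (if j = 0 \<and> m' = (z + j) mod d then 1 else 0) else 0) -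
        (if z = Suc m mod d
         then T * a (Suc j) m * (if m' = (z + j) mod d then T ^ j else 0) else 0))"
      by (rule sum.cong) (use m in \<open>auto simp: P A_def\<close>)
    also have "\<dots> = (if j = 0 \<and> m' = (m + j) mod d then 1 else 0) -
        T * a (Suc j) m * (if m' = (Suc m mod d + j) mod d then T ^ j else 0)"
      using d m by (simp add: sum_subtractf sum.delta)
    also have "\<dots> = (if j = 0 \<and> m = m' then 1 else 0) -
        (if m' = (m + Suc j) mod d then T ^ Suc j * a (Suc j) m else 0)"
      using m by (auto simp: mod_simps mult_ac)
    finally show ?thesis .
  qed
  have "index_det ({..<r} \<times> {..<d}) (cyclic_system d r T a) =
      index_det ({..<r} \<times> {..<d}) (block_companion A S)"
    by (rule index_det_cong)
       (auto simp: cyclic_system_def block_companion_def A_def S_def recurrence_mat_def)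
  also have "\<dots> = det (mat d d (\<lambda>(m, m'). \<Sum>j<r. (A j * down_prod d S 0 j) $$ (m, m')))"
    by (rule index_det_block_companion[OF Ac Sc r])
  also have "mat d d (\<lambda>(m, m'). \<Sum>j<r. (A j * down_prod d S 0 j) $$ (m, m')) =
      mat d d (\<lambda>(m, m'). (if m = m' then 1 else 0) -
        (\<Sum>j<r. if m' = (m + Suc j) mod d then T ^ Suc j * a (Suc j) m else 0))"
  proof (rule cong_mat[OF refl refl], clarify)
    fix m m' assume m: "m < d" "m' < d"
    have "(\<Sum>j<r. (A j * down_prod d S 0 j) $$ (m, m')) =
        (\<Sum>j<r. if j = 0 then (if m = m' then 1 else 0) else 0) -
        (\<Sum>j<r. if m' = (m + Suc j) mod d then T ^ Suc j * a (Suc j) m else 0)"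
      unfolding sum_subtractf[symmetric] by (rule sum.cong) (auto simp: AP[OF m])
    then show "(\<Sum>j<r. (A j * down_prod d S 0 j) $$ (m, m')) = (if m = m' then 1 else 0) -
        (\<Sum>j<r. if m' = (m + Suc j) mod d then T ^ Suc j * a (Suc j) m else 0)"
      using r by (simp add: sum.delta)
  qed
  finally show ?thesis .
qed

text \<open>Elimination now runs along the cycle: X_(d-1), X_(d-2), ..., X_1 are expressed
  successively through X_0, and going once around leaves X_0 = T^d R_0 R_1 ... R_(d-1) X_0.\<close>

lemma index_det_cyclic_system_eq_monodromy:
  fixes a :: "nat \<Rightarrow> nat \<Rightarrow> 'a::comm_ring_1"
  assumes d: "d > 0" and r: "r > 0"
  shows "index_det ({..<r} \<times> {..<d}) (cyclic_system d r T a) =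
    det (1\<^sub>m r - T ^ d \<cdot>\<^sub>m seq_prod r (\<lambda>m. recurrence_mat r (\<lambda>j. a j m)) d)"
proof -
  define \<Psi> where "\<Psi> = (\<lambda>m. recurrence_mat r (\<lambda>j. a j m))"
  have \<Psi>c: "\<Psi> m \<in> carrier_mat r r" for m by (simp add: \<Psi>_def)
  note sc = seq_prod_carrier[of \<Psi>, OF \<Psi>c]
  \<comment> \<open>The remaining equation is X_0 = T \<Psi>_0 X_1, where X_1 is block d - 1 in the
    reversed numbering. For d = 1 both terms fall on block 0.\<close>
  define A where "A b = (if b = 0 then 1\<^sub>m r else 0\<^sub>m r r) -
    (if Suc b = d then T \<cdot>\<^sub>m \<Psi> 0 else 0\<^sub>m r r)" for b
  define S where "S b = T \<cdot>\<^sub>m \<Psi> (d - b)" for b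
  have Ac: "A j \<in> carrier_mat r r" for j
    unfolding A_def by (intro minus_carrier_mat) (auto simp: \<Psi>c)
  have Sc: "S j \<in> carrier_mat r r" for j by (simp add: S_def \<Psi>c)
  note Pc = down_prod_carrier[of S, OF Sc]
  \<comment> \<open>Only b = d - 1 is needed in the end. Multiplying by the missing initial factors
    makes the claim inductive: each step moves one factor from the prefix to the elimination
    product.\<close>
  have P: "seq_prod r \<Psi> (d - b) * down_prod r S 0 b = T ^ b \<cdot>\<^sub>m seq_prod r \<Psi> d" if "b \<le> d" for b
    using that
  proof (induction b)
    case 0
    show ?case using sc[of d] by (auto intro: eq_matI)
  next
    case (Suc b)
    then obtain c where c: "d - b = Suc c" "d - Suc b = c"
      by (metis Suc_diff_le diff_Suc_Suc)
    have "seq_prod r \<Psi> (d - Suc b) * down_prod r S 0 (Suc b) =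
        seq_prod r \<Psi> c * (T \<cdot>\<^sub>m (\<Psi> c * down_prod r S 0 b))"
      unfolding c by (simp add: S_def c mult_smult_assoc_mat[OF \<Psi>c Pc])
    also have "\<dots> = T \<cdot>\<^sub>m (seq_prod r \<Psi> c * (\<Psi> c * down_prod r S 0 b))"
      by (rule mult_smult_distrib[OF sc mult_carrier_mat[OF \<Psi>c Pc]])
    also have "seq_prod r \<Psi> c * (\<Psi> c * down_prod r S 0 b) = seq_prod r \<Psi> (d - b) * down_prod r S 0 b"
      unfolding c by (simp add: assoc_mult_mat[OF sc \<Psi>c Pc])
    also have "T \<cdot>\<^sub>m (seq_prod r \<Psi> (d - b) * down_prod r S 0 b) = T ^ Suc b \<cdot>\<^sub>m seq_prod r \<Psi> d"
      using Suc by (simp add: smult_smult_mat)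
    finally show ?case .
  qed
  have "index_det ({..<r} \<times> {..<d}) (cyclic_system d r T a) =
      index_det ({..<d} \<times> {..<r}) (\<lambda>u v. cyclic_system d r T a
        (snd u, (d - fst u) mod d) (snd v, (d - fst v) mod d))"
  \<comment> \<open>The cycle is numbered backwards, b standing for m = -b mod d, because
    \<open>block_companion\<close> expresses a block by its predecessor whereas X_m is expressed by
    X_(m+1).\<close>
  proof (rule index_det_reindex[where e = "\<lambda>u. (snd u, (d - fst u) mod d)"])
    have inj: "b = b'" if "(d - b) mod d = (d - b') mod d" "b < d" "b' < d" for b b'
      using that by (cases "b = 0"; cases "b' = 0") auto
    have surj: "\<exists>b<d. m = (d - b) mod d" if "m < d" for m
      using that by (intro exI[of _ "if m = 0 then 0 else d - m"]) auto
    show "bij_betw (\<lambda>u. (snd u, (d - fst u) mod d)) ({..<d} \<times> {..<r}) ({..<r} \<times> {..<d})"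
      unfolding bij_betw_def
    proof
      show "inj_on (\<lambda>u. (snd u, (d - fst u) mod d)) ({..<d} \<times> {..<r})"
        by (auto simp: inj_on_def intro: inj)
      show "(\<lambda>u. (snd u, (d - fst u) mod d)) ` ({..<d} \<times> {..<r}) = {..<r} \<times> {..<d}"
        using d surj by (fastforce simp: image_iff)
    qed
  qed simp
  also have "\<dots> = index_det ({..<d} \<times> {..<r}) (block_companion A S)"
  proof (rule index_det_cong)
    fix u v assume "u \<in> {..<d} \<times> {..<r}" "v \<in> {..<d} \<times> {..<r}"
    then obtain b i b' i' where uv: "u = (b, i)" "v = (b', i')" and b: "b < d" "b' < d"
      and i: "i < r" "i' < r"
      by auto
    have eq: "(d - b) mod d = (d - b') mod d \<longleftrightarrow> b = b'"
      using b by (cases "b = 0"; cases "b' = 0") auto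
    show "cyclic_system d r T a (snd u, (d - fst u) mod d) (snd v, (d - fst v) mod d) =
        block_companion A S u v"
    proof (cases "b = 0")
      case True
      define m' o1 where "m' = (d - b') mod d" and "o1 = Suc 0 mod d"
      have m'v: "m' = (if b' = 0 then 0 else d - b')" using b by (simp add: m'_def)
      have o1v: "o1 = (if d = 1 then 0 else 1)" using d by (auto simp: o1_def)
      have m': "m' = o1 \<longleftrightarrow> Suc b' = d" "0 = m' \<longleftrightarrow> 0 = b'"
        unfolding m'v o1v using b by auto
      have "cyclic_system d r T a (i, 0) (i', m') = block_companion A S (0, i) (b', i')"
        unfolding cyclic_system_def block_companion_def A_def \<Psi>_def fst_conv snd_conv prod.inject m'
          o1_def[symmetric]
        using i by (simp add: recurrence_mat_def m')
      then show ?thesis using True by (simp add: m'_def uv)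
    next
      case False
      have *: "(d - b') mod d = Suc (d - b) mod d \<longleftrightarrow> Suc b' = b"
      proof (cases "b' = 0")
        case True
        then show ?thesis using b False
          by (cases "b = 1") (auto simp: mod_if)
      next
        case b': False
        show ?thesis
        proof (cases "b = 1")
          case True
          then show ?thesis using b b' by auto
        next
          case b1: False
          have "Suc (d - b) < d" using b b1 False by auto
          then show ?thesis using b b' False by auto
        qed
      qed
      have "(d - b) mod d = d - b" using False b by auto
      moreover define m' o1 where "m' = (d - b') mod d" and "o1 = Suc (d - b) mod d"
      ultimately have m': "m' = o1 \<longleftrightarrow> Suc b' = b" "d - b = m' \<longleftrightarrow> b = b'"
        using * eq by simp_all
      have "cyclic_system d r T a (i, d - b) (i', m') = block_companion A S (b, i) (b', i')"
        unfolding cyclic_system_def block_companion_def S_def \<Psi>_def fst_conv snd_conv prod.inject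
          o1_def[symmetric] m'
        using i False by (auto simp: recurrence_mat_def)
      then show ?thesis using \<open>(d - b) mod d = d - b\<close> by (simp add: m'_def uv)
    qed
  qed
  also have "\<dots> = det (mat r r (\<lambda>(x, y). \<Sum>b<d. (A b * down_prod r S 0 b) $$ (x, y)))"
    by (rule index_det_block_companion[OF Ac Sc d])
  also have "mat r r (\<lambda>(x, y). \<Sum>b<d. (A b * down_prod r S 0 b) $$ (x, y)) =
      1\<^sub>m r - T ^ d \<cdot>\<^sub>m seq_prod r \<Psi> d"
  proof (rule eq_matI)
    fix x y assume "x < dim_row (1\<^sub>m r - T ^ d \<cdot>\<^sub>m seq_prod r \<Psi> d)"
      "y < dim_col (1\<^sub>m r - T ^ d \<cdot>\<^sub>m seq_prod r \<Psi> d)"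
    then have xy: "x < r" "y < r" using sc[of d] by auto
    have AP: "(A b * down_prod r S 0 b) $$ (x, y) = (if b = 0 then 1\<^sub>m r $$ (x, y) else 0) -
        (if b = d - 1 then (T ^ d \<cdot>\<^sub>m seq_prod r \<Psi> d) $$ (x, y) else 0)" if "b < d" for b
    proof -
      have "A b * down_prod r S 0 b = (if b = 0 then 1\<^sub>m r else 0\<^sub>m r r) * down_prod r S 0 b -
          (if Suc b = d then T \<cdot>\<^sub>m \<Psi> 0 else 0\<^sub>m r r) * down_prod r S 0 b"
        unfolding A_def by (rule minus_mult_distrib_mat[OF _ _ Pc]) (auto simp: \<Psi>c)
      also have "(if b = 0 then 1\<^sub>m r else 0\<^sub>m r r) * down_prod r S 0 b =
          (if b = 0 then 1\<^sub>m r else 0\<^sub>m r r)"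
        using Pc[of 0 b] by auto
      also have "(if Suc b = d then T \<cdot>\<^sub>m \<Psi> 0 else 0\<^sub>m r r) * down_prod r S 0 b =
          (if b = d - 1 then T ^ d \<cdot>\<^sub>m seq_prod r \<Psi> d else 0\<^sub>m r r)"
      proof (cases "Suc b = d")
        case True
        have db: "d - b = Suc 0" "b \<le> d" "b = d - 1" using True by auto
        have "seq_prod r \<Psi> (Suc 0) * down_prod r S 0 b = T ^ b \<cdot>\<^sub>m seq_prod r \<Psi> d"
          using P[OF db(2)] unfolding db(1) .
        then have "\<Psi> 0 * down_prod r S 0 b = T ^ b \<cdot>\<^sub>m seq_prod r \<Psi> d"
          using \<Psi>c[of 0] by simp
        then have "(T \<cdot>\<^sub>m \<Psi> 0) * down_prod r S 0 b = T ^ Suc b \<cdot>\<^sub>m seq_prod r \<Psi> d"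
          by (simp add: mult_smult_assoc_mat[OF \<Psi>c Pc] smult_smult_mat)
        then show ?thesis using db(3) unfolding True by simp
      qed (use Pc[of 0 b] d in auto)
      finally show ?thesis using xy sc[of d] by auto
    qed
    have "(\<Sum>b<d. (A b * down_prod r S 0 b) $$ (x, y)) =
        1\<^sub>m r $$ (x, y) - (T ^ d \<cdot>\<^sub>m seq_prod r \<Psi> d) $$ (x, y)"
      using d by (simp add: AP sum_subtractf sum.delta)
    then show "mat r r (\<lambda>(x, y). \<Sum>b<d. (A b * down_prod r S 0 b) $$ (x, y)) $$ (x, y) =
        (1\<^sub>m r - T ^ d \<cdot>\<^sub>m seq_prod r \<Psi> d) $$ (x, y)"
      using xy sc[of d] by simp
  qed (use sc[of d] in auto)
  finally show ?thesis by (simp add: \<Psi>_def)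
qed


section \<open>Modules with coordinates\<close>

definition subring_set :: "'s::comm_ring_1 set \<Rightarrow> bool" where
  "subring_set S \<longleftrightarrow> 0 \<in> S \<and> 1 \<in> S \<and> (\<forall>x\<in>S. \<forall>y\<in>S. x + y \<in> S \<and> x * y \<in> S) \<and> (\<forall>x\<in>S. - x \<in> S)"

lemma subring_set_UNIV [simp]: "subring_set UNIV"
  by (simp add: subring_set_def)

lemma subring_setD:
  assumes "subring_set S"
  shows "0 \<in> S" "1 \<in> S" "x \<in> S \<Longrightarrow> y \<in> S \<Longrightarrow> x + y \<in> S" "x \<in> S \<Longrightarrow> y \<in> S \<Longrightarrow> x * y \<in> S"
    "x \<in> S \<Longrightarrow> - x \<in> S" "x \<in> S \<Longrightarrow> y \<in> S \<Longrightarrow> x - y \<in> S"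
  using assms unfolding subring_set_def
  by (auto simp: diff_conv_add_uminus simp del: add_uminus_conv_diff)

lemma subring_set_sum:
  assumes "subring_set S" "\<And>i. i \<in> I \<Longrightarrow> f i \<in> S"
  shows "sum f I \<in> S"
  using assms(2) by (induction I rule: infinite_finite_induct) (auto simp: subring_setD[OF assms(1)])

definition vecs :: "'s::comm_ring_1 set \<Rightarrow> nat \<Rightarrow> 's vec set" where
  "vecs S n = {v \<in> carrier_vec n. \<forall>i<n. v $ i \<in> S}"

definition mats :: "'s::comm_ring_1 set \<Rightarrow> nat \<Rightarrow> nat \<Rightarrow> 's mat set" where
  "mats S m n = {A \<in> carrier_mat m n. \<forall>i<m. \<forall>j<n. A $$ (i, j) \<in> S}"

lemma mult_mat_vec_index_sum:
  assumes "A \<in> carrier_mat m n" "v \<in> carrier_vec n" "i < m"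
  shows "(A *\<^sub>v v) $ i = (\<Sum>j<n. A $$ (i, j) * v $ j)"
  using assms by (simp add: scalar_prod_def atLeast0LessThan)

lemma mult_mat_vec_vecs:
  assumes "subring_set S" "A \<in> mats S m n" "v \<in> vecs S n"
  shows "A *\<^sub>v v \<in> vecs S m"
proof -
  have A: "A \<in> carrier_mat m n" and v: "v \<in> carrier_vec n"
    using assms by (auto simp: mats_def vecs_def)
  have "(A *\<^sub>v v) $ i \<in> S" if "i < m" for i
    unfolding mult_mat_vec_index_sum[OF A v that]
    using assms that by (intro subring_set_sum subring_setD(4)) (auto simp: mats_def vecs_def)
  then show ?thesis using A v by (auto simp: vecs_def)
qed

lemma mult_mat_unit_vec:
  fixes A :: "'a::comm_ring_1 mat"
  assumes "A \<in> carrier_mat m n" "j < n"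
  shows "A *\<^sub>v unit_vec n j = col A j"
proof (rule eq_vecI)
  fix i assume "i < dim_vec (col A j)"
  then have "i < m" using assms by simp
  then show "(A *\<^sub>v unit_vec n j) $ i = col A j $ i"
    using assms scalar_prod_right_unit[OF assms(2), of "row A i"] by simp
qed (use assms in simp)

lemma mat_eq_if_mult_unit_vec_eq:
  fixes A :: "'a::comm_ring_1 mat"
  assumes "A \<in> carrier_mat m n" "B \<in> carrier_mat m n"
    and "\<And>j. j < n \<Longrightarrow> A *\<^sub>v unit_vec n j = B *\<^sub>v unit_vec n j"
  shows "A = B"
proof (rule eq_matI)
  fix i j assume "i < dim_row B" "j < dim_col B"
  then have ij: "i < m" "j < n" using assms by auto
  have "col A j = col B j"
    using assms(3)[OF ij(2)] mult_mat_unit_vec[OF assms(1) ij(2)] mult_mat_unit_vec[OF assms(2) ij(2)]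
    by simp
  then have "col A j $ i = col B j $ i" by simp
  then show "A $$ (i, j) = B $$ (i, j)" using ij assms(1,2) by auto
qed (use assms in auto)

text \<open>Padding with zeros gives square matrices whose product is the identity, although one of them
  has a zero row.\<close>

lemma left_inverse_mat_dim_le:
  fixes P :: "'a::comm_ring_1 mat"
  assumes P: "P \<in> carrier_mat n m" and Q: "Q \<in> carrier_mat m n" and QP: "Q * P = 1\<^sub>m m"
  shows "m \<le> n"
proof (rule ccontr)
  assume "\<not> m \<le> n"
  then have nm: "n < m" by simp
  define P' where "P' = mat m m (\<lambda>(i, j). if i < n then P $$ (i, j) else 0)"
  define Q' where "Q' = mat m m (\<lambda>(i, j). if j < n then Q $$ (i, j) else 0)"
  have c: "P' \<in> carrier_mat m m" "Q' \<in> carrier_mat m m" by (auto simp: P'_def Q'_def)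
  have "Q' * P' = 1\<^sub>m m"
  proof (rule eq_matI)
    fix i j assume "i < dim_row (1\<^sub>m m)" "j < dim_col (1\<^sub>m m)"
    then have ij: "i < m" "j < m" by auto
    have "(Q' * P') $$ (i, j) = (\<Sum>k<m. if k < n then Q $$ (i, k) * P $$ (k, j) else 0)"
      using ij by (auto simp: P'_def Q'_def scalar_prod_def atLeast0LessThan intro!: sum.cong)
    also have "\<dots> = (\<Sum>k<n. Q $$ (i, k) * P $$ (k, j))"
      by (rule sum.mono_neutral_cong_right) (use nm in auto)
    also have "\<dots> = (Q * P) $$ (i, j)"
      using ij P Q by (simp add: scalar_prod_def atLeast0LessThan)
    finally show "(Q' * P') $$ (i, j) = 1\<^sub>m m $$ (i, j)" using QP by simp
  qed (use c in auto)
  then have 1: "det Q' * det P' = 1"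
    using det_mult[OF c(2,1)] by simp
  have "det P' = 0"
    unfolding det_def'[OF c(1)]
  proof (rule sum.neutral, rule ballI)
    fix p assume "p \<in> {p. p permutes {0..<m}}"
    then have "p n < m" using nm permutes_in_image[of p "{0..<m}" n] by auto
    then have "P' $$ (n, p n) = 0" using nm by (simp add: P'_def)
    then have "(\<Prod>i = 0..<m. P' $$ (i, p i)) = 0"
      using nm by (intro prod_zero bexI[of _ n]) auto
    then show "signof p * (\<Prod>i = 0..<m. P' $$ (i, p i)) = 0" by simp
  qed
  with 1 show False by simp
qed

text \<open>A free module is presented by \<kappa> rather than by a basis, since the modules at hand
  consist of functions or cosets whose identities are best checked on vectors. Beyond closure no
  module laws are assumed; they are inherited from vectors through injectivity of \<kappa>.\<close>

locale coordinates =
  fixes S :: "'s::comm_ring_1 set" and M :: "('s, 'm) module" and n :: nat and \<kappa> :: "'m \<Rightarrow> 's vec"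
  assumes ring: "subring_set S"
    and bij: "bij_betw \<kappa> (carrier M) (vecs S n)"
    and zero_closed: "\<zero>\<^bsub>M\<^esub> \<in> carrier M"
    and add_closed: "x \<in> carrier M \<Longrightarrow> y \<in> carrier M \<Longrightarrow> x \<oplus>\<^bsub>M\<^esub> y \<in> carrier M"
    and smult_closed: "s \<in> S \<Longrightarrow> x \<in> carrier M \<Longrightarrow> s \<odot>\<^bsub>M\<^esub> x \<in> carrier M"
    and coord_zero: "\<kappa> \<zero>\<^bsub>M\<^esub> = 0\<^sub>v n"
    and coord_add: "x \<in> carrier M \<Longrightarrow> y \<in> carrier M \<Longrightarrow> \<kappa> (x \<oplus>\<^bsub>M\<^esub> y) = \<kappa> x + \<kappa> y"
    and coord_smult: "s \<in> S \<Longrightarrow> x \<in> carrier M \<Longrightarrow> \<kappa> (s \<odot>\<^bsub>M\<^esub> x) = s \<cdot>\<^sub>v \<kappa> x"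
begin

definition of_coord :: "'s vec \<Rightarrow> 'm" where
  "of_coord v = inv_into (carrier M) \<kappa> v"

definition basis_elem :: "nat \<Rightarrow> 'm" where
  "basis_elem i = of_coord (unit_vec n i)"

lemma coord_vecs: "x \<in> carrier M \<Longrightarrow> \<kappa> x \<in> vecs S n"
  using bij by (auto simp: bij_betw_def)

lemma coord_carrier [simp]: "x \<in> carrier M \<Longrightarrow> \<kappa> x \<in> carrier_vec n"
  using coord_vecs by (auto simp: vecs_def)

lemma dim_coord [simp]: "x \<in> carrier M \<Longrightarrow> dim_vec (\<kappa> x) = n"
  using coord_carrier by (rule carrier_vecD)

lemma coord_entry: "x \<in> carrier M \<Longrightarrow> i < n \<Longrightarrow> \<kappa> x $ i \<in> S"
  using coord_vecs by (auto simp: vecs_def)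

lemma coord_inj: "x \<in> carrier M \<Longrightarrow> y \<in> carrier M \<Longrightarrow> \<kappa> x = \<kappa> y \<Longrightarrow> x = y"
  using bij by (auto simp: bij_betw_def inj_on_def)

lemma of_coord_closed: "v \<in> vecs S n \<Longrightarrow> of_coord v \<in> carrier M"
  using bij unfolding of_coord_def bij_betw_def by (metis inv_into_into)

lemma coord_of_coord: "v \<in> vecs S n \<Longrightarrow> \<kappa> (of_coord v) = v"
  using bij unfolding of_coord_def bij_betw_def by (metis f_inv_into_f)

lemma unit_vec_vecs: "unit_vec n i \<in> vecs S n"
  using subring_setD[OF ring] by (auto simp: vecs_def unit_vec_def)

lemma basis_elem_closed [simp]: "basis_elem i \<in> carrier M"
  unfolding basis_elem_def by (rule of_coord_closed[OF unit_vec_vecs])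

lemma coord_basis_elem [simp]: "\<kappa> (basis_elem i) = unit_vec n i"
  unfolding basis_elem_def by (rule coord_of_coord[OF unit_vec_vecs])

lemma abelian_group: "abelian_group M"
proof (rule abelian_groupI)
  note c = zero_closed add_closed coord_inj
  fix x y z assume x: "x \<in> carrier M" and y: "y \<in> carrier M" and z: "z \<in> carrier M"
  show "x \<oplus>\<^bsub>M\<^esub> y \<oplus>\<^bsub>M\<^esub> z = x \<oplus>\<^bsub>M\<^esub> (y \<oplus>\<^bsub>M\<^esub> z)"
    by (rule coord_inj)
       (simp_all add: add_closed x y z coord_add assoc_add_vec[of _ n])
  show "x \<oplus>\<^bsub>M\<^esub> y = y \<oplus>\<^bsub>M\<^esub> x"
    by (rule coord_inj)
       (simp_all add: add_closed x y coord_add comm_add_vec[of _ n])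
  show "\<zero>\<^bsub>M\<^esub> \<oplus>\<^bsub>M\<^esub> x = x"
    by (rule coord_inj)
       (simp_all add: add_closed zero_closed x coord_add coord_zero)
  let ?y = "of_coord (- \<kappa> x)"
  have v: "- \<kappa> x \<in> vecs S n"
    using coord_vecs[OF x] subring_setD[OF ring] by (auto simp: vecs_def)
  have "?y \<oplus>\<^bsub>M\<^esub> x = \<zero>\<^bsub>M\<^esub>"
    by (rule coord_inj)
       (simp_all add: add_closed zero_closed x coord_add coord_zero of_coord_closed v coord_of_coord)
  then show "\<exists>y\<in>carrier M. y \<oplus>\<^bsub>M\<^esub> x = \<zero>\<^bsub>M\<^esub>"
    using of_coord_closed[OF v] by blast
qed (auto simp: zero_closed add_closed)

sublocale abelian_group M by (rule abelian_group)

lemma coord_minus: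
  assumes "x \<in> carrier M" "y \<in> carrier M"
  shows "\<kappa> (x \<ominus>\<^bsub>M\<^esub> y) = \<kappa> x - \<kappa> y"
proof -
  have "\<kappa> (x \<ominus>\<^bsub>M\<^esub> y) + \<kappa> y = \<kappa> ((x \<ominus>\<^bsub>M\<^esub> y) \<oplus>\<^bsub>M\<^esub> y)"
    using assms by (simp add: coord_add)
  also have "(x \<ominus>\<^bsub>M\<^esub> y) \<oplus>\<^bsub>M\<^esub> y = x"
    using assms by (simp add: minus_eq a_assoc l_neg)
  finally have *: "\<kappa> (x \<ominus>\<^bsub>M\<^esub> y) + \<kappa> y = \<kappa> x" .
  show ?thesis
  proof (rule eq_vecI)
    fix i assume "i < dim_vec (\<kappa> x - \<kappa> y)"
    then have i: "i < n" using assms by simp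
    have "(\<kappa> (x \<ominus>\<^bsub>M\<^esub> y) + \<kappa> y) $ i = \<kappa> x $ i" by (simp add: *)
    then show "\<kappa> (x \<ominus>\<^bsub>M\<^esub> y) $ i = (\<kappa> x - \<kappa> y) $ i"
      using i assms by (simp add: eq_diff_eq)
  qed (use assms minus_closed in auto)
qed

lemma coord_finsum:
  assumes "finite I" "f \<in> I \<rightarrow> carrier M"
  shows "\<kappa> (\<Oplus>\<^bsub>M\<^esub>i\<in>I. f i) = vec n (\<lambda>j. \<Sum>i\<in>I. \<kappa> (f i) $ j)"
  using assms
proof (induction I rule: finite_induct)
  case empty
  show ?case by (auto simp: coord_zero)
next
  case (insert a I)
  then have f: "f a \<in> carrier M" "f \<in> I \<rightarrow> carrier M" by auto
  have "\<kappa> (\<Oplus>\<^bsub>M\<^esub>i\<in>insert a I. f i) = \<kappa> (f a) + \<kappa> (\<Oplus>\<^bsub>M\<^esub>i\<in>I. f i)"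
    using insert f by (simp add: coord_add)
  then show ?case
    using insert f by (auto intro!: eq_vecI)
qed

lemma coord_lincomb:
  assumes "\<And>j. j < m \<Longrightarrow> c j \<in> S" "\<And>j. j < m \<Longrightarrow> b j \<in> carrier M"
  shows "\<kappa> (\<Oplus>\<^bsub>M\<^esub>j\<in>{..<m}. c j \<odot>\<^bsub>M\<^esub> b j) = mat n m (\<lambda>(i, j). \<kappa> (b j) $ i) *\<^sub>v vec m c"
proof -
  have "\<kappa> (\<Oplus>\<^bsub>M\<^esub>j\<in>{..<m}. c j \<odot>\<^bsub>M\<^esub> b j) = vec n (\<lambda>i. \<Sum>j<m. \<kappa> (c j \<odot>\<^bsub>M\<^esub> b j) $ i)"
    using assms by (intro coord_finsum) (auto simp: smult_closed)
  also have "\<dots> = vec n (\<lambda>i. \<Sum>j<m. c j * \<kappa> (b j) $ i)"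
    by (intro eq_vecI)
       (use assms in \<open>auto simp: coord_smult intro!: sum.cong\<close>)
  also have "\<dots> = mat n m (\<lambda>(i, j). \<kappa> (b j) $ i) *\<^sub>v vec m c"
    by (intro eq_vecI) (auto simp: scalar_prod_def atLeast0LessThan mult.commute)
  finally show ?thesis .
qed

lemma coord_lincomb_basis_elem:
  assumes "v \<in> vecs S n"
  shows "\<kappa> (\<Oplus>\<^bsub>M\<^esub>j\<in>{..<n}. (v $ j) \<odot>\<^bsub>M\<^esub> basis_elem j) = v"
proof -
  have "\<kappa> (\<Oplus>\<^bsub>M\<^esub>j\<in>{..<n}. (v $ j) \<odot>\<^bsub>M\<^esub> basis_elem j) =
      mat n n (\<lambda>(i, j). \<kappa> (basis_elem j) $ i) *\<^sub>v vec n (\<lambda>j. v $ j)"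
    using assms by (intro coord_lincomb) (auto simp: vecs_def)
  also have "mat n n (\<lambda>(i, j). \<kappa> (basis_elem j) $ i) = 1\<^sub>m n"
    by (intro eq_matI) auto
  also have "vec n (\<lambda>j. v $ j) = v" using assms by (auto simp: vecs_def)
  finally show ?thesis using assms by (simp add: vecs_def)
qed

lemma lincomb_basis_elem:
  assumes "x \<in> carrier M"
  shows "x = (\<Oplus>\<^bsub>M\<^esub>j\<in>{..<n}. (\<kappa> x $ j) \<odot>\<^bsub>M\<^esub> basis_elem j)"
  by (rule coord_inj[OF assms])
     (use assms in \<open>auto simp: coord_lincomb_basis_elem[OF coord_vecs] smult_closed coord_entry
        intro!: finsum_closed\<close>)

lemma is_basis_basis_elem: "is_basis S M n basis_elem"
  unfolding is_basis_def
proof (intro conjI ballI)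
  fix x assume x: "x \<in> carrier M"
  show "\<exists>!c. c \<in> {..<n} \<rightarrow>\<^sub>E S \<and> x = (\<Oplus>\<^bsub>M\<^esub>i\<in>{..<n}. c i \<odot>\<^bsub>M\<^esub> basis_elem i)"
  proof (rule ex1I[of _ "\<lambda>i\<in>{..<n}. \<kappa> x $ i"])
    have "x = (\<Oplus>\<^bsub>M\<^esub>i\<in>{..<n}. (\<kappa> x $ i) \<odot>\<^bsub>M\<^esub> basis_elem i)"
      by (rule lincomb_basis_elem[OF x])
    also have "\<dots> = (\<Oplus>\<^bsub>M\<^esub>i\<in>{..<n}. (\<lambda>i\<in>{..<n}. \<kappa> x $ i) i \<odot>\<^bsub>M\<^esub> basis_elem i)"
      by (rule finsum_cong') (auto simp: smult_closed coord_entry[OF x])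
    finally show "(\<lambda>i\<in>{..<n}. \<kappa> x $ i) \<in> {..<n} \<rightarrow>\<^sub>E S \<and>
        x = (\<Oplus>\<^bsub>M\<^esub>i\<in>{..<n}. (\<lambda>i\<in>{..<n}. \<kappa> x $ i) i \<odot>\<^bsub>M\<^esub> basis_elem i)"
      using coord_entry[OF x] by auto
  next
    fix c assume c: "c \<in> {..<n} \<rightarrow>\<^sub>E S \<and> x = (\<Oplus>\<^bsub>M\<^esub>i\<in>{..<n}. c i \<odot>\<^bsub>M\<^esub> basis_elem i)"
    then have v: "vec n c \<in> vecs S n" by (auto simp: vecs_def)
    have "(\<Oplus>\<^bsub>M\<^esub>i\<in>{..<n}. c i \<odot>\<^bsub>M\<^esub> basis_elem i) =
        (\<Oplus>\<^bsub>M\<^esub>i\<in>{..<n}. (vec n c $ i) \<odot>\<^bsub>M\<^esub> basis_elem i)"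
      by (rule finsum_cong') (use c in \<open>auto simp: smult_closed PiE_def Pi_def\<close>)
    then have "\<kappa> x = vec n c" using c coord_lincomb_basis_elem[OF v] by simp
    then show "c = (\<lambda>i\<in>{..<n}. \<kappa> x $ i)"
      using c by (intro ext) (auto simp: PiE_def extensional_def)
  qed
qed auto

text \<open>The description of \<open>endo_det\<close> admits every basis of any length, so
  independence of the basis has to be proved. The transition matrices \<open>P\<close> and
  \<open>Q\<close> to another basis are mutually inverse, which forces equal lengths, and
  \<open>C * P = P * C'\<close> yields equal determinants.\<close>

lemma endo_det_eq_det:
  assumes f: "\<And>x. x \<in> carrier M \<Longrightarrow> f x \<in> carrier M"
    and C: "C \<in> mats S n n" and fC: "\<And>x. x \<in> carrier M \<Longrightarrow> \<kappa> (f x) = C *\<^sub>v \<kappa> x"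
  shows "endo_det S M f = det C"
  unfolding endo_det_def
proof (rule the_equality)
  have Cc: "C \<in> carrier_mat n n" using C by (simp add: mats_def)
  have "f (basis_elem j) = (\<Oplus>\<^bsub>M\<^esub>i\<in>{..<n}. C $$ (i, j) \<odot>\<^bsub>M\<^esub> basis_elem i)" if j: "j < n" for j
  proof -
    have k: "\<kappa> (f (basis_elem j)) = col C j"
      by (simp add: fC mult_mat_unit_vec[OF Cc j])
    have "f (basis_elem j) = (\<Oplus>\<^bsub>M\<^esub>i\<in>{..<n}. (\<kappa> (f (basis_elem j)) $ i) \<odot>\<^bsub>M\<^esub> basis_elem i)"
      by (rule lincomb_basis_elem[OF f]) simp
    also have "\<dots> = (\<Oplus>\<^bsub>M\<^esub>i\<in>{..<n}. C $$ (i, j) \<odot>\<^bsub>M\<^esub> basis_elem i)"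
      by (rule finsum_cong') (use Cc C j in \<open>auto simp: k mats_def smult_closed\<close>)
    finally show ?thesis .
  qed
  then show "\<exists>n b C'. is_basis S M n b \<and> C' \<in> carrier_mat n n \<and> (\<forall>i<n. \<forall>j<n. C' $$ (i, j) \<in> S) \<and>
      (\<forall>j<n. f (b j) = (\<Oplus>\<^bsub>M\<^esub>i\<in>{..<n}. C' $$ (i, j) \<odot>\<^bsub>M\<^esub> b i)) \<and> det C = det C'"
    using is_basis_basis_elem C by (auto simp: mats_def)
next
  fix D
  have Cc: "C \<in> carrier_mat n n" using C by (simp add: mats_def)
  assume "\<exists>n b C'. is_basis S M n b \<and> C' \<in> carrier_mat n n \<and> (\<forall>i<n. \<forall>j<n. C' $$ (i, j) \<in> S) \<and>
      (\<forall>j<n. f (b j) = (\<Oplus>\<^bsub>M\<^esub>i\<in>{..<n}. C' $$ (i, j) \<odot>\<^bsub>M\<^esub> b i)) \<and> D = det C'"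
  then obtain m b C' where b: "is_basis S M m b" and C': "C' \<in> carrier_mat m m"
    and C'S: "\<And>i j. i < m \<Longrightarrow> j < m \<Longrightarrow> C' $$ (i, j) \<in> S"
    and fb: "\<And>j. j < m \<Longrightarrow> f (b j) = (\<Oplus>\<^bsub>M\<^esub>i\<in>{..<m}. C' $$ (i, j) \<odot>\<^bsub>M\<^esub> b i)"
    and D: "D = det C'"
    by blast
  have bc: "b j \<in> carrier M" if "j < m" for j using b that by (auto simp: is_basis_def)
  define P where "P = mat n m (\<lambda>(i, j). \<kappa> (b j) $ i)"
  have Pc: "P \<in> carrier_mat n m" by (simp add: P_def)
  have PS: "P $$ (i, j) \<in> S" if "i < n" "j < m" for i j
    using that coord_entry[OF bc] by (simp add: P_def)
  have kb: "\<kappa> (b j) = P *\<^sub>v unit_vec m j" if "j < m" for j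
    using that bc
    by (simp add: mult_mat_unit_vec[OF Pc that]) (auto simp: P_def intro!: eq_vecI)
  have lin: "\<kappa> (\<Oplus>\<^bsub>M\<^esub>j\<in>{..<m}. c j \<odot>\<^bsub>M\<^esub> b j) = P *\<^sub>v vec m c" if "\<And>j. j < m \<Longrightarrow> c j \<in> S" for c
    unfolding P_def by (rule coord_lincomb[OF that bc])
  have "\<exists>c. c \<in> {..<m} \<rightarrow>\<^sub>E S \<and> basis_elem i = (\<Oplus>\<^bsub>M\<^esub>k\<in>{..<m}. c k \<odot>\<^bsub>M\<^esub> b k)" for i
    using b basis_elem_closed[of i] unfolding is_basis_def by blast
  then obtain c where c: "\<And>i. c i \<in> {..<m} \<rightarrow>\<^sub>E S"
    "\<And>i. basis_elem i = (\<Oplus>\<^bsub>M\<^esub>k\<in>{..<m}. c i k \<odot>\<^bsub>M\<^esub> b k)"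
    by metis
  define Q where "Q = mat m n (\<lambda>(k, i). c i k)"
  have Qc: "Q \<in> carrier_mat m n" by (simp add: Q_def)
  have QS: "Q $$ (k, i) \<in> S" if "k < m" "i < n" for k i
    using that c(1)[of i] by (auto simp: Q_def)
  have PQ: "P * Q = 1\<^sub>m n"
  proof (rule mat_eq_if_mult_unit_vec_eq)
    fix i assume i: "i < n"
    have "(P * Q) *\<^sub>v unit_vec n i = P *\<^sub>v (Q *\<^sub>v unit_vec n i)"
      by (rule assoc_mult_mat_vec[OF Pc Qc]) simp
    also have "Q *\<^sub>v unit_vec n i = vec m (c i)"
      unfolding mult_mat_unit_vec[OF Qc i] using i by (auto simp: Q_def)
    also have "P *\<^sub>v vec m (c i) = \<kappa> (basis_elem i)"
      using lin[of "c i"] c(1)[of i] c(2)[of i] by (auto simp: PiE_def Pi_def)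
    finally show "(P * Q) *\<^sub>v unit_vec n i = 1\<^sub>m n *\<^sub>v unit_vec n i" by simp
  qed (use Pc Qc in auto)
  \<comment> \<open>Uniqueness of coefficients in the basis \<open>b\<close> enters here: column j
    of \<open>Q * P\<close> and the unit vector \<open>w\<close> both express \<open>b j\<close>.
    Both are restricted to the index set because the coefficient functions of
    \<open>is_basis\<close> are extensional.\<close>
  have QP: "Q * P = 1\<^sub>m m"
  proof (rule eq_matI)
    fix k j assume "k < dim_row (1\<^sub>m m)" "j < dim_col (1\<^sub>m m)"
    then have kj: "k < m" "j < m" by auto
    define u where "u k = (Q * P) $$ (k, j)" for k
    have uS: "u k \<in> S" if "k < m" for k
      using that kj Pc Qc unfolding u_def
      by (auto simp: scalar_prod_def intro!: subring_set_sum[OF ring] subring_setD(4)[OF ring] QS PS)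
    have "vec m u = (Q * P) *\<^sub>v unit_vec m j"
      using kj Pc Qc by (subst mult_mat_unit_vec[of _ m m]) (auto simp: u_def)
    then have "P *\<^sub>v vec m u = P *\<^sub>v ((Q * P) *\<^sub>v unit_vec m j)" by simp
    also have "\<dots> = (P * (Q * P)) *\<^sub>v unit_vec m j"
      by (rule assoc_mult_mat_vec[symmetric]) (use Pc Qc in auto)
    also have "P * (Q * P) = P"
      using assoc_mult_mat[OF Pc Qc Pc] PQ Pc by simp
    finally have "\<kappa> (\<Oplus>\<^bsub>M\<^esub>k\<in>{..<m}. u k \<odot>\<^bsub>M\<^esub> b k) = \<kappa> (b j)"
      using lin[OF uS] kb[OF kj(2)] by simp
    then have u1: "b j = (\<Oplus>\<^bsub>M\<^esub>k\<in>{..<m}. u k \<odot>\<^bsub>M\<^esub> b k)"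
      by (intro coord_inj) (use kj bc uS in \<open>auto simp: smult_closed intro!: finsum_closed\<close>)
    define w where "w k = (if k = j then 1 else 0 :: 's)" for k
    have wS: "w k \<in> S" for k using subring_setD[OF ring] by (auto simp: w_def)
    have "vec m w = unit_vec m j" using kj by (auto simp: w_def)
    then have "\<kappa> (\<Oplus>\<^bsub>M\<^esub>k\<in>{..<m}. w k \<odot>\<^bsub>M\<^esub> b k) = \<kappa> (b j)"
      using lin[OF wS] kb[OF kj(2)] by simp
    then have w1: "b j = (\<Oplus>\<^bsub>M\<^esub>k\<in>{..<m}. w k \<odot>\<^bsub>M\<^esub> b k)"
      by (intro coord_inj) (use kj bc wS in \<open>auto simp: smult_closed intro!: finsum_closed\<close>)
    have r1: "b j = (\<Oplus>\<^bsub>M\<^esub>k\<in>{..<m}. restrict u {..<m} k \<odot>\<^bsub>M\<^esub> b k)"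
      by (subst u1, rule finsum_cong') (use bc uS in \<open>auto simp: smult_closed\<close>)
    have r2: "b j = (\<Oplus>\<^bsub>M\<^esub>k\<in>{..<m}. restrict w {..<m} k \<odot>\<^bsub>M\<^esub> b k)"
      by (subst w1, rule finsum_cong') (use bc wS in \<open>auto simp: smult_closed\<close>)
    have "\<exists>!c. c \<in> {..<m} \<rightarrow>\<^sub>E S \<and> b j = (\<Oplus>\<^bsub>M\<^esub>k\<in>{..<m}. c k \<odot>\<^bsub>M\<^esub> b k)"
      using b bc[OF kj(2)] unfolding is_basis_def by blast
    then obtain c0 where c0: "\<And>c. c \<in> {..<m} \<rightarrow>\<^sub>E S \<Longrightarrow>
        b j = (\<Oplus>\<^bsub>M\<^esub>k\<in>{..<m}. c k \<odot>\<^bsub>M\<^esub> b k) \<Longrightarrow> c = c0"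
      by (elim ex1E) blast
    have "restrict u {..<m} = c0" by (rule c0[OF _ r1]) (use uS in \<open>auto split: if_splits\<close>)
    moreover have "restrict w {..<m} = c0" by (rule c0[OF _ r2]) (use wS in \<open>auto split: if_splits\<close>)
    ultimately have "restrict u {..<m} = restrict w {..<m}" by simp
    then have "u k = w k" using kj by (metis lessThan_iff restrict_apply')
    then show "(Q * P) $$ (k, j) = 1\<^sub>m m $$ (k, j)" using kj by (auto simp: u_def w_def)
  qed (use Pc Qc in auto)
  have mn: "m = n"
    using left_inverse_mat_dim_le[OF Pc Qc QP] left_inverse_mat_dim_le[OF Qc Pc PQ] by simp
  have CP: "C * P = P * C'"
  proof (rule mat_eq_if_mult_unit_vec_eq)
    fix j assume j: "j < m"
    have "(C * P) *\<^sub>v unit_vec m j = C *\<^sub>v \<kappa> (b j)"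
      using j by (simp add: assoc_mult_mat_vec[OF Cc Pc] kb)
    also have "\<dots> = \<kappa> (f (b j))" by (rule fC[OF bc[OF j], symmetric])
    also have "\<dots> = P *\<^sub>v vec m (\<lambda>i. C' $$ (i, j))"
      unfolding fb[OF j] by (rule lin) (use C'S j in auto)
    also have "vec m (\<lambda>i. C' $$ (i, j)) = C' *\<^sub>v unit_vec m j"
      using C' j by (auto simp: mult_mat_unit_vec[OF C'] intro!: eq_vecI)
    also have "P *\<^sub>v (C' *\<^sub>v unit_vec m j) = (P * C') *\<^sub>v unit_vec m j"
      by (rule assoc_mult_mat_vec[OF Pc C', symmetric]) simp
    finally show "(C * P) *\<^sub>v unit_vec m j = (P * C') *\<^sub>v unit_vec m j" .
  qed (use Cc Pc C' in auto)
  note Pn = Pc[unfolded mn] and Qn = Qc[unfolded mn] and Cn = C'[unfolded mn]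
  have 1: "det P * det Q = 1" using det_mult[OF Pn Qn] PQ by simp
  have "det C * det P = det P * det C'"
    using det_mult[OF Cc Pn] det_mult[OF Pn Cn] CP by simp
  \<comment> \<open>The ring may have zero divisors, so \<open>det P\<close> is removed by
    multiplying with its inverse \<open>det Q\<close> instead of cancelling.\<close>
  then have "det C * (det P * det Q) = det C' * (det P * det Q)"
    by (metis mult.assoc mult.commute)
  then show "D = det C" by (simp add: 1 D)
qed

end


section \<open>Semilinear maps in coordinates\<close>

definition hom_on :: "'s::comm_ring_1 set \<Rightarrow> 't::comm_ring_1 set \<Rightarrow> ('s \<Rightarrow> 't) \<Rightarrow> bool" where
  "hom_on S T h \<longleftrightarrow> h 0 = 0 \<and> h 1 = 1 \<and> (\<forall>x\<in>S. h x \<in> T) \<and>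
     (\<forall>x\<in>S. \<forall>y\<in>S. h (x + y) = h x + h y \<and> h (x * y) = h x * h y)"

lemma hom_on_ident [simp]: "hom_on S S (\<lambda>s. s)"
  by (simp add: hom_on_def)

lemma hom_onD:
  assumes "hom_on S T h"
  shows "h 0 = 0" "h 1 = 1" "x \<in> S \<Longrightarrow> h x \<in> T" "x \<in> S \<Longrightarrow> y \<in> S \<Longrightarrow> h (x + y) = h x + h y"
    "x \<in> S \<Longrightarrow> y \<in> S \<Longrightarrow> h (x * y) = h x * h y"
  using assms by (auto simp: hom_on_def)

lemma hom_on_sum:
  assumes "hom_on S T h" "subring_set S" "finite I" "\<And>i. i \<in> I \<Longrightarrow> f i \<in> S"
  shows "h (sum f I) = (\<Sum>i\<in>I. h (f i))"
  using assms(3,4)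
proof (induction I rule: finite_induct)
  case (insert a I)
  then show ?case
    using hom_onD(4)[OF assms(1), of "f a" "sum f I"] subring_set_sum[OF assms(2), of I f] by simp
qed (simp add: hom_onD[OF assms(1)])

lemma semilinear_mapsD:
  assumes "f \<in> semilinear_maps S h M N"
  shows "x \<in> carrier M \<Longrightarrow> f x \<in> carrier N"
    "x \<in> carrier M \<Longrightarrow> y \<in> carrier M \<Longrightarrow> f (x \<oplus>\<^bsub>M\<^esub> y) = f x \<oplus>\<^bsub>N\<^esub> f y"
    "s \<in> S \<Longrightarrow> x \<in> carrier M \<Longrightarrow> f (s \<odot>\<^bsub>M\<^esub> x) = h s \<odot>\<^bsub>N\<^esub> f x"
    "x \<notin> carrier M \<Longrightarrow> f x = undefined"
  using assms by (auto simp: semilinear_maps_def PiE_def extensional_def)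

lemma mult_mat_vec_smult:
  assumes "A \<in> carrier_mat m n" "v \<in> carrier_vec n"
  shows "A *\<^sub>v (k \<cdot>\<^sub>v v) = k \<cdot>\<^sub>v (A *\<^sub>v (v :: 'a::comm_ring_1 vec))"
  by (rule eq_vecI) (use assms in auto)

locale coordinates_pair = dom: coordinates S M n \<kappa> + cod: coordinates T N m \<mu>
  for S :: "'s::comm_ring_1 set" and M :: "('s, 'm) module" and n \<kappa>
  and T :: "'t::comm_ring_1 set" and N :: "('t, 'n) module" and m \<mu> +
  fixes h :: "'s \<Rightarrow> 't"
  assumes hom: "hom_on S T h"
begin

lemma semilinear_maps_finsum:
  assumes f: "f \<in> semilinear_maps S h M N" and I: "finite I" "g \<in> I \<rightarrow> carrier M"
  shows "f (\<Oplus>\<^bsub>M\<^esub>i\<in>I. g i) = (\<Oplus>\<^bsub>N\<^esub>i\<in>I. f (g i))"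
  using I
proof (induction I rule: finite_induct)
  case empty
  have c: "f \<zero>\<^bsub>M\<^esub> \<in> carrier N" using f by (auto simp: semilinear_maps_def)
  have "f (\<zero>\<^bsub>M\<^esub> \<oplus>\<^bsub>M\<^esub> \<zero>\<^bsub>M\<^esub>) = f \<zero>\<^bsub>M\<^esub> \<oplus>\<^bsub>N\<^esub> f \<zero>\<^bsub>M\<^esub>"
    by (rule semilinear_mapsD(2)[OF f dom.zero_closed dom.zero_closed])
  then have "f \<zero>\<^bsub>M\<^esub> = f \<zero>\<^bsub>M\<^esub> \<oplus>\<^bsub>N\<^esub> f \<zero>\<^bsub>M\<^esub>" by simp
  then have z: "\<mu> (f \<zero>\<^bsub>M\<^esub>) = \<mu> (f \<zero>\<^bsub>M\<^esub>) + \<mu> (f \<zero>\<^bsub>M\<^esub>)"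
    using cod.coord_add[OF c c] by simp
  have "\<mu> (f \<zero>\<^bsub>M\<^esub>) = 0\<^sub>v m"
  proof (rule eq_vecI)
    fix i assume "i < dim_vec (0\<^sub>v m :: 't vec)"
    then have i: "i < dim_vec (\<mu> (f \<zero>\<^bsub>M\<^esub>))" using cod.dim_coord[OF c] by simp
    have "\<mu> (f \<zero>\<^bsub>M\<^esub>) $ i = \<mu> (f \<zero>\<^bsub>M\<^esub>) $ i + \<mu> (f \<zero>\<^bsub>M\<^esub>) $ i"
      by (rule trans[OF arg_cong[OF z, of "\<lambda>v. v $ i"] index_add_vec(1)[OF i]])
    from iffD1[OF add_cancel_right_right this] show "\<mu> (f \<zero>\<^bsub>M\<^esub>) $ i = 0\<^sub>v m $ i"
      using i cod.dim_coord[OF c] by simp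
  qed (simp add: cod.dim_coord[OF c])
  then have "f \<zero>\<^bsub>M\<^esub> = \<zero>\<^bsub>N\<^esub>"
    by (intro cod.coord_inj[OF c cod.zero_closed]) (simp add: cod.coord_zero)
  then show ?case by simp
next
  case (insert a I)
  then have g: "g a \<in> carrier M" "g \<in> I \<rightarrow> carrier M" by auto
  then have fg: "f (g a) \<in> carrier N" "(\<lambda>i. f (g i)) \<in> I \<rightarrow> carrier N"
    using f by (auto simp: semilinear_maps_def)
  have "f (g a \<oplus>\<^bsub>M\<^esub> (\<Oplus>\<^bsub>M\<^esub>i\<in>I. g i)) = f (g a) \<oplus>\<^bsub>N\<^esub> f (\<Oplus>\<^bsub>M\<^esub>i\<in>I. g i)"
    by (rule semilinear_mapsD(2)[OF f]) (use g in auto)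
  then show ?case using insert g fg by simp
qed

lemma semilinear_maps_coord:
  assumes f: "f \<in> semilinear_maps S h M N" and x: "x \<in> carrier M"
  shows "\<mu> (f x) = mat m n (\<lambda>(i, j). \<mu> (f (dom.basis_elem j)) $ i) *\<^sub>v map_vec h (\<kappa> x)"
proof -
  have fc: "f y \<in> carrier N" if "y \<in> carrier M" for y
    using f that by (auto simp: semilinear_maps_def)
  have fs: "f (s \<odot>\<^bsub>M\<^esub> y) = h s \<odot>\<^bsub>N\<^esub> f y" if "s \<in> S" "y \<in> carrier M" for s y
    using f that by (auto simp: semilinear_maps_def)
  have hS: "h s \<in> T" if "s \<in> S" for s using hom_onD(3)[OF hom that] .
  have "f x = f (\<Oplus>\<^bsub>M\<^esub>j\<in>{..<n}. (\<kappa> x $ j) \<odot>\<^bsub>M\<^esub> dom.basis_elem j)"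
    using dom.lincomb_basis_elem[OF x] by simp
  also have "\<dots> = (\<Oplus>\<^bsub>N\<^esub>j\<in>{..<n}. f ((\<kappa> x $ j) \<odot>\<^bsub>M\<^esub> dom.basis_elem j))"
    by (rule semilinear_maps_finsum[OF f]) (auto simp: dom.smult_closed dom.coord_entry[OF x])
  also have "\<dots> = (\<Oplus>\<^bsub>N\<^esub>j\<in>{..<n}. h (\<kappa> x $ j) \<odot>\<^bsub>N\<^esub> f (dom.basis_elem j))"
    by (rule cod.finsum_cong')
       (auto simp: fs dom.coord_entry[OF x] cod.smult_closed hS fc)
  also have "\<mu> \<dots> = mat m n (\<lambda>(i, j). \<mu> (f (dom.basis_elem j)) $ i) *\<^sub>v vec n (\<lambda>j. h (\<kappa> x $ j))"
    by (rule cod.coord_lincomb) (auto simp: hS fc dom.coord_entry[OF x])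
  also have "vec n (\<lambda>j. h (\<kappa> x $ j)) = map_vec h (\<kappa> x)"
    using x by auto
  finally show ?thesis .
qed

lemma semilinear_maps_matrix:
  assumes "f \<in> semilinear_maps S h M N"
  obtains A where "A \<in> mats T m n" "\<And>x. x \<in> carrier M \<Longrightarrow> \<mu> (f x) = A *\<^sub>v map_vec h (\<kappa> x)"
proof
  have "f (dom.basis_elem j) \<in> carrier N" for j
    using assms by (auto simp: semilinear_maps_def)
  then show "mat m n (\<lambda>(i, j). \<mu> (f (dom.basis_elem j)) $ i) \<in> mats T m n"
    by (auto simp: mats_def cod.coord_entry)
qed (rule semilinear_maps_coord[OF assms])

text \<open>This is the uniqueness needed for the descriptions by THE: outside the carrier
  extensionality fixes the value, inside it the images of the basis do.\<close>

lemma semilinear_maps_eqI: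
  assumes f: "f \<in> semilinear_maps S h M N" and g: "g \<in> semilinear_maps S h M N"
    and eq: "\<And>j. j < n \<Longrightarrow> f (dom.basis_elem j) = g (dom.basis_elem j)"
  shows "f = g"
proof
  fix x
  show "f x = g x"
  proof (cases "x \<in> carrier M")
    case True
    have "mat m n (\<lambda>(i, j). \<mu> (f (dom.basis_elem j)) $ i) =
        mat m n (\<lambda>(i, j). \<mu> (g (dom.basis_elem j)) $ i)"
      by (rule cong_mat) (auto simp: eq)
    then have "\<mu> (f x) = \<mu> (g x)"
      unfolding semilinear_maps_coord[OF f True] semilinear_maps_coord[OF g True] by simp
    moreover have "f x \<in> carrier N" "g x \<in> carrier N"
      using f g True by (auto simp: semilinear_maps_def)
    ultimately show ?thesis by (rule cod.coord_inj[rotated 2])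
  next
    case False
    then show ?thesis using f g by (auto simp: semilinear_maps_def PiE_def extensional_def)
  qed
qed

text \<open>The candidate that witnesses existence in the descriptions by THE; the restriction to
  the carrier makes it extensional.\<close>

definition matrix_map :: "'t mat \<Rightarrow> 'm \<Rightarrow> 'n" where
  "matrix_map A = (\<lambda>x\<in>carrier M. cod.of_coord (A *\<^sub>v map_vec h (\<kappa> x)))"

lemma map_vec_coord:
  assumes "x \<in> carrier M"
  shows "map_vec h (\<kappa> x) \<in> vecs T n"
  using dom.coord_vecs[OF assms] hom_onD(3)[OF hom] by (auto simp: vecs_def)

lemma coord_matrix_map:
  assumes "A \<in> mats T m n" "x \<in> carrier M"
  shows "\<mu> (matrix_map A x) = A *\<^sub>v map_vec h (\<kappa> x)"
  using assms cod.coord_of_coord[OF mult_mat_vec_vecs[OF cod.ring assms(1) map_vec_coord[OF assms(2)]]]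
  by (simp add: matrix_map_def)

lemma matrix_map_closed:
  assumes "A \<in> mats T m n" "x \<in> carrier M"
  shows "matrix_map A x \<in> carrier N"
  using assms cod.of_coord_closed[OF mult_mat_vec_vecs[OF cod.ring assms(1) map_vec_coord[OF assms(2)]]]
  by (simp add: matrix_map_def)

lemma matrix_map_semilinear:
  assumes A: "A \<in> mats T m n"
  shows "matrix_map A \<in> semilinear_maps S h M N"
  unfolding semilinear_maps_def
proof (intro CollectI conjI ballI PiE_I)
  have Ac: "A \<in> carrier_mat m n" using A by (simp add: mats_def)
  note mc = matrix_map_closed[OF A] and cm = coord_matrix_map[OF A]
  note hx = map_vec_coord
  have hxc: "map_vec h (\<kappa> x) \<in> carrier_vec n" if "x \<in> carrier M" for x
    using hx[OF that] by (simp add: vecs_def)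
  fix x assume x: "x \<in> carrier M"
  show "matrix_map A x \<in> carrier N" by (rule mc[OF x])
  fix y assume y: "y \<in> carrier M"
  have "map_vec h (\<kappa> x + \<kappa> y) = map_vec h (\<kappa> x) + map_vec h (\<kappa> y)"
    by (rule eq_vecI)
       (use x y dom.coord_entry hom_onD(4)[OF hom] in auto)
  then show "matrix_map A (x \<oplus>\<^bsub>M\<^esub> y) = matrix_map A x \<oplus>\<^bsub>N\<^esub> matrix_map A y"
    by (intro cod.coord_inj)
       (auto simp: x y mc cm dom.add_closed cod.add_closed dom.coord_add cod.coord_add
          mult_add_distrib_mat_vec[OF Ac hxc hxc])
next
  have Ac: "A \<in> carrier_mat m n" using A by (simp add: mats_def)
  note mc = matrix_map_closed[OF A] and cm = coord_matrix_map[OF A]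
  have hxc: "map_vec h (\<kappa> x) \<in> carrier_vec n" if "x \<in> carrier M" for x
    using map_vec_coord[OF that] by (simp add: vecs_def)
  fix s x assume s: "s \<in> S" and x: "x \<in> carrier M"
  have "map_vec h (s \<cdot>\<^sub>v \<kappa> x) = h s \<cdot>\<^sub>v map_vec h (\<kappa> x)"
    by (rule eq_vecI)
       (use s x dom.coord_entry hom_onD(5)[OF hom] in auto)
  then show "matrix_map A (s \<odot>\<^bsub>M\<^esub> x) = h s \<odot>\<^bsub>N\<^esub> matrix_map A x"
    by (intro cod.coord_inj)
       (auto simp: s x mc cm dom.smult_closed cod.smult_closed dom.coord_smult cod.coord_smult
          hom_onD(3)[OF hom] mult_mat_vec_smult[OF Ac hxc])
qed (simp add: matrix_map_def)

end


section \<open>Base change of a free module\<close>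

text \<open>The group homomorphism on the free abelian group that extends \<open>g\<close>.\<close>

definition frag_eval :: "('p \<Rightarrow> 'a::comm_ring_1) \<Rightarrow> ('p \<Rightarrow>\<^sub>0 int) \<Rightarrow> 'a" where
  "frag_eval g c = (\<Sum>p\<in>Poly_Mapping.keys c. of_int (Poly_Mapping.lookup c p) * g p)"

lemma frag_eval_superset:
  assumes "finite A" "Poly_Mapping.keys c \<subseteq> A"
  shows "frag_eval g c = (\<Sum>p\<in>A. of_int (Poly_Mapping.lookup c p) * g p)"
  unfolding frag_eval_def
  by (rule sum.mono_neutral_left) (use assms in \<open>auto simp: in_keys_iff\<close>)

lemma frag_eval_0 [simp]: "frag_eval g 0 = 0"
  by (simp add: frag_eval_def)

lemma frag_eval_of [simp]: "frag_eval g (frag_of p) = g p"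
  by (simp add: frag_eval_def)

lemma frag_eval_add: "frag_eval g (a + b) = frag_eval g a + frag_eval g b"
proof -
  let ?A = "Poly_Mapping.keys a \<union> Poly_Mapping.keys b"
  have "frag_eval g c = (\<Sum>p\<in>?A. of_int (Poly_Mapping.lookup c p) * g p)"
    if "c = a \<or> c = b \<or> c = a + b" for c
    using that keys_add[of a b] by (intro frag_eval_superset) auto
  then show ?thesis by (simp add: lookup_add distrib_right sum.distrib)
qed

lemma frag_eval_minus: "frag_eval g (- a) = - frag_eval g a"
  by (simp add: frag_eval_def sum_negf)

lemma frag_eval_diff: "frag_eval g (a - b) = frag_eval g a - frag_eval g b"
  using frag_eval_add[of g a "- b"] by (simp add: frag_eval_minus)

lemma frag_eval_sum: "frag_eval g (sum f I) = (\<Sum>i\<in>I. frag_eval g (f i))"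
  by (induction I rule: infinite_finite_induct) (auto simp: frag_eval_add)

locale base_change_coordinates = coordinates UNIV M n \<kappa>
  for M :: "('r::comm_ring_1, 'm) module" and n \<kappa> +
  fixes S :: "'s::comm_ring_1 set" and h :: "'r \<Rightarrow> 's"
  assumes target: "subring_set S" and hom: "hom_on UNIV S h"
begin

abbreviation "G \<equiv> tensor_free S M"
abbreviation "K \<equiv> tensor_ker h S M"

text \<open>The coordinates that a formal sum should have in the tensor product: s \<otimes> x has
  those of x, mapped by \<open>h\<close> and scaled by s. That they vanish exactly on the relations
  is what has to be shown.\<close>

definition frag_coord :: "('s \<times> 'm \<Rightarrow>\<^sub>0 int) \<Rightarrow> 's vec" where
  "frag_coord c = vec n (\<lambda>i. frag_eval (\<lambda>(s, x). s * h (\<kappa> x $ i)) c)"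

lemma frag_coord_carrier [simp]: "frag_coord c \<in> carrier_vec n" "dim_vec (frag_coord c) = n"
  by (simp_all add: frag_coord_def)

lemma frag_coord_add: "frag_coord (a + b) = frag_coord a + frag_coord b"
  by (auto simp: frag_coord_def frag_eval_add)

lemma frag_coord_diff: "frag_coord (a - b) = frag_coord a - frag_coord b"
  by (auto simp: frag_coord_def frag_eval_diff)

lemma frag_coord_minus: "frag_coord (- a) = - frag_coord a"
  by (auto simp: frag_coord_def frag_eval_minus)

lemma frag_coord_0 [simp]: "frag_coord 0 = 0\<^sub>v n"
  by (auto simp: frag_coord_def)

lemma frag_coord_of:
  assumes "x \<in> carrier M"
  shows "frag_coord (frag_of (s, x)) = s \<cdot>\<^sub>v map_vec h (\<kappa> x)"
  using assms by (auto simp: frag_coord_def)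

lemma G_simps [simp]:
  "c \<in> carrier G \<longleftrightarrow> Poly_Mapping.keys c \<subseteq> S \<times> carrier M"
  "a \<otimes>\<^bsub>G\<^esub> b = a + b" "\<one>\<^bsub>G\<^esub> = 0"
  by (simp_all add: tensor_free_def)

lemma group_G: "comm_group G"
  by (simp add: tensor_free_def abelian_free_Abelian_group)

sublocale G: comm_group G by (rule group_G)

lemma inv_G [simp]: "c \<in> carrier G \<Longrightarrow> inv\<^bsub>G\<^esub> c = - c"
  by (simp add: tensor_free_def)

lemma keys_add_subset: "Poly_Mapping.keys a \<subseteq> A \<Longrightarrow> Poly_Mapping.keys b \<subseteq> A \<Longrightarrow>
    Poly_Mapping.keys (a + b) \<subseteq> A"
  using keys_add[of a b] by blast

lemma keys_diff_subset: "Poly_Mapping.keys a \<subseteq> A \<Longrightarrow> Poly_Mapping.keys b \<subseteq> A \<Longrightarrow>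
    Poly_Mapping.keys (a - b) \<subseteq> A"
  using keys_diff[of a b] by blast

section \<open>The subgroup generated by the tensor relations\<close>

lemma rels_subset: "tensor_rels h S M \<subseteq> {c \<in> carrier G. frag_coord c = 0\<^sub>v n}"
proof
  note sub = subring_setD[OF target]
  note hs = hom_onD[OF hom]
  fix c assume "c \<in> tensor_rels h S M"
  then consider
      (1) s s' x where "c = frag_of (s + s', x) - frag_of (s, x) - frag_of (s', x)"
        "s \<in> S" "s' \<in> S" "x \<in> carrier M"
    | (2) s x x' where "c = frag_of (s, x \<oplus>\<^bsub>M\<^esub> x') - frag_of (s, x) - frag_of (s, x')"
        "s \<in> S" "x \<in> carrier M" "x' \<in> carrier M"
    | (3) s r x where "c = frag_of (s * h r, x) - frag_of (s, r \<odot>\<^bsub>M\<^esub> x)" "s \<in> S" "x \<in> carrier M"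
    unfolding tensor_rels_def by blast
  then show "c \<in> {c \<in> carrier G. frag_coord c = 0\<^sub>v n}"
  proof cases
    case 1
    have "frag_coord c = 0\<^sub>v n"
      unfolding 1(1) using 1(2-)
      by (auto simp: frag_coord_diff frag_coord_of distrib_right)
    moreover have "c \<in> carrier G"
      unfolding 1 G_simps by (intro keys_diff_subset) (use 1 sub in \<open>auto simp: keys_frag_of\<close>)
    ultimately show ?thesis by blast
  next
    case 2
    have "frag_coord c = 0\<^sub>v n"
      unfolding 2(1) using 2(2-)
      by (auto simp: frag_coord_diff frag_coord_of add_closed coord_add hs distrib_left)
    moreover have "c \<in> carrier G"
      unfolding 2 G_simps
      by (intro keys_diff_subset) (use 2 sub add_closed in \<open>auto simp: keys_frag_of\<close>)
    ultimately show ?thesis by blast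
  next
    case 3
    have "frag_coord c = 0\<^sub>v n"
      unfolding 3(1) using 3(2-)
      by (auto simp: frag_coord_diff frag_coord_of smult_closed coord_smult hs mult.assoc)
    moreover have "c \<in> carrier G"
      unfolding 3 G_simps
      by (intro keys_diff_subset) (use 3 sub hs smult_closed in \<open>auto simp: keys_frag_of\<close>)
    ultimately show ?thesis by blast
  qed
qed

lemma subgroup_K: "subgroup K G"
  unfolding tensor_ker_def using rels_subset by (intro G.generate_is_subgroup) blast

lemma rels_K: "c \<in> tensor_rels h S M \<Longrightarrow> c \<in> K"
  unfolding tensor_ker_def by (rule generate.incl)

lemma K_add: "a \<in> K \<Longrightarrow> b \<in> K \<Longrightarrow> a + b \<in> K"
  using subgroup.m_closed[OF subgroup_K] by simp

lemma K_minus: "a \<in> K \<Longrightarrow> - a \<in> K"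
  using subgroup.m_inv_closed[OF subgroup_K] subgroup.mem_carrier[OF subgroup_K] inv_G by metis

lemma K_diff: "a \<in> K \<Longrightarrow> b \<in> K \<Longrightarrow> a - b \<in> K"
  using K_add[of a "- b"] K_minus by simp

lemma K_0: "0 \<in> K"
  using subgroup.one_closed[OF subgroup_K] by simp

lemma K_sum: "(\<And>i. i \<in> I \<Longrightarrow> f i \<in> K) \<Longrightarrow> sum f I \<in> K"
  by (induction I rule: infinite_finite_induct) (auto simp: K_0 K_add)

lemma rel_add_left:
  "s \<in> S \<Longrightarrow> s' \<in> S \<Longrightarrow> x \<in> carrier M \<Longrightarrow> frag_of (s + s', x) - frag_of (s, x) - frag_of (s', x) \<in> K"
  by (rule rels_K) (auto simp: tensor_rels_def)

lemma rel_add_right: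
  "s \<in> S \<Longrightarrow> x \<in> carrier M \<Longrightarrow> y \<in> carrier M \<Longrightarrow>
    frag_of (s, x \<oplus>\<^bsub>M\<^esub> y) - frag_of (s, x) - frag_of (s, y) \<in> K"
  by (rule rels_K) (auto simp: tensor_rels_def)

lemma rel_smult:
  "s \<in> S \<Longrightarrow> x \<in> carrier M \<Longrightarrow> frag_of (s * h r, x) - frag_of (s, r \<odot>\<^bsub>M\<^esub> x) \<in> K"
  by (rule rels_K) (auto simp: tensor_rels_def)

lemma frag_finsum_K:
  assumes s: "s \<in> S" and I: "finite I" "f \<in> I \<rightarrow> carrier M"
  shows "frag_of (s, \<Oplus>\<^bsub>M\<^esub>i\<in>I. f i) - (\<Sum>i\<in>I. frag_of (s, f i)) \<in> K"
  using I
proof (induction I rule: finite_induct)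
  case empty
  have "frag_of (s, \<zero>\<^bsub>M\<^esub> \<oplus>\<^bsub>M\<^esub> \<zero>\<^bsub>M\<^esub>) - frag_of (s, \<zero>\<^bsub>M\<^esub>) - frag_of (s, \<zero>\<^bsub>M\<^esub>) \<in> K"
    by (rule rel_add_right) (use s in auto)
  then have "- frag_of (s, \<zero>\<^bsub>M\<^esub>) \<in> K" by simp
  then show ?case using K_minus by force
next
  case (insert a I)
  then have f: "f a \<in> carrier M" "f \<in> I \<rightarrow> carrier M" by auto
  have "frag_of (s, f a \<oplus>\<^bsub>M\<^esub> (\<Oplus>\<^bsub>M\<^esub>i\<in>I. f i)) - frag_of (s, f a) - frag_of (s, \<Oplus>\<^bsub>M\<^esub>i\<in>I. f i) \<in> K"
    by (rule rel_add_right) (use s f in auto)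
  from K_add[OF this insert.IH[OF f(2)]] show ?case
    using insert f by (simp add: algebra_simps)
qed

text \<open>Modulo the relations every formal sum can be rewritten with the basis elements as right
  factors, its coordinates being the left factors. This bounds the quotient from above, so that no
  further classes have coordinates zero.\<close>

lemma frag_normal_form:
  assumes "Poly_Mapping.keys c \<subseteq> S \<times> carrier M"
  shows "c - (\<Sum>i<n. frag_of (frag_coord c $ i, basis_elem i)) \<in> K \<and> frag_coord c \<in> vecs S n"
  using assms
proof (induction rule: free_Abelian_group_induct[consumes 1, case_names 1 2 3])
  case 1
  have "frag_of (0, basis_elem i) \<in> K" for i
    using K_minus[OF rel_add_left[of 0 0 "basis_elem i"]] subring_setD(1)[OF target] by simp
  then have "(\<Sum>i<n. frag_of (0, basis_elem i)) \<in> K" by (intro K_sum)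
  then show ?case using K_minus subring_setD(1)[OF target] by (auto simp: vecs_def)
next
  case (2 a b)
  have v: "frag_coord (a - b) \<in> vecs S n"
    using 2 subring_setD(6)[OF target] by (auto simp: vecs_def frag_coord_diff)
  \<comment> \<open>The relations speak of sums only, so additivity on the left is used in the form
    a_i = (a - b)_i + b_i.\<close>
  have "frag_of (frag_coord a $ i, basis_elem i) - frag_of (frag_coord (a - b) $ i, basis_elem i)
      - frag_of (frag_coord b $ i, basis_elem i) \<in> K" if "i < n" for i
    using rel_add_left[of "frag_coord (a - b) $ i" "frag_coord b $ i" "basis_elem i"] v 2 that
    by (simp add: vecs_def frag_coord_diff)
  then have "(\<Sum>i<n. frag_of (frag_coord a $ i, basis_elem i) - frag_of (frag_coord (a - b) $ i,
      basis_elem i)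
      - frag_of (frag_coord b $ i, basis_elem i)) \<in> K"
    by (intro K_sum) auto
  then have "(\<Sum>i<n. frag_of (frag_coord a $ i, basis_elem i)) -
      (\<Sum>i<n. frag_of (frag_coord (a - b) $ i, basis_elem i)) -
      (\<Sum>i<n. frag_of (frag_coord b $ i, basis_elem i)) \<in> K"
    by (simp only: sum_subtractf)
  moreover have "(a - (\<Sum>i<n. frag_of (frag_coord a $ i, basis_elem i))) -
      (b - (\<Sum>i<n. frag_of (frag_coord b $ i, basis_elem i))) \<in> K"
    by (rule K_diff) (use 2 in auto)
  ultimately have "((a - (\<Sum>i<n. frag_of (frag_coord a $ i, basis_elem i))) -
      (b - (\<Sum>i<n. frag_of (frag_coord b $ i, basis_elem i)))) +
      ((\<Sum>i<n. frag_of (frag_coord a $ i, basis_elem i)) -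
      (\<Sum>i<n. frag_of (frag_coord (a - b) $ i, basis_elem i)) -
      (\<Sum>i<n. frag_of (frag_coord b $ i, basis_elem i))) \<in> K"
    using K_add by blast
  then show ?case using v by (simp add: algebra_simps)
next
  case (3 p)
  then obtain s x where p: "p = (s, x)" and s: "s \<in> S" and x: "x \<in> carrier M" by auto
  have c: "frag_coord (frag_of p) = s \<cdot>\<^sub>v map_vec h (\<kappa> x)"
    unfolding p by (rule frag_coord_of[OF x])
  have dx: "dim_vec (\<kappa> x) = n" using x by simp
  have v: "s \<cdot>\<^sub>v map_vec h (\<kappa> x) \<in> vecs S n"
    using s dx subring_setD(4)[OF target] hom_onD(3)[OF hom] by (auto simp: vecs_def)
  have 1: "frag_of (s, x) - (\<Sum>i<n. frag_of (s, (\<kappa> x $ i) \<odot>\<^bsub>M\<^esub> basis_elem i)) \<in> K"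
    using frag_finsum_K[OF s, of "{..<n}" "\<lambda>i. (\<kappa> x $ i) \<odot>\<^bsub>M\<^esub> basis_elem i"]
    by (simp add: smult_closed flip: lincomb_basis_elem[OF x])
  have "(\<Sum>i<n. frag_of (s * h (\<kappa> x $ i), basis_elem i) -
      frag_of (s, (\<kappa> x $ i) \<odot>\<^bsub>M\<^esub> basis_elem i)) \<in> K"
    by (intro K_sum rel_smult s basis_elem_closed)
  from K_diff[OF 1 this]
  have "frag_of (s, x) - (\<Sum>i<n. frag_of (s * h (\<kappa> x $ i), basis_elem i)) \<in> K"
    by (simp add: sum_subtractf)
  moreover have "(\<Sum>i<n. frag_of ((s \<cdot>\<^sub>v map_vec h (\<kappa> x)) $ i, basis_elem i)) =
      (\<Sum>i<n. frag_of (s * h (\<kappa> x $ i), basis_elem i))"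
    by (rule sum.cong) (auto simp: dx)
  ultimately show ?case using v by (simp add: c) (simp add: p)
qed

text \<open>The formal sums with zero coordinates form a subgroup containing all relations, hence
  all of \<open>K\<close>. Conversely, such a sum equals the normal form of 0 modulo
  \<open>K\<close>.\<close>

lemma K_iff: "c \<in> K \<longleftrightarrow> c \<in> carrier G \<and> frag_coord c = 0\<^sub>v n"
proof
  have "subgroup {c \<in> carrier G. frag_coord c = 0\<^sub>v n} G"
  proof (rule G.subgroupI)
    show "{c \<in> carrier G. frag_coord c = 0\<^sub>v n} \<noteq> {}" by (auto intro!: exI[of _ 0])
    fix a assume a: "a \<in> {c \<in> carrier G. frag_coord c = 0\<^sub>v n}"
    then show "inv\<^bsub>G\<^esub> a \<in> {c \<in> carrier G. frag_coord c = 0\<^sub>v n}"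
      by (auto simp: frag_coord_minus)
    fix b assume b: "b \<in> {c \<in> carrier G. frag_coord c = 0\<^sub>v n}"
    show "a \<otimes>\<^bsub>G\<^esub> b \<in> {c \<in> carrier G. frag_coord c = 0\<^sub>v n}"
      using a b keys_add_subset[of a "S \<times> carrier M" b] by (auto simp: frag_coord_add)
  qed auto
  then have sub: "K \<subseteq> {c \<in> carrier G. frag_coord c = 0\<^sub>v n}"
    unfolding tensor_ker_def by (rule G.generate_subgroup_incl[OF rels_subset])
  show "c \<in> K \<Longrightarrow> c \<in> carrier G \<and> frag_coord c = 0\<^sub>v n" using sub by blast
  assume c: "c \<in> carrier G \<and> frag_coord c = 0\<^sub>v n"
  \<comment> \<open>A generator (0, x) is not the zero of the free abelian group, so the normal form
    of 0 is a nontrivial formal sum when n > 0, and its membership in \<open>K\<close> needs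
    proof.\<close>
  have frag_normal_zero: "(\<Sum>i<n. frag_of (frag_coord 0 $ i, basis_elem i)) \<in> K"
    using K_minus frag_normal_form[of 0] by force
  have "c - (\<Sum>i<n. frag_of (frag_coord c $ i, basis_elem i)) \<in> K"
    using frag_normal_form[of c] c by simp
  from K_add[OF this frag_normal_zero] show "c \<in> K" using c by simp
qed

lemma r_coset_eq: "K #>\<^bsub>G\<^esub> a = {c. \<exists>k\<in>K. c = k + a}"
  by (auto simp: r_coset_def)

lemma r_coset_mem:
  assumes "a \<in> carrier G"
  shows "c \<in> K #>\<^bsub>G\<^esub> a \<longleftrightarrow> c \<in> carrier G \<and> frag_coord c = frag_coord a"
proof
  assume "c \<in> K #>\<^bsub>G\<^esub> a"
  then obtain k where k: "k \<in> K" "c = k + a" by (auto simp: r_coset_eq)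
  then show "c \<in> carrier G \<and> frag_coord c = frag_coord a"
    using assms keys_add_subset[of k "S \<times> carrier M" a] by (auto simp: K_iff frag_coord_add)
next
  assume c: "c \<in> carrier G \<and> frag_coord c = frag_coord a"
  then have "c - a \<in> K"
    using assms keys_diff_subset[of c "S \<times> carrier M" a] by (auto simp: K_iff frag_coord_diff)
  then show "c \<in> K #>\<^bsub>G\<^esub> a" unfolding r_coset_eq by (intro CollectI bexI[of _ "c - a"]) auto
qed

lemma r_coset_cong:
  assumes "a \<in> carrier G" "b \<in> carrier G" "frag_coord a = frag_coord b"
  shows "K #>\<^bsub>G\<^esub> a = K #>\<^bsub>G\<^esub> b"
  by (rule Set.set_eqI) (simp only: r_coset_mem[OF assms(1)] r_coset_mem[OF assms(2)] assms(3))

text \<open>The choice of representative is harmless, because \<open>frag_coord\<close> is constant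
  on cosets.\<close>

definition tensor_coord :: "('s \<times> 'm \<Rightarrow>\<^sub>0 int) set \<Rightarrow> 's vec" where
  "tensor_coord X = frag_coord (SOME c. c \<in> X)"

lemma tensor_coord_coset:
  assumes "a \<in> carrier G"
  shows "tensor_coord (K #>\<^bsub>G\<^esub> a) = frag_coord a"
proof -
  have "a \<in> K #>\<^bsub>G\<^esub> a" using r_coset_mem[OF assms] assms by simp
  then have "(SOME c. c \<in> K #>\<^bsub>G\<^esub> a) \<in> K #>\<^bsub>G\<^esub> a" by (rule someI)
  then show ?thesis using r_coset_mem[OF assms] by (simp add: tensor_coord_def)
qed

lemma base_change_simps:
  "carrier (base_change h S M) = (\<lambda>a. K #>\<^bsub>G\<^esub> a) ` carrier G"
  "\<zero>\<^bsub>base_change h S M\<^esub> = K"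
  "X \<oplus>\<^bsub>base_change h S M\<^esub> Y = X <#>\<^bsub>G\<^esub> Y"
  "s \<odot>\<^bsub>base_change h S M\<^esub> X =
     (\<Union>x\<in>X. K #>\<^bsub>G\<^esub> frag_extend (\<lambda>(u, m). frag_of (s * u, m)) x)"
  by (auto simp: base_change_def Let_def FactGroup_def RCOSETS_def image_iff)

lemma coset_add:
  assumes "a \<in> carrier G" "b \<in> carrier G"
  shows "(K #>\<^bsub>G\<^esub> a) <#>\<^bsub>G\<^esub> (K #>\<^bsub>G\<^esub> b) = K #>\<^bsub>G\<^esub> (a + b)"
proof -
  have "normal K G" by (rule G.subgroup_imp_normal[OF subgroup_K])
  from normal.rcos_sum[OF this assms] show ?thesis by simp
qed

lemma frag_scale:
  assumes s: "s \<in> S" and "Poly_Mapping.keys c \<subseteq> S \<times> carrier M"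
  shows "Poly_Mapping.keys (frag_extend (\<lambda>(u, m). frag_of (s * u, m)) c) \<subseteq> S \<times> carrier M \<and>
    frag_coord (frag_extend (\<lambda>(u, m). frag_of (s * u, m)) c) = s \<cdot>\<^sub>v frag_coord c"
  using assms(2)
proof (induction rule: free_Abelian_group_induct[consumes 1, case_names 1 2 3])
  case 1
  show ?case by auto
next
  case (2 x y)
  then show ?case
    using keys_diff_subset[of "frag_extend (\<lambda>(u, m). frag_of (s * u, m)) x" "S \<times> carrier M"
        "frag_extend (\<lambda>(u, m). frag_of (s * u, m)) y"]
    by (auto simp: frag_extend_diff frag_coord_diff right_diff_distrib)
next
  case (3 p)
  then show ?case
    using s subring_setD(4)[OF target]
    by (auto simp: keys_frag_of frag_coord_of)
qed

text \<open>Scalar multiplication was encoded as a union over all representatives. Scaling acts on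
  coordinates, so all cosets in this union coincide.\<close>

lemma coset_smult:
  assumes s: "s \<in> S" and a: "a \<in> carrier G"
  shows "s \<odot>\<^bsub>base_change h S M\<^esub> (K #>\<^bsub>G\<^esub> a) =
    K #>\<^bsub>G\<^esub> frag_extend (\<lambda>(u, m). frag_of (s * u, m)) a"
proof -
  have "K #>\<^bsub>G\<^esub> frag_extend (\<lambda>(u, m). frag_of (s * u, m)) c =
      K #>\<^bsub>G\<^esub> frag_extend (\<lambda>(u, m). frag_of (s * u, m)) a" if "c \<in> K #>\<^bsub>G\<^esub> a" for c
    using that a frag_scale[OF s] by (intro r_coset_cong) (auto simp: r_coset_mem)
  moreover have "a \<in> K #>\<^bsub>G\<^esub> a" using r_coset_mem[OF a] a by simp
  ultimately show ?thesis unfolding base_change_simps by blast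
qed

lemma pure_tensor_closed:
  assumes "s \<in> S" "x \<in> carrier M"
  shows "pure_tensor h S M s x \<in> carrier (base_change h S M)"
  using assms by (auto simp: pure_tensor_def base_change_simps)

lemma tensor_coord_pure_tensor:
  assumes "s \<in> S" "x \<in> carrier M"
  shows "tensor_coord (pure_tensor h S M s x) = s \<cdot>\<^sub>v map_vec h (\<kappa> x)"
  using assms by (simp add: pure_tensor_def tensor_coord_coset frag_coord_of)

lemma tensor_coord_pure_tensor_1:
  assumes "x \<in> carrier M"
  shows "pure_tensor h S M 1 x \<in> carrier (base_change h S M)"
    "tensor_coord (pure_tensor h S M 1 x) = map_vec h (\<kappa> x)"
  using tensor_coord_pure_tensor[OF subring_setD(2)[OF target] assms]
    pure_tensor_closed[OF subring_setD(2)[OF target] assms] by simp_all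

text \<open>Two cosets with equal coordinates coincide by \<open>r_coset_cong\<close>, and a vector
  v is attained at the sum of the v_i \<otimes> e_i. Thus freeness and rank survive the quotient
  construction.\<close>

lemma coordinates_base_change: "coordinates S (base_change h S M) n tensor_coord"
proof
  show "subring_set S" by (rule target)
  note tc = tensor_coord_coset
  show "bij_betw tensor_coord (carrier (base_change h S M)) (vecs S n)"
    unfolding bij_betw_def
  proof
    show "inj_on tensor_coord (carrier (base_change h S M))"
    proof (rule inj_onI)
      fix X Y assume "X \<in> carrier (base_change h S M)" "Y \<in> carrier (base_change h S M)"
        and eq: "tensor_coord X = tensor_coord Y"
      then obtain a b where ab: "a \<in> carrier G" "b \<in> carrier G" and X: "X = K #>\<^bsub>G\<^esub> a"
        and Y: "Y = K #>\<^bsub>G\<^esub> b"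
        unfolding base_change_simps(1) by blast
      show "X = Y"
        using eq unfolding X Y tc[OF ab(1)] tc[OF ab(2)] by (rule r_coset_cong[OF ab])
    qed
    show "tensor_coord ` carrier (base_change h S M) = vecs S n"
    proof
      show "tensor_coord ` carrier (base_change h S M) \<subseteq> vecs S n"
        using frag_normal_form by (auto simp: base_change_simps tc)
      show "vecs S n \<subseteq> tensor_coord ` carrier (base_change h S M)"
      proof
        fix v assume v: "v \<in> vecs S n"
        let ?a = "\<Sum>i<n. frag_of (v $ i, basis_elem i)"
        have ac: "?a \<in> carrier G"
          unfolding tensor_free_def
          by (rule sum_closed_free_Abelian_group) (use v in \<open>auto simp: vecs_def\<close>)
        have "frag_coord ?a = v"
          using v hom_onD[OF hom]
          by (intro eq_vecI) (auto simp: vecs_def frag_coord_def frag_eval_sum unit_vec_def if_distrib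
            if_distribR sum.delta cong: if_cong)
        then have "v = tensor_coord (K #>\<^bsub>G\<^esub> ?a)" using tc[OF ac] by simp
        then show "v \<in> tensor_coord ` carrier (base_change h S M)"
          using ac by (auto simp: base_change_simps)
      qed
    qed
  qed
  have K: "K = K #>\<^bsub>G\<^esub> 0" using r_coset_eq[of 0] by auto
  show "\<zero>\<^bsub>base_change h S M\<^esub> \<in> carrier (base_change h S M)"
    unfolding base_change_simps by (subst K) auto
  show "tensor_coord \<zero>\<^bsub>base_change h S M\<^esub> = 0\<^sub>v n"
    unfolding base_change_simps by (subst K) (simp add: tc)
  show "X \<oplus>\<^bsub>base_change h S M\<^esub> Y \<in> carrier (base_change h S M)"
    "tensor_coord (X \<oplus>\<^bsub>base_change h S M\<^esub> Y) = tensor_coord X + tensor_coord Y"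
    if "X \<in> carrier (base_change h S M)" "Y \<in> carrier (base_change h S M)" for X Y
  proof -
    obtain a b where ab: "a \<in> carrier G" "b \<in> carrier G" and X: "X = K #>\<^bsub>G\<^esub> a" and Y: "Y = K #>\<^bsub>G\<^esub> b"
      using \<open>X \<in> _\<close> \<open>Y \<in> _\<close> unfolding base_change_simps(1) by blast
    have "X \<oplus>\<^bsub>base_change h S M\<^esub> Y = K #>\<^bsub>G\<^esub> (a + b)"
      unfolding X Y base_change_simps(3) by (rule coset_add[OF ab])
    moreover have c: "a + b \<in> carrier G" unfolding G_simps
      by (rule keys_add_subset) (use ab in auto)
    ultimately show "X \<oplus>\<^bsub>base_change h S M\<^esub> Y \<in> carrier (base_change h S M)"
      "tensor_coord (X \<oplus>\<^bsub>base_change h S M\<^esub> Y) = tensor_coord X + tensor_coord Y"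
      using tc[OF c] tc[OF ab(1)] tc[OF ab(2)]
      by (auto simp: base_change_simps(1) X Y frag_coord_add)
  qed
  show "s \<odot>\<^bsub>base_change h S M\<^esub> X \<in> carrier (base_change h S M)"
    "tensor_coord (s \<odot>\<^bsub>base_change h S M\<^esub> X) = s \<cdot>\<^sub>v tensor_coord X"
    if s: "s \<in> S" and "X \<in> carrier (base_change h S M)" for s X
  proof -
    obtain a where a: "a \<in> carrier G" and X: "X = K #>\<^bsub>G\<^esub> a"
      using \<open>X \<in> _\<close> unfolding base_change_simps(1) by blast
    have c: "frag_extend (\<lambda>(u, m). frag_of (s * u, m)) a \<in> carrier G"
      using frag_scale[OF s] a by auto
    show "s \<odot>\<^bsub>base_change h S M\<^esub> X \<in> carrier (base_change h S M)"
      "tensor_coord (s \<odot>\<^bsub>base_change h S M\<^esub> X) = s \<cdot>\<^sub>v tensor_coord X"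
      using c tc[OF c] tc[OF a] frag_scale[OF s, of a] a
      unfolding X coset_smult[OF s a] by (auto simp: base_change_simps(1))
  qed
qed

end


section \<open>Dual modules and pairings\<close>

lemma coordinates_regular_module:
  assumes "subring_set S"
  shows "coordinates S (regular_module S) 1 (\<lambda>s. vec 1 (\<lambda>_. s))"
proof
  show "bij_betw (\<lambda>s. vec 1 (\<lambda>_. s)) (carrier (regular_module S)) (vecs S 1)"
  proof (rule bij_betw_byWitness[where f' = "\<lambda>v. v $ 0"])
    show "\<forall>v\<in>vecs S 1. vec 1 (\<lambda>_. v $ 0) = v"
      by (auto simp: vecs_def intro!: eq_vecI)
  qed (auto simp: regular_module_def vecs_def)
qed (use assms subring_setD[OF assms] in \<open>auto simp: regular_module_def\<close>)

context coordinates
begin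

lemma dual_module_simps:
  "carrier (dual_module S M) = linear_maps S M (regular_module S)"
  "\<zero>\<^bsub>dual_module S M\<^esub> = (\<lambda>x\<in>carrier M. 0)"
  "f \<oplus>\<^bsub>dual_module S M\<^esub> g = (\<lambda>x\<in>carrier M. f x + g x)"
  "s \<odot>\<^bsub>dual_module S M\<^esub> f = (\<lambda>x\<in>carrier M. s * f x)"
  by (simp_all add: dual_module_def)

text \<open>Coordinates with respect to the dual basis, chosen so that evaluation becomes the dot
  product.\<close>

definition dual_coord :: "('m \<Rightarrow> 's) \<Rightarrow> 's vec" where
  "dual_coord f = vec n (\<lambda>i. f (basis_elem i))"

lemma dual_module_pair: "coordinates_pair S M n \<kappa> S (regular_module S) 1 (\<lambda>s. vec 1 (\<lambda>_. s)) (\<lambda>s. s)"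
  by (intro coordinates_pair.intro coordinates_axioms coordinates_regular_module ring)
     (simp add: coordinates_pair_axioms_def)

lemma dual_module_apply:
  assumes f: "f \<in> carrier (dual_module S M)" and x: "x \<in> carrier M"
  shows "f x = dual_coord f \<bullet> \<kappa> x"
proof -
  have "vec 1 (\<lambda>_. f x) $ 0 = (mat 1 n (\<lambda>(i, j). vec 1 (\<lambda>_. f (basis_elem j)) $ i) *\<^sub>v map_vec (\<lambda>s. s) (\<kappa> x)) $ 0"
    using coordinates_pair.semilinear_maps_coord[OF dual_module_pair, of f x] assms
    by (simp add: dual_module_simps)
  then show ?thesis using x by (simp add: dual_coord_def scalar_prod_def)
qed

lemma dual_coord_vecs:
  assumes f: "f \<in> carrier (dual_module S M)"
  shows "dual_coord f \<in> vecs S n"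
  using semilinear_mapsD(1)[OF f[unfolded dual_module_simps]]
  by (auto simp: vecs_def dual_coord_def regular_module_def)

lemma scalar_prod_vecs:
  assumes "v \<in> vecs S n" "w \<in> vecs S n"
  shows "v \<bullet> w \<in> S"
  using assms subring_setD(4)[OF ring]
  by (auto simp: scalar_prod_def vecs_def intro!: subring_set_sum[OF ring])

lemma dual_module_mem:
  assumes v: "v \<in> vecs S n"
  shows "(\<lambda>x\<in>carrier M. v \<bullet> \<kappa> x) \<in> carrier (dual_module S M)"
proof -
  have vc: "v \<in> carrier_vec n" using v by (simp add: vecs_def)
  show ?thesis
    unfolding dual_module_simps semilinear_maps_def
    using v
    by (auto simp: regular_module_def add_closed smult_closed coord_add coord_smult
        scalar_prod_vecs coord_vecs scalar_prod_add_distrib[OF vc] scalar_prod_smult_distrib[OF vc])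
qed

lemma coordinates_dual_module: "coordinates S (dual_module S M) n dual_coord"
proof
  show "subring_set S" by (rule ring)
  let ?D = "dual_module S M"
  note ap = dual_module_apply
  have inj: "f = g" if f: "f \<in> carrier ?D" and g: "g \<in> carrier ?D"
      and eq: "dual_coord f = dual_coord g" for f g
  proof
    fix x
    show "f x = g x"
      using ap[OF f] ap[OF g] eq semilinear_mapsD(4)[OF f[unfolded dual_module_simps]]
        semilinear_mapsD(4)[OF g[unfolded dual_module_simps]]
      by (cases "x \<in> carrier M") auto
  qed
  show "bij_betw dual_coord (carrier ?D) (vecs S n)"
  proof (rule bij_betwI')
    show "dual_coord f = dual_coord g \<longleftrightarrow> f = g" if "f \<in> carrier ?D" "g \<in> carrier ?D" for f g
      using inj that by blast
    show "dual_coord f \<in> vecs S n" if "f \<in> carrier ?D" for f by (rule dual_coord_vecs[OF that])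
    show "\<exists>f\<in>carrier ?D. v = dual_coord f" if v: "v \<in> vecs S n" for v
    proof (rule bexI[OF _ dual_module_mem[OF v]])
      show "v = dual_coord (\<lambda>x\<in>carrier M. v \<bullet> \<kappa> x)"
        using v by (auto simp: dual_coord_def vecs_def)
    qed
  qed
  have mem: "h \<in> carrier ?D" if "dual_coord h = v" "v \<in> vecs S n" "h = (\<lambda>x\<in>carrier M. v \<bullet> \<kappa> x)" for h v
    using dual_module_mem that by simp
  show "\<zero>\<^bsub>?D\<^esub> \<in> carrier ?D"
  proof -
    have "\<zero>\<^bsub>?D\<^esub> = (\<lambda>x\<in>carrier M. 0\<^sub>v n \<bullet> \<kappa> x)"
      by (auto simp: dual_module_simps scalar_prod_left_zero[OF coord_carrier] intro!: restrict_ext)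
    then show ?thesis using dual_module_mem[of "0\<^sub>v n"] subring_setD(1)[OF ring] by (auto simp: vecs_def)
  qed
  show "dual_coord \<zero>\<^bsub>?D\<^esub> = 0\<^sub>v n" by (auto simp: dual_coord_def dual_module_simps)
  fix f assume f: "f \<in> carrier ?D"
  note fv = dual_coord_vecs[OF f]
  then have fc: "dual_coord f \<in> carrier_vec n" by (simp add: vecs_def)
  {
    fix g assume g: "g \<in> carrier ?D"
    note gv = dual_coord_vecs[OF g]
    then have gc: "dual_coord g \<in> carrier_vec n" by (simp add: vecs_def)
    have "f \<oplus>\<^bsub>?D\<^esub> g = (\<lambda>x\<in>carrier M. (dual_coord f + dual_coord g) \<bullet> \<kappa> x)"
      unfolding dual_module_simps
      by (rule restrict_ext) (simp add: ap f g add_scalar_prod_distrib[OF fc gc coord_carrier])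
    moreover have "dual_coord f + dual_coord g \<in> vecs S n"
      using fv gv subring_setD(3)[OF ring] by (auto simp: vecs_def)
    ultimately show "f \<oplus>\<^bsub>?D\<^esub> g \<in> carrier ?D" using dual_module_mem by metis
    show "dual_coord (f \<oplus>\<^bsub>?D\<^esub> g) = dual_coord f + dual_coord g"
      by (auto simp: dual_coord_def dual_module_simps)
  }
  fix s assume s: "s \<in> S"
  have "s \<odot>\<^bsub>?D\<^esub> f = (\<lambda>x\<in>carrier M. (s \<cdot>\<^sub>v dual_coord f) \<bullet> \<kappa> x)"
    unfolding dual_module_simps
    by (rule restrict_ext) (simp add: ap f scalar_prod_smult_left carrier_vecD[OF fc])
  moreover have "s \<cdot>\<^sub>v dual_coord f \<in> vecs S n"
    using fv s subring_setD(4)[OF ring] by (auto simp: vecs_def)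
  ultimately show "s \<odot>\<^bsub>?D\<^esub> f \<in> carrier ?D" using dual_module_mem by metis
  show "dual_coord (s \<odot>\<^bsub>?D\<^esub> f) = s \<cdot>\<^sub>v dual_coord f"
    by (auto simp: dual_coord_def dual_module_simps)
qed

end

lemma map_vec_ident: "map_vec (\<lambda>s. s) v = v"
  by (rule eq_vecI) simp_all

lemma map_vec_unit_vec:
  assumes "hom_on S T h"
  shows "map_vec h (unit_vec n i) = unit_vec n i"
  by (auto simp: unit_vec_def hom_onD(1,2)[OF assms])

lemma map_vec_scalar_prod:
  assumes h: "hom_on UNIV T h" and "v \<in> carrier_vec n" "w \<in> carrier_vec n"
  shows "h (v \<bullet> w) = map_vec h v \<bullet> map_vec h w"
  using assms(2,3) hom_onD(5)[OF h] by (auto simp: scalar_prod_def hom_on_sum[OF h])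

text \<open>The basis vectors are asked for only through their coordinates, so pure tensors can
  serve directly as test elements.\<close>

lemma coordinates_semilinear_maps_eqI:
  assumes "coordinates S M n \<kappa>" "coordinates T N m \<mu>" "hom_on S T h"
    and "f \<in> semilinear_maps S h M N" "g \<in> semilinear_maps S h M N"
    and "\<And>j. j < n \<Longrightarrow> \<exists>x\<in>carrier M. \<kappa> x = unit_vec n j \<and> f x = g x"
  shows "f = g"
proof -
  interpret coordinates_pair S M n \<kappa> T N m \<mu> h
    using assms by (intro coordinates_pair.intro coordinates_pair_axioms.intro)
  show ?thesis
  proof (rule semilinear_maps_eqI[OF assms(4,5)])
    fix j assume "j < n"
    then obtain x where "x \<in> carrier M" "\<kappa> x = unit_vec n j" "f x = g x" using assms(6) by blast
    moreover from this have "x = dom.basis_elem j" by (intro dom.coord_inj) auto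
    ultimately show "f (dom.basis_elem j) = g (dom.basis_elem j)" by simp
  qed
qed

text \<open>A dot product remains a dot product after base change. Uniqueness is applied twice,
  since a bilinear pairing is a linear map into the dual: for the map itself and for each functional
  among its values.\<close>

lemma pairing_base_change_eq:
  fixes h :: "'r::comm_ring_1 \<Rightarrow> 's::comm_ring_1"
  assumes M: "coordinates UNIV M n \<kappa>" and N: "coordinates UNIV N n \<mu>"
    and S: "subring_set S" and h: "hom_on UNIV S h"
    and B: "\<And>x y. x \<in> carrier M \<Longrightarrow> y \<in> carrier N \<Longrightarrow> B x y = \<kappa> x \<bullet> \<mu> y"
    and X: "X \<in> carrier (base_change h S M)" and Y: "Y \<in> carrier (base_change h S N)"
  shows "pairing_base_change h S M N B X Y =
    base_change_coordinates.tensor_coord n \<kappa> h X \<bullet> base_change_coordinates.tensor_coord n \<mu> h Y"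
proof -
  interpret M: base_change_coordinates M n \<kappa> S h
    using M S h by (intro base_change_coordinates.intro base_change_coordinates_axioms.intro)
  interpret N: base_change_coordinates N n \<mu> S h
    using N S h by (intro base_change_coordinates.intro base_change_coordinates_axioms.intro)
  let ?M = "base_change h S M" and ?N = "base_change h S N"
  interpret MS: coordinates S ?M n M.tensor_coord by (rule M.coordinates_base_change)
  interpret NS: coordinates S ?N n N.tensor_coord by (rule N.coordinates_base_change)
  interpret ND: coordinates S "dual_module S ?N" n NS.dual_coord by (rule NS.coordinates_dual_module)
  interpret P: coordinates_pair S ?M n M.tensor_coord S "dual_module S ?N" n NS.dual_coord "\<lambda>s. s"
    by (intro coordinates_pair.intro coordinates_pair_axioms.intro MS.coordinates_axioms
        ND.coordinates_axioms hom_on_ident)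
  \<comment> \<open>Sending coordinates unchanged to dual coordinates is exactly the dot product
    pairing.\<close>
  define B' where "B' = P.matrix_map (1\<^sub>m n)"
  have one: "1\<^sub>m n \<in> mats S n n" using subring_setD[OF S] by (auto simp: mats_def one_mat_def)
  have B'lin: "B' \<in> linear_maps S ?M (dual_module S ?N)"
    unfolding B'_def by (rule P.matrix_map_semilinear[OF one])
  have B'ap: "B' X Y = M.tensor_coord X \<bullet> N.tensor_coord Y"
    if X: "X \<in> carrier ?M" and Y: "Y \<in> carrier ?N" for X Y
    using NS.dual_module_apply[OF semilinear_mapsD(1)[OF B'lin X] Y] P.coord_matrix_map[OF one X]
      MS.coord_carrier[OF X]
    by (simp add: B'_def map_vec_ident)
  have "pairing_base_change h S M N B = B'"
    unfolding pairing_base_change_def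
  proof (rule the_equality)
    show "B' \<in> linear_maps S ?M (dual_module S ?N) \<and>
        (\<forall>m\<in>carrier M. \<forall>n\<in>carrier N.
           B' (pure_tensor h S M 1 m) (pure_tensor h S N 1 n) = h (B m n))"
      using B'lin
      by (auto simp: B'ap M.tensor_coord_pure_tensor_1 N.tensor_coord_pure_tensor_1 B
          map_vec_scalar_prod[OF h M.coord_carrier N.coord_carrier])
  next
    fix C assume C: "C \<in> linear_maps S ?M (dual_module S ?N) \<and>
        (\<forall>m\<in>carrier M. \<forall>n\<in>carrier N.
           C (pure_tensor h S M 1 m) (pure_tensor h S N 1 n) = h (B m n))"
    show "C = B'"
    proof (rule coordinates_semilinear_maps_eqI[OF MS.coordinates_axioms ND.coordinates_axioms
          hom_on_ident _ B'lin])
      show Clin: "C \<in> linear_maps S ?M (dual_module S ?N)" using C by blast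
      fix j assume "j < n"
      let ?x = "pure_tensor h S M 1 (M.basis_elem j)"
      have x: "?x \<in> carrier ?M" "M.tensor_coord ?x = unit_vec n j"
        using M.tensor_coord_pure_tensor_1[OF M.basis_elem_closed] map_vec_unit_vec[OF h] by auto
      have "C ?x = B' ?x"
      proof (rule coordinates_semilinear_maps_eqI[OF NS.coordinates_axioms
            coordinates_regular_module[OF S] hom_on_ident])
        show "C ?x \<in> linear_maps S ?N (regular_module S)" "B' ?x \<in> linear_maps S ?N (regular_module S)"
          using semilinear_mapsD(1)[OF Clin x(1)] semilinear_mapsD(1)[OF B'lin x(1)]
          by (simp_all add: NS.dual_module_simps)
        fix i assume "i < n"
        let ?y = "pure_tensor h S N 1 (N.basis_elem i)"
        have y: "?y \<in> carrier ?N" "N.tensor_coord ?y = unit_vec n i"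
          using N.tensor_coord_pure_tensor_1[OF N.basis_elem_closed] map_vec_unit_vec[OF h] by auto
        have "C ?x ?y = h (unit_vec n j \<bullet> unit_vec n i)"
          using C by (simp add: B)
        also have "\<dots> = B' ?x ?y"
          by (simp add: B'ap x y map_vec_scalar_prod[OF h, of _ n] map_vec_unit_vec[OF h])
        finally show "\<exists>y\<in>carrier ?N. N.tensor_coord y = unit_vec n i \<and> C ?x y = B' ?x y"
          using y by blast
      qed
      then show "\<exists>x\<in>carrier ?M. M.tensor_coord x = unit_vec n j \<and> C x = B' x"
        using x by blast
    qed
  qed
  then show ?thesis using B'ap[OF X Y] by simp
qed


section \<open>Arithmetic of the finite field\<close>

text \<open>Multiplication by a nonzero x permutes the nonzero elements; comparing their products
  gives x^(q-1) = 1.\<close>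

lemma power_card_UNIV:
  fixes x :: "'a::{field,finite}"
  shows "x ^ CARD('a) = x"
proof (cases "x = 0")
  case False
  define n where "n = card (UNIV - {0 :: 'a})"
  have "bij_betw ((*) x) (UNIV - {0}) (UNIV - {0})"
    by (rule bij_betw_byWitness[where f' = "\<lambda>y. y / x"]) (use False in auto)
  then have "(\<Prod>y\<in>UNIV - {0}. x * y) = \<Prod>(UNIV - {0})"
    by (rule prod.reindex_bij_betw)
  then have "x ^ n * \<Prod>(UNIV - {0}) = \<Prod>(UNIV - {0 :: 'a})"
    by (simp add: prod.distrib n_def)
  then have "x ^ n = 1" by simp
  moreover have "CARD('a) = Suc n" by (simp add: n_def card_Diff_singleton)
  ultimately show ?thesis by simp
qed (simp add: zero_power)

lemma card_UNIV_gt_1: "CARD('a::{field,finite}) > 1"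
  using card_mono[of UNIV "{0, 1 :: 'a}"] by simp

lemma poly_eq_0_if_card_roots:
  fixes p :: "'a::idom poly"
  assumes "degree p < card A" "\<And>x. x \<in> A \<Longrightarrow> poly p x = 0"
  shows "p = 0"
proof (rule ccontr)
  assume p: "p \<noteq> 0"
  have "card A \<le> card {x. poly p x = 0}"
    by (rule card_mono[OF poly_roots_finite[OF p]]) (use assms(2) in auto)
  also have "\<dots> \<le> degree p" by (rule card_poly_roots_bound[OF p])
  finally show False using assms(1) by simp
qed

text \<open>Both sides are monic of degree \<open>q\<close> and agree on the \<open>q\<close> elements of the field.\<close>

lemma linear_power_card:
  "[:1, 1 :: 'a::{field,finite}:] ^ CARD('a) = monom 1 CARD('a) + 1"
proof -
  let ?q = "CARD('a)"
  define P where "P = [:1, 1 :: 'a:] ^ ?q - (monom 1 ?q + 1)"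
  have q: "?q > 0" by simp
  have deg: "degree ([:1, 1 :: 'a:] ^ ?q) = ?q" by (simp add: degree_power_eq)
  have lc: "coeff ([:1, 1 :: 'a:] ^ ?q) ?q = 1"
    using lead_coeff_power[of "[:1, 1 :: 'a:]" ?q] deg by simp
  have "coeff P i = 0" if "i \<ge> ?q" for i
    using that lc deg q by (cases "i = ?q") (auto simp: P_def coeff_eq_0)
  then have "degree P < ?q"
    using q by (metis degree_0 leading_coeff_0_iff not_less)
  moreover have "poly P x = 0" for x
    by (simp add: P_def poly_monom power_card_UNIV)
  ultimately have "P = 0" by (intro poly_eq_0_if_card_roots[of P UNIV]) auto
  then show ?thesis by (simp add: P_def)
qed

lemma funpow_frob: "(frob q ^^ m) x = x ^ (q ^ m)"
  by (induction m arbitrary: x) (simp_all add: frob_def power_mult[symmetric] mult.commute funpow_swap1)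

locale drinfeld_setting =
  fixes \<gamma> :: "'k::{field,finite} poly \<Rightarrow> 'f::{field,finite}" and \<pp> :: "'k poly"
  assumes gamma: "\<gamma> \<in> ring_hom type_ring type_ring"
    and monic: "lead_coeff \<pp> = 1"
    and ker: "{a. \<gamma> a = 0} = {a. \<pp> dvd a}"
    and deg: "degree \<pp> = vector_space.dim (\<lambda>c x. struct_map \<gamma> c * x) (UNIV :: 'f set)"
begin

definition \<theta> :: 'f where "\<theta> = \<gamma> tvar"

abbreviation d :: nat where "d \<equiv> degree \<pp>"

sublocale gamma: idom_hom \<gamma>
proof -
  have add: "\<gamma> (a + b) = \<gamma> a + \<gamma> b" and mult: "\<gamma> (a * b) = \<gamma> a * \<gamma> b" and one: "\<gamma> 1 = 1" for a b
    using gamma by (auto simp: ring_hom_def type_ring_def)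
  have "\<gamma> 0 + \<gamma> 0 = \<gamma> 0 + 0" using add[of 0 0] by (simp only: add_0_right)
  then have "\<gamma> 0 = 0" by (rule add_left_imp_eq)
  then show "idom_hom \<gamma>" by unfold_locales (auto simp: add mult one)
qed

sublocale struct: field_hom "struct_map \<gamma>"
  by unfold_locales
     (auto simp: struct_map_def gamma.hom_add[symmetric] gamma.hom_mult[symmetric]
         one_pCons[symmetric] mult.commute)

lemma gamma_eq_poly: "\<gamma> a = poly (scalar_ext \<gamma> a) \<theta>"
proof (induction a)
  case (pCons c a)
  have "pCons c a = [:c:] + tvar * a" by simp
  then have "\<gamma> (pCons c a) = \<gamma> [:c:] + \<theta> * \<gamma> a"
    unfolding \<theta>_def by (simp only: gamma.hom_add gamma.hom_mult)
  then show ?case using pCons by (simp add: scalar_ext_def struct.map_poly_pCons_hom struct_map_def)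
qed (simp add: scalar_ext_def)

lemma gamma_eq_0_iff: "\<gamma> a = 0 \<longleftrightarrow> \<pp> dvd a"
  using ker by blast

lemma pp_nonzero: "\<pp> \<noteq> 0" using monic by auto

lemma d_pos: "d > 0"
proof (rule ccontr)
  assume "\<not> d > 0"
  then obtain c where "\<pp> = [:c:]" using degree_0_id[of \<pp>] by (metis gr0I)
  then have "\<pp> dvd 1" using monic by (simp add: one_pCons)
  then show False using gamma_eq_0_iff[of 1] by simp
qed

lemma gamma_inj_degree_less:
  assumes "degree a < d" "degree b < d" "\<gamma> a = \<gamma> b"
  shows "a = b"
proof (rule ccontr)
  assume "a \<noteq> b"
  moreover have "\<pp> dvd a - b" using assms(3) gamma_eq_0_iff[of "a - b"] by (simp add: gamma.hom_minus)
  ultimately have "d \<le> degree (a - b)" by (intro dvd_imp_degree_le) auto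
  then show False using degree_diff_less[OF assms(1,2)] by simp
qed

text \<open>A linear relation among \<theta>^j with j < d would be a nonzero polynomial of degree
  below d in the kernel, which \<pp> generates. So these powers are independent, and as d is the
  dimension of F they span it.\<close>

lemma surj_gamma: "surj \<gamma>"
proof -
  interpret vs: vector_space "\<lambda>c x. struct_map \<gamma> c * x"
    by unfold_locales (auto simp: algebra_simps struct.hom_add struct.hom_mult)
  obtain B where B: "vs.independent B" "UNIV \<subseteq> vs.span B" "card B = vs.dim UNIV"
    using vs.basis_exists[of UNIV] by metis
  define P where "P = (\<lambda>j. \<theta> ^ j) ` {..<d}"
  have lin: "(\<Sum>j<d. struct_map \<gamma> (u j) * \<theta> ^ j) = \<gamma> (\<Sum>j<d. monom (u j) j)" for u
  proof -
    have "\<gamma> (monom c j) = struct_map \<gamma> c * \<theta> ^ j" for c j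
      by (simp add: gamma_eq_poly scalar_ext_def poly_monom)
    then show ?thesis by (simp add: gamma.hom_sum)
  qed
  have degs: "degree (\<Sum>j<d. monom (u j) j) < d" for u :: "nat \<Rightarrow> 'k"
    by (rule degree_sum_less) (use d_pos in \<open>auto intro: le_less_trans[OF degree_monom_le]\<close>)
  have u0: "u j = 0" if "(\<Sum>j<d. struct_map \<gamma> (u j) * \<theta> ^ j) = 0" "j < d" for u j
  proof -
    have "(\<Sum>j<d. monom (u j) j) = 0"
      by (rule gamma_inj_degree_less) (use degs[of u] that(1) d_pos in \<open>auto simp: lin\<close>)
    then have "coeff (\<Sum>j<d. monom (u j) j) j = 0" by simp
    then show ?thesis using that(2) by (simp add: coeff_sum)
  qed
  have inj: "inj_on (\<lambda>j. \<theta> ^ j) {..<d}"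
  proof (rule inj_onI)
    fix i j assume ij: "i \<in> {..<d}" "j \<in> {..<d}" and eq: "\<theta> ^ i = \<theta> ^ j"
    have "monom 1 i = (monom 1 j :: 'k poly)"
      by (rule gamma_inj_degree_less)
         (use ij eq in \<open>auto simp: degree_monom_eq gamma_eq_poly scalar_ext_def poly_monom\<close>)
    then show "i = j" by (simp add: monom_eq_iff')
  qed
  have cP: "card P = d" unfolding P_def by (simp add: card_image[OF inj])
  have indP: "vs.independent P"
    unfolding vs.independent_explicit_finite_subsets
  proof (intro allI impI ballI)
    fix A u v assume A: "A \<subseteq> P" and "finite A" and s: "(\<Sum>v\<in>A. struct_map \<gamma> (u v) * v) = 0" and v: "v \<in> A"
    have "(\<Sum>v\<in>A. struct_map \<gamma> (u v) * v) = (\<Sum>v\<in>P. struct_map \<gamma> (if v \<in> A then u v else 0) * v)"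
      by (rule sum.mono_neutral_cong_left) (use A in \<open>auto simp: P_def\<close>)
    also have "\<dots> = (\<Sum>j<d. struct_map \<gamma> (if \<theta> ^ j \<in> A then u (\<theta> ^ j) else 0) * \<theta> ^ j)"
      unfolding P_def by (subst sum.reindex[OF inj]) simp
    finally have "(if \<theta> ^ j \<in> A then u (\<theta> ^ j) else 0) = 0" if "j < d" for j
      using u0[of "\<lambda>j. if \<theta> ^ j \<in> A then u (\<theta> ^ j) else 0", OF _ that] s by simp
    moreover obtain j where "j < d" "v = \<theta> ^ j" using A v by (auto simp: P_def)
    ultimately show "u v = 0" using v by metis
  qed
  have "x \<in> vs.span P" for x
  proof (rule ccontr)
    assume x: "x \<notin> vs.span P"
    then have ind: "vs.independent (insert x P)" using indP by (rule vs.independent_insertI)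
    have "x \<notin> P" using x vs.span_base by blast
    then have "card (insert x P) = Suc d" using cP by (simp add: P_def)
    moreover have "card (insert x P) \<le> card B"
      using vs.independent_span_bound[OF _ ind, of B] B(2) by auto
    ultimately show False using B(3) deg by simp
  qed
  then have "x \<in> range \<gamma>" for x
  proof -
    have fin: "finite P" by (simp add: P_def)
    have "x \<in> vs.span P" by fact
    then obtain u where "x = (\<Sum>v\<in>P. struct_map \<gamma> (u v) * v)"
      unfolding vs.span_finite[OF fin] by blast
    also have "\<dots> = (\<Sum>j<d. struct_map \<gamma> (u (\<theta> ^ j)) * \<theta> ^ j)"
      unfolding P_def by (subst sum.reindex[OF inj]) simp
    finally show ?thesis by (simp add: lin)
  qed
  then show ?thesis by blast
qed

text \<open>Any preimage may be replaced by its remainder modulo \<pp>.\<close>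

lemma gamma_rep: "\<exists>a. degree a < d \<and> \<gamma> a = x"
proof -
  obtain a where a: "\<gamma> a = x" using surj_gamma by (metis surjD)
  have "\<gamma> a = \<gamma> (\<pp> * (a div \<pp>) + a mod \<pp>)" by simp
  also have "\<dots> = \<gamma> (a mod \<pp>)"
    unfolding gamma.hom_add gamma.hom_mult using gamma_eq_0_iff[of \<pp>] by simp
  finally have "\<gamma> (a mod \<pp>) = x" using a by simp
  moreover have "degree (a mod \<pp>) < d" using degree_mod_less[OF pp_nonzero, of a] d_pos by auto
  ultimately show ?thesis by blast
qed

text \<open>Polynomials of degree below d represent every element of F exactly once, and they are
  counted by their coefficients.\<close>

lemma card_F: "CARD('f) = CARD('k) ^ d"
proof -
  have "bij_betw (\<lambda>u. \<Sum>j<d. monom (u j) j) ({..<d} \<rightarrow>\<^sub>E (UNIV :: 'k set)) {a. degree a < d}"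
  proof (rule bij_betw_byWitness[where f' = "\<lambda>a. \<lambda>j\<in>{..<d}. coeff a j"])
    show "(\<lambda>u. \<Sum>j<d. monom (u j) j) ` ({..<d} \<rightarrow>\<^sub>E (UNIV :: 'k set)) \<subseteq> {a. degree a < d}"
    proof clarify
      fix u :: "nat \<Rightarrow> 'k"
      show "degree (\<Sum>j<d. monom (u j) j) < d"
        by (rule degree_sum_less) (use d_pos in \<open>auto intro: le_less_trans[OF degree_monom_le]\<close>)
    qed
    show "\<forall>a\<in>{a :: 'k poly. degree a < d}. (\<Sum>j<d. monom ((\<lambda>j\<in>{..<d}. coeff a j) j) j) = a"
      by (auto simp: poly_eq_iff coeff_sum coeff_eq_0)
    show "\<forall>u\<in>{..<d} \<rightarrow>\<^sub>E (UNIV :: 'k set). (\<lambda>j\<in>{..<d}. coeff (\<Sum>j<d. monom (u j) j) j) = u"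
      by (auto simp: fun_eq_iff coeff_sum PiE_def extensional_def)
  qed (auto split: if_splits)
  then have "card {a :: 'k poly. degree a < d} = CARD('k) ^ d"
    by (simp add: bij_betw_same_card[symmetric] card_PiE)
  moreover have "bij_betw \<gamma> {a. degree a < d} UNIV"
    unfolding bij_betw_def inj_on_def using gamma_inj_degree_less gamma_rep
        by (auto simp: image_iff) metis
  ultimately show ?thesis by (metis bij_betw_same_card)
qed

lemma frob_struct [simp]: "frob CARD('k) (struct_map \<gamma> c) = struct_map \<gamma> c"
  by (simp add: frob_def struct.hom_power[symmetric] power_card_UNIV)

text \<open>The identity (1 + X)^q = X^q + 1, known over the small field, is carried to F[X] by
  \<open>struct_map\<close>, evaluated at x / y and multiplied by y^q. Binomial coefficients never
  enter.\<close>

lemma frob_add: "frob CARD('k) (x + y :: 'f) = frob CARD('k) x + frob CARD('k) y"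
proof (cases "y = 0")
  case False
  interpret mp: map_poly_comm_ring_hom "struct_map \<gamma>" ..
  have "map_poly (struct_map \<gamma>) ([:1, 1:] ^ CARD('k)) = map_poly (struct_map \<gamma>) (monom 1 CARD('k) + 1)"
    by (simp only: linear_power_card)
  then have "[:1, 1:] ^ CARD('k) = (monom 1 CARD('k) + 1 :: 'f poly)"
    by (simp add: mp.hom_power mp.hom_add struct.map_poly_pCons_hom)
  then have "poly ([:1, 1:] ^ CARD('k)) (x / y) = poly (monom 1 CARD('k) + 1) (x / y)" by simp
  then have "(1 + x / y) ^ CARD('k) = (x / y) ^ CARD('k) + 1" by (simp add: poly_monom)
  then have "(1 + x / y) ^ CARD('k) * y ^ CARD('k) = x ^ CARD('k) + y ^ CARD('k)"
    using False by (simp add: field_simps power_divide)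
  moreover have "(1 + x / y) ^ CARD('k) * y ^ CARD('k) = (x + y) ^ CARD('k)"
    using False by (simp add: power_mult_distrib[symmetric] field_simps)
  ultimately show ?thesis by (simp add: frob_def)
qed (simp add: frob_def zero_power)

sublocale frob: field_hom "frob CARD('k) :: 'f \<Rightarrow> 'f"
  by unfold_locales (auto simp: frob_def zero_power power_mult_distrib frob_add[unfolded frob_def])

lemma frob_pow_d: "(frob CARD('k) ^^ d) x = (x :: 'f)"
  using power_card_UNIV[of x] by (simp add: funpow_frob card_F)

section \<open>The conjugates of \<theta>\<close>

definition conj_root :: "nat \<Rightarrow> 'f" where
  "conj_root m = (frob CARD('k) ^^ m) \<theta>"

lemma frob_pow_poly: "(frob CARD('k) ^^ m) (poly (scalar_ext \<gamma> a) x) =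
    poly (scalar_ext \<gamma> a) ((frob CARD('k) ^^ m) x)"
proof (induction m)
  case (Suc m)
  have "map_poly (frob CARD('k)) (scalar_ext \<gamma> a) = scalar_ext \<gamma> a"
    by (simp add: poly_eq_iff scalar_ext_def)
  then have "frob CARD('k) (poly (scalar_ext \<gamma> a) y) = poly (scalar_ext \<gamma> a) (frob CARD('k) y)" for y
    using frob.poly_map_poly[of "scalar_ext \<gamma> a" y] by simp
  then show ?case using Suc by simp
qed simp

text \<open>A coincidence gives some 0 < s < d for which sigma^s fixes \<theta>. It then fixes all
  of F, as \<gamma> is surjective, and X^(q^s) - X would have q^d roots.\<close>

lemma inj_conj_root: "inj_on conj_root {..<d}"
proof -
  have False if m: "m < m'" "m' < d" and eq: "conj_root m = conj_root m'" for m m'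
  proof -
    define s where "s = m' - m"
    have s: "0 < s" "s < d" "m' = m + s" using m by (auto simp: s_def)
    have inj: "(frob CARD('k) ^^ m) x = (frob CARD('k) ^^ m) y \<Longrightarrow> x = y" for x y :: 'f
      by (induction m) (auto simp: frob.eq_iff)
    have "(frob CARD('k) ^^ m) \<theta> = (frob CARD('k) ^^ m) ((frob CARD('k) ^^ s) \<theta>)"
      using eq by (simp add: conj_root_def s(3) funpow_add)
    then have \<theta>: "(frob CARD('k) ^^ s) \<theta> = \<theta>" using inj by metis
    have fixed: "(frob CARD('k) ^^ s) x = x" for x :: 'f
    proof -
      obtain a where "\<gamma> a = x" using gamma_rep by blast
      then show ?thesis using frob_pow_poly[of s a \<theta>] \<theta> by (simp add: gamma_eq_poly)
    qed
    have qs: "CARD('k) ^ s < CARD('k) ^ d" using s card_UNIV_gt_1[where 'a = 'k] by simp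
    have "1 < CARD('k) ^ s" by (rule one_less_power[OF card_UNIV_gt_1[where 'a = 'k] s(1)])
    define P where "P = monom 1 (CARD('k) ^ s) - (tvar :: 'f poly)"
    have dP: "degree P \<le> CARD('k) ^ s"
      unfolding P_def by (rule degree_diff_le) (use \<open>1 < CARD('k) ^ s\<close> in \<open>auto simp: degree_monom_eq\<close>)
    have "P = 0"
    proof (rule poly_eq_0_if_card_roots[of P UNIV])
      show "degree P < CARD('f)" using dP qs card_F by simp
      show "poly P x = 0" for x using fixed[of x] by (simp add: P_def poly_monom funpow_frob)
    qed
    then have "coeff P (CARD('k) ^ s) = 0" by simp
    then show False using \<open>1 < CARD('k) ^ s\<close> by (auto simp: P_def coeff_pCons split: nat.splits)
  qed
  then show ?thesis by (intro inj_onI) (metis lessThan_iff linorder_neqE_nat)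
qed

text \<open>Both sides are monic of degree d and vanish at the d distinct conjugates, since \<pp> at
  \<theta>_m is sigma^m(\<gamma>(\<pp>)) = 0. Their difference has too many roots for its
  degree.\<close>

lemma scalar_ext_pp: "scalar_ext \<gamma> \<pp> = (\<Prod>m<d. [:- conj_root m, 1:])"
proof -
  define P where "P = scalar_ext \<gamma> \<pp> - (\<Prod>m<d. [:- conj_root m, 1:])"
  have deg1: "degree (scalar_ext \<gamma> \<pp>) = d" "lead_coeff (scalar_ext \<gamma> \<pp>) = 1"
    using monic by (simp_all add: scalar_ext_def)
  have deg2: "degree (\<Prod>m<d. [:- conj_root m, 1:]) = d" "lead_coeff (\<Prod>m<d. [:- conj_root m, 1:]) = 1"
    by (simp add: degree_prod_eq_sum_degree, subst lead_coeff_prod, simp)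
  have "coeff P i = 0" if "i \<ge> d" for i
    using that deg1 deg2 by (cases "i = d") (auto simp: P_def coeff_eq_0)
  then have dP: "degree P < d" using d_pos by (metis degree_0 leading_coeff_0_iff not_less)
  have "P = 0"
  proof (rule poly_eq_0_if_card_roots[of P "conj_root ` {..<d}"])
    show "degree P < card (conj_root ` {..<d})" using dP by (simp add: card_image[OF inj_conj_root])
    fix x assume "x \<in> conj_root ` {..<d}"
    then obtain m where m: "m < d" "x = conj_root m" by auto
    have "poly (scalar_ext \<gamma> \<pp>) x = (frob CARD('k) ^^ m) (\<gamma> \<pp>)"
      unfolding m(2) conj_root_def gamma_eq_poly[of \<pp>] by (rule frob_pow_poly[symmetric])
    also have "\<dots> = 0" using gamma_eq_0_iff[of \<pp>] by (induction m) auto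
    finally show "poly P x = 0" using m by (auto simp: P_def poly_prod)
  qed
  then show ?thesis by (simp add: P_def)
qed

end


section \<open>The coefficient rings\<close>

lemma subring_set_localized_at:
  assumes "s \<noteq> 0"
  shows "subring_set (localized_at s)"
  unfolding subring_set_def
proof (intro conjI ballI)
  have s: "to_fract s \<noteq> 0" using assms by simp
  have "0 = to_fract 0 / to_fract s ^ 0" "1 = to_fract 1 / to_fract s ^ 0" by simp_all
  then show "0 \<in> localized_at s" "1 \<in> localized_at s" unfolding localized_at_def by blast+
  fix x assume "x \<in> localized_at s"
  then obtain a n where x: "x = to_fract a / to_fract s ^ n" by (auto simp: localized_at_def)
  have "- x = to_fract (- a) / to_fract s ^ n" by (simp add: x)
  then show "- x \<in> localized_at s" unfolding localized_at_def by blast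
  fix y assume "y \<in> localized_at s"
  then obtain b m where y: "y = to_fract b / to_fract s ^ m" by (auto simp: localized_at_def)
  have pw: "to_fract (s ^ k) = to_fract s ^ k" for k by (induction k) auto
  have "x + y = to_fract (a * s ^ m + b * s ^ n) / to_fract s ^ (n + m)"
    using s by (simp add: x y pw power_add add_frac_eq)
  then show "x + y \<in> localized_at s" unfolding localized_at_def by blast
  have "x * y = to_fract (a * b) / to_fract s ^ (n + m)"
    by (simp add: x y power_add)
  then show "x * y \<in> localized_at s" unfolding localized_at_def by blast
qed

lemma to_fract_localized_at: "to_fract a \<in> localized_at s"
  unfolding localized_at_def by (intro CollectI exI[of _ a] exI[of _ 0]) simp

lemma subring_set_coeffs:
  assumes "subring_set R"
  shows "subring_set {P. \<forall>i. coeff P i \<in> R}"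
  unfolding subring_set_def
  using subring_setD[OF assms]
  by (auto intro!: subring_set_sum[OF assms] simp: coeff_mult one_pCons coeff_pCons split: nat.splits)

lemma comm_ring_hom_funpow:
  fixes h :: "'a::comm_ring_1 \<Rightarrow> 'a"
  assumes "comm_ring_hom h"
  shows "comm_ring_hom (h ^^ m)"
proof (induction m)
  case 0
  show ?case by unfold_locales auto
next
  case (Suc m)
  interpret h: comm_ring_hom h by fact
  interpret hm: comm_ring_hom "h ^^ m" by fact
  show ?case
    by unfold_locales (simp_all add: hm.hom_add hm.hom_mult h.hom_add h.hom_mult)
qed

text \<open>The value is read off from an arbitrarily chosen fraction;
  \<open>frob_fract_divide\<close> shows independence of that choice from the multiplicativity of
  the Frobenius on polynomials and its injectivity, which keeps denominators nonzero.\<close>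

definition frob_fract :: "nat \<Rightarrow> 'f::field poly fract \<Rightarrow> 'f poly fract" where
  "frob_fract m x = (SOME y. \<exists>a b. b \<noteq> 0 \<and> x = to_fract a / to_fract b \<and>
     y = to_fract (frob_poly m a) / to_fract (frob_poly m b))"

definition frob_fract_poly :: "nat \<Rightarrow> 'f::field poly fract poly \<Rightarrow> 'f poly fract poly" where
  "frob_fract_poly m = map_poly (frob_fract m)"

context drinfeld_setting
begin

sublocale frob_poly: inj_idom_hom "frob_poly CARD('k) :: 'f poly \<Rightarrow> 'f poly"
proof -
  interpret map_poly_inj_idom_hom "frob CARD('k) :: 'f \<Rightarrow> 'f" ..
  show "inj_idom_hom (frob_poly CARD('k) :: 'f poly \<Rightarrow> 'f poly)"
    unfolding frob_poly_def by (rule inj_idom_hom_axioms)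
qed

lemma frob_fract_divide:
  assumes b: "b \<noteq> 0"
  shows "frob_fract CARD('k) (to_fract a / to_fract b :: 'f poly fract) =
    to_fract (frob_poly CARD('k) a) / to_fract (frob_poly CARD('k) b)"
proof -
  define x where "x = to_fract a / to_fract b"
  have "to_fract (frob_poly CARD('k) n) / to_fract (frob_poly CARD('k) m) =
      to_fract (frob_poly CARD('k) a) / to_fract (frob_poly CARD('k) b)"
    if m: "m \<noteq> 0" and "x = to_fract n / to_fract m" for n m
  proof -
    have "to_fract (a * m) = to_fract (n * b)"
      using b that unfolding x_def by (simp add: frac_eq_eq)
    then have "a * m = n * b" by (simp only: to_fract_eq_iff)
    then have "frob_poly CARD('k) a * frob_poly CARD('k) m = frob_poly CARD('k) n * frob_poly CARD('k) b"
      by (simp only: frob_poly.hom_mult[symmetric])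
    then have "to_fract (frob_poly CARD('k) a) * to_fract (frob_poly CARD('k) m) =
        to_fract (frob_poly CARD('k) n) * to_fract (frob_poly CARD('k) b)"
      by (simp only: to_fract_mult[symmetric])
    then show ?thesis using b m by (simp add: frac_eq_eq)
  qed
  then show ?thesis
    unfolding frob_fract_def x_def[symmetric] by (intro some_equality) (use b x_def in blast)+
qed

lemma frob_fract_to_fract:
  "frob_fract CARD('k) (to_fract a :: 'f poly fract) = to_fract (frob_poly CARD('k) a)"
  using frob_fract_divide[of 1 a] by simp

lemma fract_cases: "\<exists>a b. b \<noteq> 0 \<and> x = to_fract a / (to_fract b :: 'f poly fract)"
  by (metis Fract_cases Fract_conv_to_fract)

sublocale frob_fract: field_hom "frob_fract CARD('k) :: 'f poly fract \<Rightarrow> 'f poly fract"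
proof unfold_locales
  let ?s = "frob_poly CARD('k) :: 'f poly \<Rightarrow> 'f poly" and ?S = "frob_fract CARD('k) :: 'f poly fract \<Rightarrow> _"
  show "?S 0 = 0" "?S 1 = 1"
    using frob_fract_to_fract[of 0] frob_fract_to_fract[of 1] by simp_all
  fix x y :: "'f poly fract"
  obtain a b where b: "b \<noteq> 0" and x: "x = to_fract a / to_fract b" using fract_cases by blast
  obtain c e where e: "e \<noteq> 0" and y: "y = to_fract c / to_fract e" using fract_cases by blast
  have Sx: "?S x = to_fract (?s a) / to_fract (?s b)" and Sy: "?S y = to_fract (?s c) / to_fract (?s e)"
    unfolding x y by (rule frob_fract_divide[OF b], rule frob_fract_divide[OF e])
  have be: "b * e \<noteq> 0" using b e by simp
  have "x + y = to_fract (a * e + c * b) / to_fract (b * e)" using b e by (simp add: x y add_frac_eq)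
  then have "?S (x + y) = to_fract (?s (a * e + c * b)) / to_fract (?s (b * e))"
    by (simp only: frob_fract_divide[OF be])
  also have "\<dots> = ?S x + ?S y"
    using b e by (simp add: Sx Sy frob_poly.hom_add frob_poly.hom_mult add_frac_eq)
  finally show "?S (x + y) = ?S x + ?S y" .
  have "x * y = to_fract (a * c) / to_fract (b * e)" by (simp add: x y)
  then have "?S (x * y) = to_fract (?s (a * c)) / to_fract (?s (b * e))"
    by (simp only: frob_fract_divide[OF be])
  then show "?S (x * y) = ?S x * ?S y" by (simp add: Sx Sy frob_poly.hom_mult)
qed

sublocale frob_fract_poly: inj_idom_hom "frob_fract_poly CARD('k) :: 'f poly fract poly \<Rightarrow> 'f poly fract poly"
proof -
  interpret map_poly_inj_idom_hom "frob_fract CARD('k) :: 'f poly fract \<Rightarrow> 'f poly fract" ..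
  show "inj_idom_hom (frob_fract_poly CARD('k) :: 'f poly fract poly \<Rightarrow> 'f poly fract poly)"
    unfolding frob_fract_poly_def by (rule inj_idom_hom_axioms)
qed

lemma coeff_frob_fract_poly [simp]:
  "coeff (frob_fract_poly CARD('k) P) i = frob_fract CARD('k) (coeff P i :: 'f poly fract)"
  by (simp add: frob_fract_poly_def)

lemma frob_fract_poly_const [simp]:
  "frob_fract_poly CARD('k) [:u :: 'f poly fract:] = [:frob_fract CARD('k) u:]"
  by (rule poly_eqI) (simp add: coeff_pCons split: nat.splits)

text \<open>Since t and T are fixed, the triviality of sigma^d on F spreads to F(t)[T]. This is what
  makes the d-th iterate of a Frobenius-semilinear map linear.\<close>

lemma frob_fract_poly_pow_d: "(frob_fract_poly CARD('k) ^^ d) P = (P :: 'f poly fract poly)"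
proof (rule poly_eqI)
  have 1: "coeff ((frob_poly CARD('k) ^^ m) a) i = (frob CARD('k) ^^ m) (coeff a i :: 'f)" for m a i
    by (induction m) (simp_all add: frob_poly_def)
  then have "(frob_poly CARD('k) ^^ d) a = (a :: 'f poly)" for a
    by (simp add: poly_eq_iff frob_pow_d)
  moreover have "(frob_fract CARD('k) ^^ m) (to_fract a / to_fract b :: 'f poly fract) =
      to_fract ((frob_poly CARD('k) ^^ m) a) / to_fract ((frob_poly CARD('k) ^^ m) b)" for m a b
    by (induction m) (simp_all add: frob_fract.hom_div frob_fract_to_fract)
  ultimately have "(frob_fract CARD('k) ^^ d) x = (x :: 'f poly fract)" for x
    using fract_cases[of x] by auto
  moreover have "coeff ((frob_fract_poly CARD('k) ^^ m) P) i =
      (frob_fract CARD('k) ^^ m) (coeff P i)" for m i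
    by (induction m) simp_all
  ultimately show "coeff ((frob_fract_poly CARD('k) ^^ d) P) i = coeff P i" for i by simp
qed

lemma comm_ring_hom_frob_fract_poly_pow:
  "comm_ring_hom (frob_fract_poly CARD('k) ^^ m :: 'f poly fract poly \<Rightarrow> 'f poly fract poly)"
  by (rule comm_ring_hom_funpow) (rule frob_fract_poly.comm_ring_hom_axioms)

section \<open>Inclusions between the coefficient rings and the action of Frobenius on them\<close>

abbreviation "R\<theta> \<equiv> ring_theta \<gamma>"
abbreviation "ApTF \<equiv> ring_ApTF \<gamma> \<pp>"
abbreviation "ApT \<equiv> ring_ApT \<gamma> \<pp>"

lemma scalar_ext_pp_nonzero: "scalar_ext \<gamma> \<pp> \<noteq> 0"
  using pp_nonzero by (simp add: scalar_ext_def poly_eq_iff)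

lemma subring_R\<theta>: "subring_set R\<theta>"
  unfolding ring_theta_def by (rule subring_set_localized_at) (simp flip: one_pCons)

lemma subring_ApTF: "subring_set ApTF"
  unfolding ring_ApTF_def
  by (rule subring_set_coeffs[OF subring_set_localized_at[OF scalar_ext_pp_nonzero]])

lemma hom_on_to_fract: "hom_on UNIV R\<theta> to_fract"
  by (simp add: hom_on_def ring_theta_def to_fract_localized_at)

lemma const_ApTF: "u \<in> localized_at (scalar_ext \<gamma> \<pp>) \<Longrightarrow> [:u:] \<in> ApTF"
  using subring_setD(1)[OF subring_set_localized_at[OF scalar_ext_pp_nonzero]]
  by (auto simp: ring_ApTF_def coeff_pCons split: nat.splits)

lemma hom_on_to_ApTF: "hom_on UNIV ApTF to_ApTF"
  by (auto simp: hom_on_def pCons_one const_ApTF to_fract_localized_at)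

lemma hom_on_frob_poly: "hom_on UNIV UNIV (frob_poly CARD('k) :: 'f poly \<Rightarrow> 'f poly)"
  by (auto simp: hom_on_def frob_poly.hom_add frob_poly.hom_mult)

text \<open>The root \<theta> gives \<pp> = (t - \<theta>) c, so a / (t - \<theta>)^n = a c^n /
  \<pp>^n.\<close>

lemma ring_theta_subset: "R\<theta> \<subseteq> localized_at (scalar_ext \<gamma> \<pp>)"
proof
  fix u assume "u \<in> R\<theta>"
  then obtain a n where u: "u = to_fract a / to_fract [:- \<theta>, 1:] ^ n"
    by (auto simp: ring_theta_def localized_at_def \<theta>_def)
  have "poly (scalar_ext \<gamma> \<pp>) \<theta> = 0" using gamma_eq_0_iff[of \<pp>] by (simp add: gamma_eq_poly)
  then obtain c where c: "scalar_ext \<gamma> \<pp> = [:- \<theta>, 1:] * c" by (metis poly_eq_0_iff_dvd dvdE)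
  then have "c \<noteq> 0" using scalar_ext_pp_nonzero by auto
  have pw: "to_fract (c ^ k) = to_fract c ^ k" for k by (induction k) auto
  have "u = to_fract (a * c ^ n) / to_fract (scalar_ext \<gamma> \<pp>) ^ n"
    using \<open>c \<noteq> 0\<close> unfolding u c to_fract_mult power_mult_distrib pw by simp
  then show "u \<in> localized_at (scalar_ext \<gamma> \<pp>)" unfolding localized_at_def by blast
qed

lemma hom_on_const: "hom_on R\<theta> ApTF (\<lambda>u. [:u:])"
  using ring_theta_subset by (auto simp: hom_on_def pCons_one intro: const_ApTF)

lemma frob_poly_scalar_ext [simp]: "frob_poly CARD('k) (scalar_ext \<gamma> a) = scalar_ext \<gamma> a"
  by (simp add: poly_eq_iff scalar_ext_def frob_poly_def)

text \<open>The coefficients of \<pp> lie in the small field, so Frobenius does not change the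
  admissible denominators.\<close>

lemma hom_on_frob_fract_poly: "hom_on ApTF ApTF (frob_fract_poly CARD('k))"
proof -
  have "frob_fract CARD('k) u \<in> localized_at (scalar_ext \<gamma> \<pp>)"
      if "u \<in> localized_at (scalar_ext \<gamma> \<pp>)" for u
  proof -
    obtain a n where "u = to_fract a / to_fract (scalar_ext \<gamma> \<pp>) ^ n"
      using \<open>u \<in> _\<close> by (auto simp: localized_at_def)
    then have "frob_fract CARD('k) u = to_fract (frob_poly CARD('k) a) / to_fract (scalar_ext \<gamma> \<pp>) ^ n"
      by (simp add: frob_fract.hom_div frob_fract.hom_power frob_fract_to_fract)
    then show ?thesis unfolding localized_at_def by blast
  qed
  then show ?thesis
    by (auto simp: hom_on_def ring_ApTF_def frob_fract_poly.hom_add frob_fract_poly.hom_mult)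
qed

lemma ApT_subset: "ApT \<subseteq> ApTF"
  unfolding ring_ApT_def ring_ApTF_def localized_at_def by blast

lemma frob_fract_poly_ApT: "s \<in> ApT \<Longrightarrow> frob_fract_poly CARD('k) s = s"
proof (rule poly_eqI)
  fix i assume "s \<in> ApT"
  then obtain a n where "coeff s i = to_fract (scalar_ext \<gamma> a) / to_fract (scalar_ext \<gamma> \<pp>) ^ n"
    unfolding ring_ApT_def by blast
  then show "coeff (frob_fract_poly CARD('k) s) i = coeff s i"
    by (simp add: frob_fract.hom_div frob_fract.hom_power frob_fract_to_fract)
qed

text \<open>The large ring is additively generated by products of \<open>ApT\<close> and A_F: a term
  (a / \<pp>^n) T^i splits into T^i / \<pp>^n and a. This gives access to maps that are linear only
  over \<open>ApT\<close>.\<close>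

lemma ApTF_induct:
  assumes P: "P \<in> ApTF"
    and zero: "Q 0" and add: "\<And>x y. Q x \<Longrightarrow> Q y \<Longrightarrow> Q (x + y)"
    and mult: "\<And>a s. s \<in> ApT \<Longrightarrow> Q (s * to_ApTF a)"
  shows "Q P"
proof -
  have "Q (monom (coeff P i) i)" for i
  proof -
    obtain a n where a: "coeff P i = to_fract a / to_fract (scalar_ext \<gamma> \<pp>) ^ n"
      using P unfolding ring_ApTF_def localized_at_def by blast
    define s where "s = monom (1 / to_fract (scalar_ext \<gamma> \<pp>) ^ n) i"
    have "coeff s j = to_fract (scalar_ext \<gamma> (if j = i then 1 else 0)) / to_fract (scalar_ext \<gamma> \<pp>) ^ n" for j
      by (auto simp: s_def scalar_ext_def)
    then have "s \<in> ApT" unfolding ring_ApT_def by blast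
    moreover have "monom (coeff P i) i = s * to_ApTF a"
      by (simp add: s_def a monom_altdef[symmetric] smult_monom mult.commute)
    ultimately show ?thesis using mult by simp
  qed
  then have "Q (\<Sum>i\<in>I. monom (coeff P i) i)" for I
    by (induction I rule: infinite_finite_induct) (auto simp: zero add)
  then show ?thesis by (metis poly_as_sum_of_monoms)
qed

end


section \<open>Matrices with entries in a subring\<close>

lemma mats_carrier: "A \<in> mats S m n \<Longrightarrow> A \<in> carrier_mat m n"
  by (simp add: mats_def)

lemma mats_one: "subring_set S \<Longrightarrow> 1\<^sub>m n \<in> mats S n n"
  by (auto simp: mats_def one_mat_def subring_setD)

lemma mats_mult:
  assumes "subring_set S" "A \<in> mats S m n" "B \<in> mats S n k"
  shows "A * B \<in> mats S m k"
  using assms by (auto simp: mats_def scalar_prod_def intro!: subring_set_sum subring_setD(4))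

lemma mats_minus:
  assumes "subring_set S" "A \<in> mats S m n" "B \<in> mats S m n"
  shows "A - B \<in> mats S m n"
  using assms by (auto simp: mats_def intro!: subring_setD(6))

lemma mats_smult:
  assumes "subring_set S" "s \<in> S" "A \<in> mats S m n"
  shows "s \<cdot>\<^sub>m A \<in> mats S m n"
  using assms by (auto simp: mats_def intro!: subring_setD(4))

lemma mats_map:
  assumes "\<And>x. x \<in> S \<Longrightarrow> h x \<in> T" "A \<in> mats S m n"
  shows "map_mat h A \<in> mats T m n"
  using assms by (auto simp: mats_def)

lemma map_vec_mult_mat_vec:
  assumes h: "hom_on S T h" and S: "subring_set S" and A: "A \<in> mats S m n" and v: "v \<in> vecs S n"
  shows "map_vec h (A *\<^sub>v v) = map_mat h A *\<^sub>v map_vec h v"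
proof (rule eq_vecI)
  fix i assume "i < dim_vec (map_mat h A *\<^sub>v map_vec h v)"
  then have i: "i < m" using A by (auto simp: mats_def)
  have Ac: "A \<in> carrier_mat m n" and vc: "v \<in> carrier_vec n" using A v by (auto simp: mats_def vecs_def)
  have "map_vec h (A *\<^sub>v v) $ i = h (\<Sum>j<n. A $$ (i, j) * v $ j)"
    using i Ac mult_mat_vec_index_sum[OF Ac vc i] by simp
  also have "\<dots> = (\<Sum>j<n. h (A $$ (i, j) * v $ j))"
    using A v i by (intro hom_on_sum[OF h S]) (auto simp: mats_def vecs_def subring_setD(4)[OF S])
  also have "\<dots> = (\<Sum>j<n. map_mat h A $$ (i, j) * map_vec h v $ j)"
    using A v i by (intro sum.cong) (auto simp: mats_def vecs_def hom_onD(5)[OF h])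
  also have "\<dots> = (map_mat h A *\<^sub>v map_vec h v) $ i"
    by (rule mult_mat_vec_index_sum[symmetric]) (use Ac vc i in auto)
  finally show "map_vec h (A *\<^sub>v v) $ i = (map_mat h A *\<^sub>v map_vec h v) $ i" .
qed (use A in \<open>auto simp: mats_def\<close>)

lemma smult_mat_mult_vec:
  assumes "A \<in> carrier_mat m n" "v \<in> carrier_vec n"
  shows "(k \<cdot>\<^sub>m A) *\<^sub>v v = k \<cdot>\<^sub>v (A *\<^sub>v (v :: 'a::comm_ring_1 vec))"
  by (rule eq_vecI) (use assms in \<open>auto simp: scalar_prod_def sum_distrib_left mult.assoc\<close>)

lemma seq_prod_mats:
  assumes "subring_set S" "\<And>m. \<Psi> m \<in> mats S r r"
  shows "seq_prod r \<Psi> m \<in> mats S r r"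
  by (induction m) (auto intro: mats_one mats_mult assms)

lemma vec_eq_if_scalar_prod_eq:
  fixes v w :: "'a::comm_ring_1 vec"
  assumes S: "subring_set S" and v: "v \<in> carrier_vec n" "w \<in> carrier_vec n"
    and eq: "\<And>u. u \<in> vecs S n \<Longrightarrow> v \<bullet> u = w \<bullet> u"
  shows "v = w"
proof (rule eq_vecI)
  fix i assume "i < dim_vec w"
  then have i: "i < n" using v by simp
  have "unit_vec n i \<in> vecs S n" using subring_setD[OF S] by (auto simp: vecs_def unit_vec_def)
  from eq[OF this] show "v $ i = w $ i"
    using v scalar_prod_right_unit[OF i, of v] scalar_prod_right_unit[OF i, of w] by simp
qed (use v in simp)


section \<open>Anderson motives in coordinates\<close>

abbreviation "frob_coord m n \<kappa> \<equiv> base_change_coordinates.tensor_coord n \<kappa> (frob_poly m)"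
abbreviation "loc_coord n \<kappa> \<equiv> base_change_coordinates.tensor_coord n \<kappa> to_fract"
abbreviation "euler_coord n \<kappa> \<equiv> base_change_coordinates.tensor_coord n \<kappa> to_ApTF"

lemma base_change_coordinates:
  assumes "coordinates UNIV M n \<kappa>" "subring_set S" "hom_on UNIV S h"
  shows "coordinates S (base_change h S M) n (base_change_coordinates.tensor_coord n \<kappa> h)"
    and "x \<in> carrier M \<Longrightarrow> pure_tensor h S M 1 x \<in> carrier (base_change h S M)"
    and "x \<in> carrier M \<Longrightarrow>
      base_change_coordinates.tensor_coord n \<kappa> h (pure_tensor h S M 1 x) = map_vec h (\<kappa> x)"
proof -
  interpret base_change_coordinates M n \<kappa> S h
    using assms by (intro base_change_coordinates.intro base_change_coordinates_axioms.intro)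
  show "coordinates S (base_change h S M) n tensor_coord" by (rule coordinates_base_change)
  show "x \<in> carrier M \<Longrightarrow> pure_tensor h S M 1 x \<in> carrier (base_change h S M)"
    and "x \<in> carrier M \<Longrightarrow> tensor_coord (pure_tensor h S M 1 x) = map_vec h (\<kappa> x)"
    by (fact tensor_coord_pure_tensor_1)+
qed

lemma semilinear_maps_eqI_pure_tensor:
  assumes M: "coordinates UNIV M n \<kappa>" and S: "subring_set S" and h: "hom_on UNIV S h"
    and N: "coordinates T N m \<mu>" and g: "hom_on S T g"
    and f: "f \<in> semilinear_maps S g (base_change h S M) N"
        "f' \<in> semilinear_maps S g (base_change h S M) N"
    and eq: "\<And>x. x \<in> carrier M \<Longrightarrow> f (pure_tensor h S M 1 x) = f' (pure_tensor h S M 1 x)"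
  shows "f = f'"
proof (rule coordinates_semilinear_maps_eqI[OF base_change_coordinates(1)[OF M S h] N g f])
  interpret M: coordinates UNIV M n \<kappa> by (rule M)
  fix j assume "j < n"
  show "\<exists>x\<in>carrier (base_change h S M). base_change_coordinates.tensor_coord n \<kappa> h x =
      unit_vec n j \<and> f x = f' x"
    using base_change_coordinates(2,3)[OF M S h M.basis_elem_closed[of j]]
        eq[OF M.basis_elem_closed[of j]]
    by (auto simp: map_vec_unit_vec[OF h])
qed

definition has_matrix ::
  "('m \<Rightarrow> 'n) \<Rightarrow> 'm set \<Rightarrow> ('m \<Rightarrow> 's::comm_ring_1 vec) \<Rightarrow> 'n set \<Rightarrow> ('n \<Rightarrow> 's vec) \<Rightarrow> 's mat \<Rightarrow> bool" where
  "has_matrix f A \<kappa> B \<mu> C \<longleftrightarrow> (\<forall>x\<in>A. f x \<in> B \<and> \<mu> (f x) = C *\<^sub>v \<kappa> x)"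

context drinfeld_setting
begin

lemmas pull_coordinates = base_change_coordinates[OF _ subring_set_UNIV hom_on_frob_poly]
lemmas loc_coordinates = base_change_coordinates[OF _ subring_R\<theta> hom_on_to_fract]
lemmas euler_coordinates = base_change_coordinates[OF _ subring_ApTF hom_on_to_ApTF]

text \<open>In coordinates the defining condition is (G f) . (\<Phi> w) = f . w for all w, so G is
  the inverse of the transpose of \<Phi>. This is the relation between \<Psi> and \<Phi> assumed in
  \<open>inv\<close>.\<close>

lemma dual_motive_map_has_matrix:
  assumes M: "coordinates UNIV M n \<kappa>"
    and \<tau>M: "has_matrix \<tau>M (carrier (loc_theta \<gamma> (frob_pullback CARD('k) M))) (loc_coord n (frob_coord CARD('k) n \<kappa>))
      (carrier (loc_theta \<gamma> M)) (loc_coord n \<kappa>) \<Phi>"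
    and \<Phi>: "\<Phi> \<in> mats R\<theta> n n" and \<Psi>: "\<Psi> \<in> mats R\<theta> n n"
    and inv: "transpose_mat \<Psi> * \<Phi> = 1\<^sub>m n" "\<Phi> * transpose_mat \<Psi> = 1\<^sub>m n"
  defines "D \<equiv> dual_module UNIV M" and "\<delta> \<equiv> coordinates.dual_coord M n \<kappa>"
  shows "has_matrix (dual_motive_map \<gamma> M \<tau>M)
    (carrier (loc_theta \<gamma> (frob_pullback CARD('k) D))) (loc_coord n (frob_coord CARD('k) n \<delta>))
    (carrier (loc_theta \<gamma> D)) (loc_coord n \<delta>) \<Psi>"
proof -
  interpret M: coordinates UNIV M n \<kappa> by (rule M)
  have D: "coordinates UNIV D n \<delta>"
    unfolding D_def \<delta>_def by (rule M.coordinates_dual_module)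
  let ?M' = "frob_pullback CARD('k) M" and ?D' = "frob_pullback CARD('k) D"
  let ?\<kappa>' = "frob_coord CARD('k) n \<kappa>" and ?\<delta>' = "frob_coord CARD('k) n \<delta>"
  have M': "coordinates UNIV ?M' n ?\<kappa>'" by (rule pull_coordinates(1)[OF M])
  have D': "coordinates UNIV ?D' n ?\<delta>'" by (rule pull_coordinates(1)[OF D])
  interpret LM: coordinates R\<theta> "loc_theta \<gamma> M" n "loc_coord n \<kappa>" by (rule loc_coordinates(1)[OF M])
  interpret LM': coordinates R\<theta> "loc_theta \<gamma> ?M'" n "loc_coord n ?\<kappa>'" by (rule loc_coordinates(1)[OF M'])
  interpret LD: coordinates R\<theta> "loc_theta \<gamma> D" n "loc_coord n \<delta>" by (rule loc_coordinates(1)[OF D])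
  interpret LD': coordinates R\<theta> "loc_theta \<gamma> ?D'" n "loc_coord n ?\<delta>'" by (rule loc_coordinates(1)[OF D'])
  interpret P: coordinates_pair R\<theta> "loc_theta \<gamma> ?D'" n "loc_coord n ?\<delta>'" R\<theta> "loc_theta \<gamma> D" n
      "loc_coord n \<delta>" "\<lambda>s. s"
    by (intro coordinates_pair.intro coordinates_pair_axioms.intro LD.coordinates_axioms
        LD'.coordinates_axioms hom_on_ident)
  have E: "f x = \<delta> f \<bullet> \<kappa> x" if "f \<in> carrier D" "x \<in> carrier M" for f x
    using M.dual_module_apply that by (simp add: D_def \<delta>_def)
  define E' where "E' = pairing_base_change (frob_poly CARD('k)) UNIV D M (\<lambda>f x. f x)"
  have E': "E' f x = ?\<delta>' f \<bullet> ?\<kappa>' x" if "f \<in> carrier ?D'" "x \<in> carrier ?M'" for f x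
    unfolding E'_def
    by (rule pairing_base_change_eq[OF D M subring_set_UNIV hom_on_frob_poly E that])
  have pair1: "pairing_base_change to_fract R\<theta> D M (\<lambda>f x. f x) f x = loc_coord n \<delta> f \<bullet> loc_coord n \<kappa> x"
    if "f \<in> carrier (loc_theta \<gamma> D)" "x \<in> carrier (loc_theta \<gamma> M)" for f x
    by (rule pairing_base_change_eq[OF D M subring_R\<theta> hom_on_to_fract E that])
  have pair2: "pairing_base_change to_fract R\<theta> ?D' ?M' E' f x = loc_coord n ?\<delta>' f \<bullet> loc_coord n ?\<kappa>' x"
    if "f \<in> carrier (loc_theta \<gamma> ?D')" "x \<in> carrier (loc_theta \<gamma> ?M')" for f x
    by (rule pairing_base_change_eq[OF D' M' subring_R\<theta> hom_on_to_fract E' that])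
  have \<tau>c: "\<tau>M x \<in> carrier (loc_theta \<gamma> M)" "loc_coord n \<kappa> (\<tau>M x) = \<Phi> *\<^sub>v loc_coord n ?\<kappa>' x"
    if "x \<in> carrier (loc_theta \<gamma> ?M')" for x
    using \<tau>M that by (auto simp: has_matrix_def)
  have \<Phi>c: "\<Phi> \<in> carrier_mat n n" and \<Psi>c: "\<Psi> \<in> carrier_mat n n" using \<Phi> \<Psi> by (auto simp: mats_def)
  have adj: "(\<Psi> *\<^sub>v v) \<bullet> w = v \<bullet> (transpose_mat \<Psi> *\<^sub>v w)"
    if "v \<in> carrier_vec n" "w \<in> carrier_vec n" for v w :: "'f poly fract vec"
  proof -
    have T: "transpose_mat \<Psi> *\<^sub>v w \<in> carrier_vec n" and Pv: "\<Psi> *\<^sub>v v \<in> carrier_vec n"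
      using \<Psi>c that by auto
    have "(\<Psi> *\<^sub>v v) \<bullet> w = w \<bullet> (\<Psi> *\<^sub>v v)" by (rule comm_scalar_prod[OF Pv that(2)])
    also have "\<dots> = (transpose_mat \<Psi> *\<^sub>v w) \<bullet> v"
      by (rule transpose_vec_mult_scalar[OF \<Psi>c that, symmetric])
    also have "\<dots> = v \<bullet> (transpose_mat \<Psi> *\<^sub>v w)" by (rule comm_scalar_prod[OF T that(1)])
    finally show ?thesis .
  qed
  define g where "g = P.matrix_map \<Psi>"
  have glin: "g \<in> linear_maps R\<theta> (loc_theta \<gamma> ?D') (loc_theta \<gamma> D)"
    unfolding g_def by (rule P.matrix_map_semilinear[OF \<Psi>])
  have gc: "loc_coord n \<delta> (g f) = \<Psi> *\<^sub>v loc_coord n ?\<delta>' f" if "f \<in> carrier (loc_theta \<gamma> ?D')" for f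
    unfolding g_def using P.coord_matrix_map[OF \<Psi> that] by (simp add: map_vec_ident)
  \<comment> \<open>For each f separately the condition pins down the coordinates of the value at f.
    Existence and uniqueness both follow from this equivalence, because the coordinates of x run
    through all vectors.\<close>
  have char: "(\<forall>x\<in>carrier (loc_theta \<gamma> ?M').
      pairing_base_change to_fract R\<theta> D M (\<lambda>f x. f x) a (\<tau>M x) =
      pairing_base_change to_fract R\<theta> ?D' ?M' E' f x) \<longleftrightarrow> loc_coord n \<delta> a = \<Psi> *\<^sub>v loc_coord n ?\<delta>' f"
    if f: "f \<in> carrier (loc_theta \<gamma> ?D')" and a: "a \<in> carrier (loc_theta \<gamma> D)" for f a
  proof -
    let ?a = "loc_coord n \<delta> a" and ?f = "loc_coord n ?\<delta>' f"
    have fc: "?f \<in> carrier_vec n" and ac: "?a \<in> carrier_vec n"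
      using LD'.coord_carrier[OF f] LD.coord_carrier[OF a] .
    have "(\<forall>x\<in>carrier (loc_theta \<gamma> ?M').
        pairing_base_change to_fract R\<theta> D M (\<lambda>f x. f x) a (\<tau>M x) =
        pairing_base_change to_fract R\<theta> ?D' ?M' E' f x) \<longleftrightarrow>
      (\<forall>x\<in>carrier (loc_theta \<gamma> ?M'). ?a \<bullet> (\<Phi> *\<^sub>v loc_coord n ?\<kappa>' x) = ?f \<bullet> loc_coord n ?\<kappa>' x)"
      using pair1[OF a] pair2[OF f] \<tau>c by simp
    also have "\<dots> \<longleftrightarrow> (\<forall>w\<in>vecs R\<theta> n. ?a \<bullet> (\<Phi> *\<^sub>v w) = ?f \<bullet> w)"
      using LM'.coord_vecs LM'.of_coord_closed LM'.coord_of_coord by metis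
    also have "\<dots> \<longleftrightarrow> ?a = \<Psi> *\<^sub>v ?f"
    proof
      assume *: "\<forall>w\<in>vecs R\<theta> n. ?a \<bullet> (\<Phi> *\<^sub>v w) = ?f \<bullet> w"
      show "?a = \<Psi> *\<^sub>v ?f"
      proof (rule vec_eq_if_scalar_prod_eq[OF subring_R\<theta> ac])
        show "\<Psi> *\<^sub>v ?f \<in> carrier_vec n" using \<Psi>c fc by simp
        fix u assume u: "u \<in> vecs R\<theta> n"
        then have uc: "u \<in> carrier_vec n" by (simp add: vecs_def)
        have T: "transpose_mat \<Psi> \<in> mats R\<theta> n n" using \<Psi> by (auto simp: mats_def)
        have "u = \<Phi> *\<^sub>v (transpose_mat \<Psi> *\<^sub>v u)"
          using assoc_mult_mat_vec[OF \<Phi>c mats_carrier[OF T] uc] inv(2) uc by simp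
        then have "?a \<bullet> u = ?a \<bullet> (\<Phi> *\<^sub>v (transpose_mat \<Psi> *\<^sub>v u))" by simp
        also have "\<dots> = ?f \<bullet> (transpose_mat \<Psi> *\<^sub>v u)"
          using * mult_mat_vec_vecs[OF subring_R\<theta> T u] by blast
        also have "\<dots> = (\<Psi> *\<^sub>v ?f) \<bullet> u" using adj[OF fc uc] by simp
        finally show "?a \<bullet> u = (\<Psi> *\<^sub>v ?f) \<bullet> u" .
      qed
    next
      assume a: "?a = \<Psi> *\<^sub>v ?f"
      show "\<forall>w\<in>vecs R\<theta> n. ?a \<bullet> (\<Phi> *\<^sub>v w) = ?f \<bullet> w"
      proof
        fix w assume "w \<in> vecs R\<theta> n"
        then have wc: "w \<in> carrier_vec n" by (simp add: vecs_def)
        have "?a \<bullet> (\<Phi> *\<^sub>v w) = ?f \<bullet> (transpose_mat \<Psi> *\<^sub>v (\<Phi> *\<^sub>v w))"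
          unfolding a by (rule adj[OF fc]) (use \<Phi>c wc in simp)
        also have "transpose_mat \<Psi> *\<^sub>v (\<Phi> *\<^sub>v w) = w"
          using assoc_mult_mat_vec[of "transpose_mat \<Psi>" n n \<Phi> n w] \<Psi>c \<Phi>c wc inv(1) by simp
        finally show "?a \<bullet> (\<Phi> *\<^sub>v w) = ?f \<bullet> w" .
      qed
    qed
    finally show ?thesis .
  qed
  have "dual_motive_map \<gamma> M \<tau>M = g"
    unfolding dual_motive_map_def Let_def D_def[symmetric] E'_def[symmetric]
  proof (rule the_equality)
    show "g \<in> linear_maps R\<theta> (loc_theta \<gamma> ?D') (loc_theta \<gamma> D) \<and>
        (\<forall>f\<in>carrier (loc_theta \<gamma> ?D'). \<forall>x\<in>carrier (loc_theta \<gamma> ?M').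
          pairing_base_change to_fract R\<theta> D M (\<lambda>f x. f x) (g f) (\<tau>M x) =
          pairing_base_change to_fract R\<theta> ?D' ?M' E' f x)"
      using char[OF _ semilinear_mapsD(1)[OF glin]] gc glin by blast
  next
    fix g' assume g': "g' \<in> linear_maps R\<theta> (loc_theta \<gamma> ?D') (loc_theta \<gamma> D) \<and>
        (\<forall>f\<in>carrier (loc_theta \<gamma> ?D'). \<forall>x\<in>carrier (loc_theta \<gamma> ?M').
          pairing_base_change to_fract R\<theta> D M (\<lambda>f x. f x) (g' f) (\<tau>M x) =
          pairing_base_change to_fract R\<theta> ?D' ?M' E' f x)"
    then have g'lin: "g' \<in> linear_maps R\<theta> (loc_theta \<gamma> ?D') (loc_theta \<gamma> D)" by blast
    show "g' = g"
    proof
      fix f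
      show "g' f = g f"
      proof (cases "f \<in> carrier (loc_theta \<gamma> ?D')")
        case True
        have "loc_coord n \<delta> (g' f) = loc_coord n \<delta> (g f)"
          using char[OF True semilinear_mapsD(1)[OF g'lin True]] g' True gc by auto
        then show ?thesis
          by (intro LD.coord_inj semilinear_mapsD(1)[OF g'lin True] semilinear_mapsD(1)[OF glin True])
      next
        case False
        then show ?thesis using semilinear_mapsD(4)[OF g'lin] semilinear_mapsD(4)[OF glin] by simp
      qed
    qed
  qed
  then show ?thesis
    unfolding has_matrix_def using gc semilinear_mapsD(1)[OF glin] by auto
qed

text \<open>The natural map has the identity matrix and is semilinear along the inclusion of
  coefficient rings; pure tensors determine it.\<close>

lemma loc_to_euler_coord:
  assumes M: "coordinates UNIV M n \<kappa>" and x: "x \<in> carrier (loc_theta \<gamma> M)"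
  shows "loc_to_euler \<gamma> \<pp> M x \<in> carrier (euler_module \<gamma> \<pp> M)"
    and "euler_coord n \<kappa> (loc_to_euler \<gamma> \<pp> M x) = map_vec (\<lambda>u. [:u:]) (loc_coord n \<kappa> x)"
proof -
  interpret M: coordinates UNIV M n \<kappa> by (rule M)
  interpret L: coordinates R\<theta> "loc_theta \<gamma> M" n "loc_coord n \<kappa>" by (rule loc_coordinates(1)[OF M])
  interpret E: coordinates ApTF "euler_module \<gamma> \<pp> M" n "euler_coord n \<kappa>"
      by (rule euler_coordinates(1)[OF M])
  interpret P: coordinates_pair R\<theta> "loc_theta \<gamma> M" n "loc_coord n \<kappa>" ApTF "euler_module \<gamma> \<pp> M" n
    "euler_coord n \<kappa>" "\<lambda>u. [:u:]"
    by (intro coordinates_pair.intro coordinates_pair_axioms.intro L.coordinates_axioms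
        E.coordinates_axioms hom_on_const)
  define j where "j = P.matrix_map (1\<^sub>m n)"
  note one = mats_one[OF subring_ApTF, of n]
  have jlin: "j \<in> semilinear_maps R\<theta> (\<lambda>u. [:u:]) (loc_theta \<gamma> M) (euler_module \<gamma> \<pp> M)"
    unfolding j_def by (rule P.matrix_map_semilinear[OF one])
  have jc: "euler_coord n \<kappa> (j x) = map_vec (\<lambda>u. [:u:]) (loc_coord n \<kappa> x)"
      if "x \<in> carrier (loc_theta \<gamma> M)" for x
    unfolding j_def using P.coord_matrix_map[OF one that] L.coord_carrier[OF that] by simp
  have jpure: "j (loc_elem \<gamma> M m) = euler_elem \<gamma> \<pp> M m" if m: "m \<in> carrier M" for m
  proof (rule E.coord_inj)
    show "j (loc_elem \<gamma> M m) \<in> carrier (euler_module \<gamma> \<pp> M)"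
      by (rule semilinear_mapsD(1)[OF jlin loc_coordinates(2)[OF M m]])
    show "euler_elem \<gamma> \<pp> M m \<in> carrier (euler_module \<gamma> \<pp> M)" by (rule euler_coordinates(2)[OF M m])
    show "euler_coord n \<kappa> (j (loc_elem \<gamma> M m)) = euler_coord n \<kappa> (euler_elem \<gamma> \<pp> M m)"
      unfolding jc[OF loc_coordinates(2)[OF M m]] loc_coordinates(3)[OF M m] euler_coordinates(3)[OF M m]
      by (rule eq_vecI) simp_all
  qed
  have "loc_to_euler \<gamma> \<pp> M = j"
    unfolding loc_to_euler_def
  proof (rule the_equality)
    fix j' assume j': "j' \<in> semilinear_maps R\<theta> (\<lambda>u. [:u:]) (loc_theta \<gamma> M) (euler_module \<gamma> \<pp> M) \<and>
      (\<forall>m\<in>carrier M. j' (loc_elem \<gamma> M m) = euler_elem \<gamma> \<pp> M m)"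
    show "j' = j"
      by (rule semilinear_maps_eqI_pure_tensor[OF M subring_R\<theta> hom_on_to_fract E.coordinates_axioms
            hom_on_const _ jlin]) (use j' jpure in auto)
  qed (use jlin jpure in blast)
  then show "loc_to_euler \<gamma> \<pp> M x \<in> carrier (euler_module \<gamma> \<pp> M)"
    "euler_coord n \<kappa> (loc_to_euler \<gamma> \<pp> M x) = map_vec (\<lambda>u. [:u:]) (loc_coord n \<kappa> x)"
    using semilinear_mapsD(1)[OF jlin x] jc[OF x] by simp_all
qed

text \<open>The equalizer is closed under addition and under \<open>ApT\<close>, but not obviously
  under A_F. The hypothesis covers all elements 1 \<otimes> m instead of a basis, and (s a)
  \<otimes> m = s (1 \<otimes> a m) then reaches every scalar of the large ring.\<close>

lemma linear_maps_ApT_eqI: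
  assumes M: "coordinates UNIV M n \<kappa>"
    and f: "f \<in> linear_maps ApT (euler_module \<gamma> \<pp> M) (euler_module \<gamma> \<pp> M)"
    and g: "g \<in> linear_maps ApT (euler_module \<gamma> \<pp> M) (euler_module \<gamma> \<pp> M)"
    and eq: "\<And>m. m \<in> carrier M \<Longrightarrow> f (euler_elem \<gamma> \<pp> M m) = g (euler_elem \<gamma> \<pp> M m)"
  shows "f = g"
proof
  interpret M: coordinates UNIV M n \<kappa> by (rule M)
  let ?L = "euler_module \<gamma> \<pp> M"
  interpret E: coordinates ApTF ?L n "euler_coord n \<kappa>" by (rule euler_coordinates(1)[OF M])
  note eM = euler_coordinates[OF M]
  define H where "H = {x \<in> carrier ?L. f x = g x}"
  have H_add: "x \<oplus>\<^bsub>?L\<^esub> y \<in> H" if "x \<in> H" "y \<in> H" for x y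
    using that semilinear_mapsD(2)[OF f] semilinear_mapsD(2)[OF g] by (auto simp: H_def)
  have H_smult: "s \<odot>\<^bsub>?L\<^esub> x \<in> H" if "x \<in> H" "s \<in> ApT" for s x
    using that semilinear_mapsD(3)[OF f] semilinear_mapsD(3)[OF g] ApT_subset
    by (auto simp: H_def intro: E.smult_closed)
  have H_pure: "euler_elem \<gamma> \<pp> M m \<in> H" if "m \<in> carrier M" for m
    using that eq eM(2) by (auto simp: H_def)
  have zero: "\<zero>\<^bsub>?L\<^esub> = euler_elem \<gamma> \<pp> M \<zero>\<^bsub>M\<^esub>"
    by (rule E.coord_inj)
       (auto simp: E.coord_zero eM(2,3) M.coord_zero intro!: eq_vecI)
  have H_0: "\<zero>\<^bsub>?L\<^esub> \<in> H" unfolding zero by (rule H_pure) simp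
  \<comment> \<open>Membership in \<open>ApTF\<close> is carried through the induction because the
    coordinate laws hold only for such scalars.\<close>
  have scal: "P \<odot>\<^bsub>?L\<^esub> euler_elem \<gamma> \<pp> M m \<in> H \<and> P \<in> ApTF" if P: "P \<in> ApTF" and m: "m \<in> carrier M" for P m
    using P
  proof (rule ApTF_induct)
    let ?e = "euler_elem \<gamma> \<pp> M m"
    note e = eM(2)[OF m]
    have "0 \<odot>\<^bsub>?L\<^esub> ?e = \<zero>\<^bsub>?L\<^esub>"
      by (rule E.coord_inj)
         (use E.coord_carrier[OF e] subring_setD(1)[OF subring_ApTF] e in
           \<open>auto simp: E.smult_closed E.coord_smult E.coord_zero\<close>)
    then show "0 \<odot>\<^bsub>?L\<^esub> ?e \<in> H \<and> 0 \<in> ApTF" using H_0 subring_setD(1)[OF subring_ApTF] by simp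
    show "(x + y) \<odot>\<^bsub>?L\<^esub> ?e \<in> H \<and> x + y \<in> ApTF"
      if "x \<odot>\<^bsub>?L\<^esub> ?e \<in> H \<and> x \<in> ApTF" "y \<odot>\<^bsub>?L\<^esub> ?e \<in> H \<and> y \<in> ApTF" for x y
    proof -
      have xy: "x \<in> ApTF" "y \<in> ApTF" "x + y \<in> ApTF" using that subring_setD(3)[OF subring_ApTF] by auto
      have "(x + y) \<odot>\<^bsub>?L\<^esub> ?e = (x \<odot>\<^bsub>?L\<^esub> ?e) \<oplus>\<^bsub>?L\<^esub> (y \<odot>\<^bsub>?L\<^esub> ?e)"
        by (rule E.coord_inj)
           (use xy e in \<open>auto simp: E.smult_closed E.add_closed E.coord_smult E.coord_add
               add_smult_distrib_vec\<close>)
      then show ?thesis using H_add that xy by simp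
    qed
    show "(s * to_ApTF a) \<odot>\<^bsub>?L\<^esub> ?e \<in> H \<and> s * to_ApTF a \<in> ApTF" if s: "s \<in> ApT" for a s
    proof -
      have s': "s \<in> ApTF" and a': "to_ApTF a \<in> ApTF"
        using s ApT_subset hom_onD(3)[OF hom_on_to_ApTF] by auto
      note sa = s' a' subring_setD(4)[OF subring_ApTF s' a']
      note am = M.smult_closed[OF UNIV_I m, of a]
      have "(s * to_ApTF a) \<odot>\<^bsub>?L\<^esub> ?e = s \<odot>\<^bsub>?L\<^esub> euler_elem \<gamma> \<pp> M (a \<odot>\<^bsub>M\<^esub> m)"
        by (rule E.coord_inj)
           (use sa e am eM(2)[OF am] m in
             \<open>auto simp: E.smult_closed E.coord_smult eM(3) M.coord_smult mult_ac intro!: eq_vecI\<close>)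
      then show ?thesis using H_smult[OF H_pure[OF am] s] sa by simp
    qed
  qed
  fix x
  show "f x = g x"
  proof (cases "x \<in> carrier ?L")
    case True
    have basis: "E.basis_elem j = euler_elem \<gamma> \<pp> M (M.basis_elem j)" for j
      by (rule E.coord_inj) (simp_all add: eM(2,3) map_vec_unit_vec[OF hom_on_to_ApTF])
    have Hs: "(\<Oplus>\<^bsub>?L\<^esub>j\<in>I. w j) \<in> H" if "finite I" "\<And>j. j \<in> I \<Longrightarrow> w j \<in> H" for I and w :: "nat \<Rightarrow> _"
      using that
    proof (induction I rule: finite_induct)
      case (insert a I)
      have "w \<in> I \<rightarrow> carrier ?L" "w a \<in> carrier ?L" using insert by (auto simp: H_def)
      then show ?case using insert H_add by simp
    qed (simp add: H_0)
    have "x = (\<Oplus>\<^bsub>?L\<^esub>j\<in>{..<n}. (euler_coord n \<kappa> x $ j) \<odot>\<^bsub>?L\<^esub> E.basis_elem j)"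
      by (rule E.lincomb_basis_elem[OF True])
    moreover have "\<dots> \<in> H"
      by (rule Hs) (use scal E.coord_entry[OF True] in \<open>auto simp: basis\<close>)
    ultimately show ?thesis by (simp add: H_def)
  next
    case False
    then show ?thesis using semilinear_mapsD(4)[OF f] semilinear_mapsD(4)[OF g] by simp
  qed
qed

text \<open>The candidate is \<Psi> composed with Frobenius. It agrees with the prescribed values
  because Frobenius may be applied before or after embedding A_F into the large ring.\<close>

lemma euler_map_coord:
  assumes M: "coordinates UNIV M n \<kappa>"
    and \<tau>M: "has_matrix \<tau>M (carrier (loc_theta \<gamma> (frob_pullback CARD('k) M))) (loc_coord n (frob_coord CARD('k) n \<kappa>))
      (carrier (loc_theta \<gamma> M)) (loc_coord n \<kappa>) \<Psi>"
    and \<Psi>: "\<Psi> \<in> mats R\<theta> n n"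
    and x: "x \<in> carrier (euler_module \<gamma> \<pp> M)"
  shows "euler_map \<gamma> \<pp> M \<tau>M x \<in> carrier (euler_module \<gamma> \<pp> M)"
    and "euler_coord n \<kappa> (euler_map \<gamma> \<pp> M \<tau>M x) =
      map_mat (\<lambda>u. [:u:]) \<Psi> *\<^sub>v map_vec (frob_fract_poly CARD('k)) (euler_coord n \<kappa> x)"
proof -
  interpret M: coordinates UNIV M n \<kappa> by (rule M)
  let ?L = "euler_module \<gamma> \<pp> M" and ?M' = "frob_pullback CARD('k) M"
  let ?\<kappa>' = "frob_coord CARD('k) n \<kappa>" and ?C = "map_mat (\<lambda>u. [:u:]) \<Psi>"
  have M': "coordinates UNIV ?M' n ?\<kappa>'" by (rule pull_coordinates(1)[OF M])
  interpret E: coordinates ApTF ?L n "euler_coord n \<kappa>" by (rule euler_coordinates(1)[OF M])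
  interpret L': coordinates R\<theta> "loc_theta \<gamma> ?M'" n "loc_coord n ?\<kappa>'" by (rule loc_coordinates(1)[OF M'])
  interpret P: coordinates_pair ApTF ?L n "euler_coord n \<kappa>" ApTF ?L n "euler_coord n \<kappa>"
      "frob_fract_poly CARD('k)"
    by (intro coordinates_pair.intro coordinates_pair_axioms.intro E.coordinates_axioms
        hom_on_frob_fract_poly)
  have C: "?C \<in> mats ApTF n n" by (rule mats_map[OF hom_onD(3)[OF hom_on_const] \<Psi>])
  define F where "F = P.matrix_map ?C"
  have Flin: "F \<in> semilinear_maps ApTF (frob_fract_poly CARD('k)) ?L ?L"
    unfolding F_def by (rule P.matrix_map_semilinear[OF C])
  have Fc: "euler_coord n \<kappa> (F x) = ?C *\<^sub>v map_vec (frob_fract_poly CARD('k)) (euler_coord n \<kappa> x)"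
    if "x \<in> carrier ?L" for x
    unfolding F_def by (rule P.coord_matrix_map[OF C that])
  \<comment> \<open>Frobenius fixes \<open>ApT\<close>, so over this subring a semilinear map is
    linear.\<close>
  have FApT: "F \<in> linear_maps ApT ?L ?L"
    using Flin ApT_subset by (auto simp: semilinear_maps_def subset_iff frob_fract_poly_ApT)
  have Fpure: "F (euler_elem \<gamma> \<pp> M m) = loc_to_euler \<gamma> \<pp> M (\<tau>M (loc_elem \<gamma> ?M' (frob_elem CARD('k) M m)))"
    if m: "m \<in> carrier M" for m
  proof (rule E.coord_inj)
    let ?y = "frob_elem CARD('k) M m"
    note y = pull_coordinates(2,3)[OF M m]
    note z = loc_coordinates(2,3)[OF M' y(1)]
    have t: "\<tau>M (loc_elem \<gamma> ?M' ?y) \<in> carrier (loc_theta \<gamma> M)"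
      "loc_coord n \<kappa> (\<tau>M (loc_elem \<gamma> ?M' ?y)) =
          \<Psi> *\<^sub>v map_vec to_fract (map_vec (frob_poly CARD('k)) (\<kappa> m))"
      using \<tau>M z y by (simp_all add: has_matrix_def)
    note e = euler_coordinates(2,3)[OF M m]
    show "F (euler_elem \<gamma> \<pp> M m) \<in> carrier ?L" by (rule semilinear_mapsD(1)[OF Flin e(1)])
    show "loc_to_euler \<gamma> \<pp> M (\<tau>M (loc_elem \<gamma> ?M' ?y)) \<in> carrier ?L"
        by (rule loc_to_euler_coord(1)[OF M t(1)])
    have v: "map_vec to_fract (map_vec (frob_poly CARD('k)) (\<kappa> m)) \<in> vecs R\<theta> n"
      using L'.coord_vecs[OF z(1)] by (simp add: z(2) y(2))
    have "euler_coord n \<kappa> (loc_to_euler \<gamma> \<pp> M (\<tau>M (loc_elem \<gamma> ?M' ?y))) =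
        ?C *\<^sub>v map_vec (\<lambda>u. [:u:]) (map_vec to_fract (map_vec (frob_poly CARD('k)) (\<kappa> m)))"
      unfolding loc_to_euler_coord(2)[OF M t(1)] t(2)
      by (rule map_vec_mult_mat_vec[OF hom_on_const subring_R\<theta> \<Psi> v])
    also have "map_vec (\<lambda>u. [:u:]) (map_vec to_fract (map_vec (frob_poly CARD('k)) (\<kappa> m))) =
        map_vec (frob_fract_poly CARD('k)) (map_vec to_ApTF (\<kappa> m))"
      by (rule eq_vecI) (simp_all add: frob_fract_to_fract)
    also have "?C *\<^sub>v \<dots> = euler_coord n \<kappa> (F (euler_elem \<gamma> \<pp> M m))"
      by (simp add: Fc[OF e(1)] e(2))
    finally show "euler_coord n \<kappa> (F (euler_elem \<gamma> \<pp> M m)) =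
        euler_coord n \<kappa> (loc_to_euler \<gamma> \<pp> M (\<tau>M (loc_elem \<gamma> ?M' ?y)))" by simp
  qed
  have "euler_map \<gamma> \<pp> M \<tau>M = F"
    unfolding euler_map_def Let_def
  proof (rule the_equality)
    fix F' assume F': "F' \<in> linear_maps ApT ?L ?L \<and> (\<forall>m\<in>carrier M. F' (euler_elem \<gamma> \<pp> M m) =
        loc_to_euler \<gamma> \<pp> M (\<tau>M (loc_elem \<gamma> ?M' (frob_elem CARD('k) M m))))"
    show "F' = F"
      by (rule linear_maps_ApT_eqI[OF M _ FApT]) (use F' Fpure in auto)
  qed (use FApT Fpure in blast)
  then show "euler_map \<gamma> \<pp> M \<tau>M x \<in> carrier ?L"
    "euler_coord n \<kappa> (euler_map \<gamma> \<pp> M \<tau>M x) = ?C *\<^sub>v map_vec (frob_fract_poly CARD('k)) (euler_coord n \<kappa> x)"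
    using semilinear_mapsD(1)[OF Flin x] Fc[OF x] by simp_all
qed

text \<open>Moving every sigma to the right turns (\<Psi> sigma)^d into the product of the
  conjugates of \<Psi> followed by sigma^d, which is the identity.\<close>

lemma euler_factor_eq_det:
  assumes M: "coordinates UNIV M n \<kappa>"
    and \<tau>M: "has_matrix \<tau>M (carrier (loc_theta \<gamma> (frob_pullback CARD('k) M))) (loc_coord n (frob_coord CARD('k) n \<kappa>))
      (carrier (loc_theta \<gamma> M)) (loc_coord n \<kappa>) \<Psi>"
    and \<Psi>: "\<Psi> \<in> mats R\<theta> n n"
  shows "euler_factor \<gamma> \<pp> M \<tau>M = det (1\<^sub>m n - monom 1 d \<cdot>\<^sub>m
    seq_prod n (\<lambda>m. map_mat (frob_fract_poly CARD('k) ^^ m) (map_mat (\<lambda>u. [:u:]) \<Psi>)) d)"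
proof -
  let ?L = "euler_module \<gamma> \<pp> M" and ?C = "map_mat (\<lambda>u. [:u:]) \<Psi>" and ?F = "euler_map \<gamma> \<pp> M \<tau>M"
  let ?S = "frob_fract_poly CARD('k) :: 'f poly fract poly \<Rightarrow> 'f poly fract poly"
  define \<Gamma> where "\<Gamma> = (\<lambda>m. map_mat (?S ^^ m) ?C)"
  interpret E: coordinates ApTF ?L n "euler_coord n \<kappa>" by (rule euler_coordinates(1)[OF M])
  note Fc = euler_map_coord[OF M \<tau>M \<Psi>]
  have C: "?C \<in> mats ApTF n n" by (rule mats_map[OF hom_onD(3)[OF hom_on_const] \<Psi>])
  have S_pow: "(?S ^^ m) u \<in> ApTF" if "u \<in> ApTF" for m u
    using that by (induction m) (auto intro: hom_onD(3)[OF hom_on_frob_fract_poly])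
  have \<Gamma>: "\<Gamma> m \<in> mats ApTF n n" for m unfolding \<Gamma>_def by (rule mats_map[OF S_pow C])
  note sp = seq_prod_mats[of ApTF \<Gamma>, OF subring_ApTF \<Gamma>]
  have pow: "(?F ^^ m) x \<in> carrier ?L \<and>
      euler_coord n \<kappa> ((?F ^^ m) x) = seq_prod n \<Gamma> m *\<^sub>v map_vec (?S ^^ m) (euler_coord n \<kappa> x)"
    if "x \<in> carrier ?L" for m x
    using that
  proof (induction m arbitrary: x)
    case 0
    then show ?case using E.coord_carrier[OF 0] by (auto intro!: eq_vecI)
  next
    case (Suc m)
    interpret Sm: comm_ring_hom "?S ^^ m" by (rule comm_ring_hom_frob_fract_poly_pow)
    note x = Suc.prems
    have c: "?C \<in> carrier_mat n n" and v: "map_vec ?S (euler_coord n \<kappa> x) \<in> carrier_vec n"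
      using C E.coord_carrier[OF x] by (auto simp: mats_def)
    \<comment> \<open>The innermost application is split off, so that the new factor sigma^m(\<Psi>)
      appears on the right as in \<open>seq_prod\<close>.\<close>
    have F: "(?F ^^ Suc m) x = (?F ^^ m) (?F x)" by (simp add: funpow_swap1)
    have "euler_coord n \<kappa> ((?F ^^ m) (?F x)) =
        seq_prod n \<Gamma> m *\<^sub>v map_vec (?S ^^ m) (?C *\<^sub>v map_vec ?S (euler_coord n \<kappa> x))"
      using Suc.IH[OF Fc(1)[OF x]] by (simp add: Fc(2)[OF x])
    also have "map_vec (?S ^^ m) (?C *\<^sub>v map_vec ?S (euler_coord n \<kappa> x)) =
        \<Gamma> m *\<^sub>v map_vec (?S ^^ m) (map_vec ?S (euler_coord n \<kappa> x))"
      unfolding \<Gamma>_def by (rule Sm.mult_mat_vec_hom[OF c v])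
    also have "map_vec (?S ^^ m) (map_vec ?S (euler_coord n \<kappa> x)) =
        map_vec (?S ^^ Suc m) (euler_coord n \<kappa> x)"
      by (rule eq_vecI) (simp_all add: funpow_swap1)
    also have "seq_prod n \<Gamma> m *\<^sub>v (\<Gamma> m *\<^sub>v \<dots>) =
        seq_prod n \<Gamma> (Suc m) *\<^sub>v map_vec (?S ^^ Suc m) (euler_coord n \<kappa> x)"
      using assoc_mult_mat_vec[OF mats_carrier[OF sp] mats_carrier[OF \<Gamma>], of "map_vec (?S ^^ Suc m) (euler_coord n \<kappa> x)" m m]
        E.coord_carrier[OF x]
      by simp
    finally show ?case unfolding F using Suc.IH[OF Fc(1)[OF x]] by blast
  qed
  have T: "monom 1 d \<in> ApTF"
    using subring_setD(1,2)[OF subring_set_localized_at[OF scalar_ext_pp_nonzero]]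
    by (auto simp: ring_ApTF_def)
  have A: "1\<^sub>m n - monom 1 d \<cdot>\<^sub>m seq_prod n \<Gamma> d \<in> mats ApTF n n"
    by (intro mats_minus mats_one mats_smult subring_ApTF T sp)
  have "endo_det ApTF ?L (\<lambda>x. x \<ominus>\<^bsub>?L\<^esub> monom 1 d \<odot>\<^bsub>?L\<^esub> (?F ^^ d) x) =
      det (1\<^sub>m n - monom 1 d \<cdot>\<^sub>m seq_prod n \<Gamma> d)"
  proof (rule E.endo_det_eq_det[OF _ A])
    fix x assume x: "x \<in> carrier ?L"
    note p = pow[OF x, of d]
    have s: "monom 1 d \<odot>\<^bsub>?L\<^esub> (?F ^^ d) x \<in> carrier ?L" using p by (intro E.smult_closed[OF T]) blast
    show "x \<ominus>\<^bsub>?L\<^esub> monom 1 d \<odot>\<^bsub>?L\<^esub> (?F ^^ d) x \<in> carrier ?L" using x s by (rule E.minus_closed)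
    have id: "map_vec (?S ^^ d) (euler_coord n \<kappa> x) = euler_coord n \<kappa> x"
      by (rule eq_vecI) (simp_all add: frob_fract_poly_pow_d)
    have xc: "euler_coord n \<kappa> x \<in> carrier_vec n" by (rule E.coord_carrier[OF x])
    have Tc: "monom 1 d \<cdot>\<^sub>m seq_prod n \<Gamma> d \<in> carrier_mat n n" using mats_carrier[OF sp[of d]] by simp
    have "euler_coord n \<kappa> (x \<ominus>\<^bsub>?L\<^esub> monom 1 d \<odot>\<^bsub>?L\<^esub> (?F ^^ d) x) =
        euler_coord n \<kappa> x - monom 1 d \<cdot>\<^sub>v (seq_prod n \<Gamma> d *\<^sub>v euler_coord n \<kappa> x)"
      using p by (simp add: E.coord_minus[OF x s] E.coord_smult[OF T] id)
    also have "\<dots> = (1\<^sub>m n - monom 1 d \<cdot>\<^sub>m seq_prod n \<Gamma> d) *\<^sub>v euler_coord n \<kappa> x"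
      using minus_mult_distrib_mat_vec[OF one_carrier_mat Tc xc]
        smult_mat_mult_vec[OF mats_carrier[OF sp[of d]] xc, of "monom 1 d"] xc
      by simp
    finally show "euler_coord n \<kappa> (x \<ominus>\<^bsub>?L\<^esub> monom 1 d \<odot>\<^bsub>?L\<^esub> (?F ^^ d) x) =
        (1\<^sub>m n - monom 1 d \<cdot>\<^sub>m seq_prod n \<Gamma> d) *\<^sub>v euler_coord n \<kappa> x" .
  qed
  then show ?thesis by (simp add: euler_factor_def Let_def \<Gamma>_def)
qed

end


section \<open>Twisted polynomials\<close>

locale twisted = comm_ring_hom \<sigma> for \<sigma> :: "'a::comm_ring_1 \<Rightarrow> 'a"
begin

lemma funpow_hom: "comm_ring_hom (\<sigma> ^^ i)"
  by (rule comm_ring_hom_funpow) (rule comm_ring_hom_axioms)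

lemma funpow_zero [simp]: "(\<sigma> ^^ i) 0 = 0" and funpow_one [simp]: "(\<sigma> ^^ i) 1 = 1"
  and funpow_add: "(\<sigma> ^^ i) (x + y) = (\<sigma> ^^ i) x + (\<sigma> ^^ i) y"
  and funpow_mult: "(\<sigma> ^^ i) (x * y) = (\<sigma> ^^ i) x * (\<sigma> ^^ i) y"
proof -
  interpret h: comm_ring_hom "\<sigma> ^^ i" by (rule funpow_hom)
  show "(\<sigma> ^^ i) 0 = 0" "(\<sigma> ^^ i) 1 = 1" "(\<sigma> ^^ i) (x + y) = (\<sigma> ^^ i) x + (\<sigma> ^^ i) y"
    "(\<sigma> ^^ i) (x * y) = (\<sigma> ^^ i) x * (\<sigma> ^^ i) y"
    by (simp_all add: h.hom_add h.hom_mult)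
qed

text \<open>Degrees may drop under addition; common summation ranges make the products of different
  summands comparable.\<close>

lemma tmult_bound:
  assumes "degree u \<le> m" "degree v \<le> n"
  shows "tmult \<sigma> u v = (\<Sum>i\<le>m. \<Sum>j\<le>n. monom (coeff u i * (\<sigma> ^^ i) (coeff v j)) (i + j))"
proof -
  have "tmult \<sigma> u v = (\<Sum>i\<le>degree u. \<Sum>j\<le>n. monom (coeff u i * (\<sigma> ^^ i) (coeff v j)) (i + j))"
    unfolding tmult_def
    by (intro sum.cong refl sum.mono_neutral_left) (use assms in \<open>auto simp: coeff_eq_0\<close>)
  also have "\<dots> = (\<Sum>i\<le>m. \<Sum>j\<le>n. monom (coeff u i * (\<sigma> ^^ i) (coeff v j)) (i + j))"
    by (intro sum.mono_neutral_left) (use assms in \<open>auto simp: coeff_eq_0\<close>)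
  finally show ?thesis .
qed

lemma tmult_add_left: "tmult \<sigma> (u + u') v = tmult \<sigma> u v + tmult \<sigma> u' v"
proof -
  let ?m = "max (degree u) (degree u')"
  have d: "degree (u + u') \<le> ?m" "degree u \<le> ?m" "degree u' \<le> ?m" by (auto intro: degree_add_le)
  show ?thesis
    unfolding d[THEN tmult_bound[OF _ order_refl]]
    by (simp add: sum.distrib[symmetric] add_monom distrib_right)
qed

lemma tmult_add_right: "tmult \<sigma> u (v + v') = tmult \<sigma> u v + tmult \<sigma> u v'"
proof -
  let ?m = "max (degree v) (degree v')"
  have d: "degree (v + v') \<le> ?m" "degree v \<le> ?m" "degree v' \<le> ?m" by (auto intro: degree_add_le)
  show ?thesis
    unfolding d[THEN tmult_bound[OF order_refl]]
    by (simp add: sum.distrib[symmetric] add_monom distrib_left funpow_add)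
qed

lemma tmult_0_left [simp]: "tmult \<sigma> 0 v = 0" and tmult_0_right [simp]: "tmult \<sigma> u 0 = 0"
  by (simp_all add: tmult_def)

lemma tmult_sum_left: "tmult \<sigma> (sum f I) v = (\<Sum>i\<in>I. tmult \<sigma> (f i) v)"
  by (induction I rule: infinite_finite_induct) (auto simp: tmult_add_left)

lemma tmult_sum_right: "tmult \<sigma> u (sum f I) = (\<Sum>i\<in>I. tmult \<sigma> u (f i))"
  by (induction I rule: infinite_finite_induct) (auto simp: tmult_add_right)

lemma tmult_monom: "tmult \<sigma> (monom a i) (monom b j) = monom (a * (\<sigma> ^^ i) b) (i + j)"
proof -
  have "tmult \<sigma> (monom a i) (monom b j) = (\<Sum>i'\<le>i. \<Sum>j'\<le>j.
      monom (coeff (monom a i) i' * (\<sigma> ^^ i') (coeff (monom b j) j')) (i' + j'))"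
    by (rule tmult_bound) (auto intro: degree_monom_le)
  also have "\<dots> = (\<Sum>i'\<le>i. \<Sum>j'\<le>j. if j' = j
      then if i' = i then monom (a * (\<sigma> ^^ i) b) (i + j) else 0 else 0)"
    by (intro sum.cong refl) auto
  also have "\<dots> = monom (a * (\<sigma> ^^ i) b) (i + j)"
    by simp
  finally show ?thesis .
qed

text \<open>Biadditivity reduces the claim to monomials, where it says sigma^i(b sigma^j(c)) =
  sigma^i(b) sigma^(i+j)(c).\<close>

lemma tmult_assoc: "tmult \<sigma> (tmult \<sigma> u v) w = tmult \<sigma> u (tmult \<sigma> v w)"
proof -
  define U V W where "U = (\<lambda>i. monom (coeff u i) i)" and "V = (\<lambda>i. monom (coeff v i) i)"
    and "W = (\<lambda>i. monom (coeff w i) i)"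
  have "u = sum U {..degree u}" "v = sum V {..degree v}" "w = sum W {..degree w}"
    by (simp_all add: U_def V_def W_def poly_as_sum_of_monoms)
  moreover have "tmult \<sigma> (tmult \<sigma> (U i) (V j)) (W l) = tmult \<sigma> (U i) (tmult \<sigma> (V j) (W l))" for i j l
    by (simp add: U_def V_def W_def tmult_monom funpow_mult funpow_add[symmetric] mult.assoc
        Nat.funpow_add add.assoc)
  ultimately show ?thesis
    by (metis (mono_tags, lifting) tmult_sum_left tmult_sum_right sum.cong)
qed

lemma tmult_const_left: "tmult \<sigma> [:c:] v = Polynomial.smult c v"
proof -
  have "tmult \<sigma> [:c:] v = (\<Sum>j\<le>degree v. Polynomial.smult c (monom (coeff v j) j))"
    by (simp add: tmult_def smult_monom)
  also have "\<dots> = Polynomial.smult c v" by (simp add: smult_sum2[symmetric] poly_as_sum_of_monoms)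
  finally show ?thesis .
qed

lemma tmult_smult_left: "tmult \<sigma> (Polynomial.smult c u) v = Polynomial.smult c (tmult \<sigma> u v)"
  by (simp only: tmult_const_left[symmetric] tmult_assoc)

lemma tmult_1_right [simp]: "tmult \<sigma> u 1 = u"
  by (simp add: tmult_def poly_as_sum_of_monoms)

lemma coeff_tmult_top:
  assumes "degree u \<le> m" "degree v \<le> n"
  shows "coeff (tmult \<sigma> u v) (m + n) = coeff u m * (\<sigma> ^^ m) (coeff v n)"
proof -
  have "coeff (tmult \<sigma> u v) (m + n) =
      (\<Sum>i\<le>m. \<Sum>j\<le>n. if i + j = m + n then coeff u i * (\<sigma> ^^ i) (coeff v j) else 0)"
    by (simp add: tmult_bound[OF assms] coeff_sum)
  also have "\<dots> = (\<Sum>i\<le>m. \<Sum>j\<le>n. if j = n then if i = m then coeff u m * (\<sigma> ^^ m) (coeff v n) else 0 else 0)"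
    by (intro sum.cong refl) auto
  finally show ?thesis by simp
qed

lemma coeff_tmult_above:
  assumes "degree u \<le> m" "degree v \<le> n" "m + n < l"
  shows "coeff (tmult \<sigma> u v) l = 0"
  using assms(3) by (auto simp: tmult_bound[OF assms(1,2)] coeff_sum intro!: sum.neutral)

end


section \<open>The motive of a Drinfeld module\<close>

text \<open>For the motive and for the twisted module only the map from vectors to elements is
  explicit; coordinates are obtained by inverting it.\<close>

lemma coordinates_inverse:
  assumes S: "subring_set S" and bij: "bij_betw \<delta> (vecs S n) (carrier M)"
    and zero: "\<delta> (0\<^sub>v n) = \<zero>\<^bsub>M\<^esub>"
    and add: "\<And>v w. v \<in> vecs S n \<Longrightarrow> w \<in> vecs S n \<Longrightarrow> \<delta> (v + w) = \<delta> v \<oplus>\<^bsub>M\<^esub> \<delta> w"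
    and smult: "\<And>s v. s \<in> S \<Longrightarrow> v \<in> vecs S n \<Longrightarrow> \<delta> (s \<cdot>\<^sub>v v) = s \<odot>\<^bsub>M\<^esub> \<delta> v"
  shows "coordinates S M n (inv_into (vecs S n) \<delta>)"
proof
  let ?\<kappa> = "inv_into (vecs S n) \<delta>"
  have \<delta>\<kappa>: "\<delta> (?\<kappa> x) = x" "?\<kappa> x \<in> vecs S n" if "x \<in> carrier M" for x
    using bij that by (auto simp: bij_betw_def f_inv_into_f inv_into_into)
  have \<kappa>\<delta>: "?\<kappa> (\<delta> v) = v" if "v \<in> vecs S n" for v
    using bij that by (auto simp: bij_betw_def)
  have \<delta>c: "\<delta> v \<in> carrier M" if "v \<in> vecs S n" for v using bij that by (auto simp: bij_betw_def)
  have vadd: "v + w \<in> vecs S n" if "v \<in> vecs S n" "w \<in> vecs S n" for v w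
    using that subring_setD(3)[OF S] by (auto simp: vecs_def)
  have vsmult: "s \<cdot>\<^sub>v v \<in> vecs S n" if "s \<in> S" "v \<in> vecs S n" for s v
    using that subring_setD(4)[OF S] by (auto simp: vecs_def)
  have vzero: "0\<^sub>v n \<in> vecs S n" using subring_setD(1)[OF S] by (auto simp: vecs_def)
  show "subring_set S" by (rule S)
  show "bij_betw ?\<kappa> (carrier M) (vecs S n)" by (rule bij_betw_inv_into[OF bij])
  show "\<zero>\<^bsub>M\<^esub> \<in> carrier M" "?\<kappa> \<zero>\<^bsub>M\<^esub> = 0\<^sub>v n"
    using \<delta>c[OF vzero] \<kappa>\<delta>[OF vzero] by (simp_all add: zero)
  fix x assume x: "x \<in> carrier M"
  show "x \<oplus>\<^bsub>M\<^esub> y \<in> carrier M" "?\<kappa> (x \<oplus>\<^bsub>M\<^esub> y) = ?\<kappa> x + ?\<kappa> y" if y: "y \<in> carrier M" for y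
    using \<delta>c[OF vadd] \<kappa>\<delta>[OF vadd] add[of "?\<kappa> x" "?\<kappa> y"] \<delta>\<kappa>[OF x] \<delta>\<kappa>[OF y] by metis+
  show "s \<odot>\<^bsub>M\<^esub> x \<in> carrier M" "?\<kappa> (s \<odot>\<^bsub>M\<^esub> x) = s \<cdot>\<^sub>v ?\<kappa> x" if s: "s \<in> S" for s
    using \<delta>c[OF vsmult[OF s]] \<kappa>\<delta>[OF vsmult[OF s]] smult[OF s, of "?\<kappa> x"] \<delta>\<kappa>[OF x] by metis+
qed

locale drinfeld_module_setting = drinfeld_setting \<gamma> \<pp>
  for \<gamma> :: "'k::{field,finite} poly \<Rightarrow> 'f::{field,finite}" and \<pp> :: "'k poly" +
  fixes \<phi> :: "'k poly \<Rightarrow> 'f poly"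
  assumes drinfeld: "drinfeld_module \<gamma> \<phi>"
begin

sublocale tw: twisted "frob CARD('k) :: 'f \<Rightarrow> 'f" ..

abbreviation r :: nat where "r \<equiv> degree (\<phi> tvar)"
abbreviation g :: "nat \<Rightarrow> 'f" where "g i \<equiv> coeff (\<phi> tvar) i"

lemma r_pos: "r > 0" and g_0: "g 0 = \<theta>"
  using drinfeld by (auto simp: drinfeld_module_def \<theta>_def)

lemma g_r: "g r \<noteq> 0"
  using r_pos by (metis degree_0 leading_coeff_0_iff less_irrefl)

section \<open>The action of t by right multiplication with phi_t, and left multiplication by
  tau\<close>

definition right_phi :: "'f poly \<Rightarrow> 'f poly" where
  "right_phi f = tmult (frob CARD('k)) f (\<phi> tvar)"

lemma right_phi_add: "right_phi (f + f') = right_phi f + right_phi f'"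
  by (simp add: right_phi_def tw.tmult_add_left)

lemma right_phi_smult: "right_phi (Polynomial.smult c f) = Polynomial.smult c (right_phi f)"
  by (simp add: right_phi_def tw.tmult_smult_left)

lemma right_phi_0 [simp]: "right_phi 0 = 0"
  by (simp add: right_phi_def)

lemma right_phi_sum: "right_phi (sum f I) = (\<Sum>i\<in>I. right_phi (f i))"
  by (simp add: right_phi_def tw.tmult_sum_left)

definition act :: "'f poly \<Rightarrow> 'f poly \<Rightarrow> 'f poly" where
  "act p f = p \<odot>\<^bsub>drinfeld_motive \<phi>\<^esub> f"

lemma phi_mult: "\<phi> (a * b) = tmult (frob CARD('k)) (\<phi> a) (\<phi> b)"
  using drinfeld by (auto simp: drinfeld_module_def ring_hom_def type_ring_def twisted_ring_def)

lemma tmult_phi_monom: "tmult (frob CARD('k)) f (\<phi> (monom 1 i)) = (right_phi ^^ i) f"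
proof (induction i)
  case 0
  have "\<phi> 1 = 1"
    using drinfeld by (auto simp: drinfeld_module_def ring_hom_def type_ring_def twisted_ring_def)
  then show ?case by simp
next
  case (Suc i)
  have "monom 1 (Suc i) = monom 1 i * (tvar :: 'k poly)" by (simp add: monom_Suc)
  then have "\<phi> (monom 1 (Suc i)) = tmult (frob CARD('k)) (\<phi> (monom 1 i)) (\<phi> tvar)"
    by (simp only: phi_mult)
  then show ?case by (simp add: tw.tmult_assoc[symmetric] Suc right_phi_def)
qed

lemma act_eq: "act p f = (\<Sum>i\<le>degree p. (right_phi ^^ i) (Polynomial.smult (coeff p i) f))"
  by (simp add: act_def drinfeld_motive_def tmult_phi_monom tw.tmult_const_left)

lemma act_0 [simp]: "act 0 f = 0"
  by (simp add: act_eq)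

text \<open>Horner's rule for the action: constants commute with right multiplication by phi_t. The
  module laws then follow by induction on the polynomial.\<close>

lemma act_pCons: "act (pCons c p) f = Polynomial.smult c f + right_phi (act p f)"
proof (cases "p = 0")
  case False
  have "act (pCons c p) f = (\<Sum>i\<le>Suc (degree p). (right_phi ^^ i) (Polynomial.smult (coeff (pCons c p) i) f))"
    using False by (simp add: act_eq)
  also have "\<dots> = Polynomial.smult c f + (\<Sum>i\<le>degree p. right_phi ((right_phi ^^ i) (Polynomial.smult (coeff p i) f)))"
    by (subst sum.atMost_Suc_shift) simp
  finally show ?thesis by (simp add: act_eq[of p] right_phi_sum)
qed (simp add: act_eq)

lemma act_0_right [simp]: "act p 0 = 0"
  by (induction p) (simp_all add: act_pCons)

lemma act_add_right: "act p (f + f') = act p f + act p f'"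
  by (induction p) (simp_all add: act_pCons right_phi_add smult_add_right)

lemma act_add_left: "act (p + p') f = act p f + act p' f"
  by (induction p p' rule: poly_induct2) (simp_all add: act_pCons right_phi_add smult_add_left)

lemma act_smult_left: "act (Polynomial.smult c p) f = Polynomial.smult c (act p f)"
  by (induction p) (simp_all add: act_pCons right_phi_smult smult_add_right)

lemma act_mult: "act (p * p') f = act p (act p' f)"
proof (induction p)
  case (pCons c p)
  have "pCons c p * p' = Polynomial.smult c p' + pCons 0 (p * p')" by simp
  then show ?case by (simp only: act_add_left act_pCons act_smult_left pCons) simp
qed simp

lemma act_sum_right: "act p (sum f I) = (\<Sum>i\<in>I. act p (f i))"
  by (induction I rule: infinite_finite_induct) (auto simp: act_add_right)

definition left_tau :: "'f poly \<Rightarrow> 'f poly" where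
  "left_tau f = tmult (frob CARD('k)) (monom 1 1) f"

text \<open>Left multiplication by tau commutes with right multiplication by phi_t, and passing a
  constant it applies Frobenius, as tau c = c^q tau.\<close>

lemma left_tau_act: "left_tau (act p f) = act (frob_poly CARD('k) p) (left_tau f)"
proof (induction p)
  case (pCons c p)
  have "left_tau (Polynomial.smult c f) = Polynomial.smult (frob CARD('k) c) (left_tau f)"
  proof -
    have "tmult (frob CARD('k)) (monom 1 1) [:c:] = tmult (frob CARD('k)) [:frob CARD('k) c:] (monom 1 1)"
      by (simp only: monom_0[symmetric] tw.tmult_monom) simp
    then show ?thesis
      unfolding left_tau_def by (simp only: tw.tmult_const_left[symmetric] tw.tmult_assoc[symmetric])
  qed
  moreover have "left_tau (right_phi h) = right_phi (left_tau h)" for h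
    by (simp add: left_tau_def right_phi_def tw.tmult_assoc)
  moreover have "frob_poly CARD('k) (pCons c p) = pCons (frob CARD('k) c) (frob_poly CARD('k) p)"
    by (simp add: frob_poly_def frob.map_poly_pCons_hom)
  ultimately show ?case
    using pCons by (simp add: act_pCons) (simp add: left_tau_def tw.tmult_add_right)
qed (simp add: left_tau_def)

lemma left_tau_sum: "left_tau (sum f I) = (\<Sum>i\<in>I. left_tau (f i))"
  by (simp add: left_tau_def tw.tmult_sum_right)

lemma left_tau_monom: "left_tau (monom 1 i) = monom 1 (Suc i)"
  by (simp add: left_tau_def tw.tmult_monom)

section \<open>The basis 1, tau, ..., tau^(r-1)\<close>

definition of_vec :: "'f poly vec \<Rightarrow> 'f poly" where
  "of_vec v = (\<Sum>i<r. act (v $ i) (monom 1 i))"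

lemma act_const: "act [:c:] f = Polynomial.smult c f"
  by (simp add: act_pCons)

lemma act_1 [simp]: "act 1 f = f"
  using act_const[of 1 f] by (simp add: pCons_one)

text \<open>The top coefficient is that of h times a Frobenius power of g_r, and neither factor
  vanishes.\<close>

lemma right_phi_top:
  assumes "h \<noteq> 0"
  shows "coeff (right_phi h) (degree h + r) \<noteq> 0"
proof -
  have "(frob CARD('k) ^^ i) x = 0 \<longleftrightarrow> x = 0" for i and x :: 'f by (induction i) auto
  then show ?thesis
    using assms g_r unfolding right_phi_def tw.coeff_tmult_top[OF order_refl order_refl] by simp
qed

text \<open>Splitting off constant terms, c_i = a_i + t c'_i, writes the relation as (sum of a_i
  tau^i) + h phi_t = 0. If h were nonzero, h phi_t would have a term of degree at least r that
  nothing cancels. So h = 0 and all a_i = 0, and the c'_i satisfy a shorter relation;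
  \<open>N\<close> bounds the number of coefficients.\<close>

lemma sum_act_eq_0:
  assumes "(\<Sum>i<r. act (c i) (monom 1 i)) = 0" "\<And>i j. i < r \<Longrightarrow> N \<le> j \<Longrightarrow> coeff (c i) j = 0" "i < r"
  shows "c i = 0"
  using assms
proof (induction N arbitrary: c i)
  case 0
  then show ?case by (simp add: poly_eq_iff)
next
  case (Suc N)
  define a c' where "a i = coeff (c i) 0" and "c' i = poly_shift 1 (c i)" for i
  have c: "c i = pCons (a i) (c' i)" for i
    by (rule poly_eqI) (simp add: a_def c'_def coeff_pCons coeff_poly_shift split: nat.split)
  define h where "h = (\<Sum>i<r. act (c' i) (monom 1 i))"
  have "(\<Sum>i<r. act (c i) (monom 1 i)) = (\<Sum>i<r. monom (a i) i) + right_phi h"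
    by (simp add: c act_pCons sum.distrib h_def right_phi_sum smult_monom)
  then have eq: "(\<Sum>i<r. monom (a i) i) + right_phi h = 0" using Suc.prems(1) by simp
  have "h = 0"
  proof (rule ccontr)
    assume "h \<noteq> 0"
    have "coeff (\<Sum>i<r. monom (a i) i) (degree h + r) = 0" by (simp add: coeff_sum)
    moreover have "coeff ((\<Sum>i<r. monom (a i) i) + right_phi h) (degree h + r) = 0" using eq by simp
    ultimately show False using right_phi_top[OF \<open>h \<noteq> 0\<close>] by simp
  qed
  then have "c' i = 0"
    using Suc.IH[of c' i] Suc.prems(2,3) by (auto simp: h_def c'_def coeff_poly_shift)
  moreover have "coeff (\<Sum>i<r. monom (a i) i) i = 0" using eq \<open>h = 0\<close> by simp
  ultimately show ?case using Suc.prems(3) by (simp add: c coeff_sum)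
qed

text \<open>Right division by phi_t: one monomial h removes the leading term, and induction on the
  degree applies both to f - h phi_t and to h.\<close>

lemma sum_act_surj: "\<exists>c. f = (\<Sum>i<r. act (c i) (monom 1 i))"
proof (induction "degree f" arbitrary: f rule: less_induct)
  case less
  show ?case
  proof (cases "degree f < r")
    case True
    have "f = (\<Sum>i<r. act [:coeff f i:] (monom 1 i))"
      using True by (auto simp: act_const smult_monom poly_eq_iff coeff_sum coeff_eq_0)
    then show ?thesis by (rule exI[of _ "\<lambda>i. [:coeff f i:]"])
  next
    case False
    define N where "N = degree f"
    have N: "r \<le> N" "N - r + r = N" "N - r < N" "N > 0" using False r_pos by (auto simp: N_def)
    have nz: "(frob CARD('k) ^^ i) x = 0 \<longleftrightarrow> x = 0" for i and x :: 'f by (induction i) auto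
    \<comment> \<open>The leading coefficient of h phi_t is that of h times sigma^(N-r)(g_r), hence
      this denominator.\<close>
    define h where "h = monom (coeff f N / (frob CARD('k) ^^ (N - r)) (g r)) (N - r)"
    have dh: "degree h \<le> N - r" unfolding h_def by (rule degree_monom_le)
    have "coeff (right_phi h) N = coeff f N"
      using tw.coeff_tmult_top[OF dh order_refl[of r]] g_r
      by (simp add: right_phi_def N(2) nz) (simp add: h_def nz)
    then have "coeff (f - right_phi h) j = 0" if "N \<le> j" for j
      using that tw.coeff_tmult_above[OF dh order_refl[of r], of j] N(2)
      by (cases "j = N") (auto simp: right_phi_def coeff_eq_0 N_def)
    then have "degree (f - right_phi h) < N" using N(4) by (metis degree_0 leading_coeff_0_iff not_less)
    then obtain c where c: "f - right_phi h = (\<Sum>i<r. act (c i) (monom 1 i))"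
      using less[of "f - right_phi h"] by (auto simp: N_def)
    obtain c' where c': "h = (\<Sum>i<r. act (c' i) (monom 1 i))"
      using less[of h] dh N(3) by (auto simp: N_def)
    have "f = (\<Sum>i<r. act (c i) (monom 1 i)) + right_phi h" unfolding c[symmetric] by simp
    \<comment> \<open>Right multiplication by phi_t is the action of t, so it shifts the
      coefficients c'_i of h by one power of t.\<close>
    also have "\<dots> = (\<Sum>i<r. act (c i + pCons 0 (c' i)) (monom 1 i))"
      by (subst c') (simp add: act_add_left act_pCons right_phi_sum sum.distrib)
    finally show ?thesis by (rule exI[of _ "\<lambda>i. c i + pCons 0 (c' i)"])
  qed
qed

definition motive_coord :: "'f poly \<Rightarrow> 'f poly vec" where
  "motive_coord = inv_into (vecs UNIV r) of_vec"

lemma bij_of_vec: "bij_betw of_vec (vecs UNIV r) UNIV"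
proof (rule bij_betwI')
  fix v w :: "'f poly vec" assume vw: "v \<in> vecs UNIV r" "w \<in> vecs UNIV r"
  show "of_vec v = of_vec w \<longleftrightarrow> v = w"
  proof
    assume eq: "of_vec v = of_vec w"
    have neg: "act (p - p') f = act p f - act p' f" for p p' f
      using act_add_left[of "p - p'" p' f] by simp
    have s0: "(\<Sum>i<r. act (v $ i - w $ i) (monom 1 i)) = 0"
      using eq by (simp add: neg sum_subtractf of_vec_def)
    define N where "N = Suc (\<Sum>i<r. degree (v $ i - w $ i))"
    have "coeff (v $ i - w $ i) j = 0" if "i < r" "N \<le> j" for i j
    proof (rule coeff_eq_0)
      have "degree (v $ i - w $ i) \<le> (\<Sum>i<r. degree (v $ i - w $ i))"
        by (rule member_le_sum) (use that in auto)
      then show "degree (v $ i - w $ i) < j" using that by (simp add: N_def)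
    qed
    from sum_act_eq_0[OF s0 this] have "v $ i = w $ i" if "i < r" for i using that by simp
    then show "v = w" using vw by (intro eq_vecI) (auto simp: vecs_def)
  qed simp
next
  fix f :: "'f poly"
  obtain c where "f = (\<Sum>i<r. act (c i) (monom 1 i))" using sum_act_surj by blast
  then show "\<exists>v\<in>vecs UNIV r. f = of_vec v"
    by (intro bexI[of _ "vec r c"]) (auto simp: of_vec_def vecs_def)
qed simp

lemma motive_coordinates: "coordinates UNIV (drinfeld_motive \<phi>) r motive_coord"
  unfolding motive_coord_def
proof (rule coordinates_inverse)
  show "bij_betw of_vec (vecs UNIV r) (carrier (drinfeld_motive \<phi>))"
    using bij_of_vec by (simp add: drinfeld_motive_def)
  show "of_vec (0\<^sub>v r) = \<zero>\<^bsub>drinfeld_motive \<phi>\<^esub>" by (simp add: of_vec_def drinfeld_motive_def)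
  show "of_vec (v + w) = of_vec v \<oplus>\<^bsub>drinfeld_motive \<phi>\<^esub> of_vec w"
    if "v \<in> vecs UNIV r" "w \<in> vecs UNIV r" for v w
    using that by (simp add: of_vec_def vecs_def act_add_left sum.distrib drinfeld_motive_def)
  show "of_vec (s \<cdot>\<^sub>v v) = s \<odot>\<^bsub>drinfeld_motive \<phi>\<^esub> of_vec v" if "v \<in> vecs UNIV r" for s v
    using that by (simp add: of_vec_def vecs_def act_mult act_sum_right flip: act_def)
qed simp

text \<open>Coordinates of \<open>\<tau>\<^sup>r\<close>, obtained by solving \<open>t \<bullet> 1 = \<phi>\<^sub>t\<close> for the leading term.\<close>

definition top_coord :: "nat \<Rightarrow> 'f poly" where
  "top_coord i = (if i = 0 then Polynomial.smult (inverse (g r)) [:- \<theta>, 1:] else [:- g i / g r:])"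

lemma sum_top_coord: "(\<Sum>i<r. act (top_coord i) (monom 1 i)) = monom 1 r"
proof -
  have 1: "right_phi 1 = \<phi> tvar" unfolding right_phi_def
    using tw.tmult_const_left[of 1 "\<phi> tvar"] by (simp add: one_pCons)
  have "act (top_coord i) (monom 1 i) = (if i = 0 then Polynomial.smult (inverse (g r)) (\<phi> tvar) else 0)
      - monom (g i / g r) i" for i
  proof (cases "i = 0")
    case True
    have "act [:- \<theta>, 1:] 1 = \<phi> tvar - [:\<theta>:]"
      unfolding act_pCons[of "- \<theta>"] act_const smult_1_left 1
      by (simp add: pCons_one[symmetric] del: pCons_one)
    moreover have "act (top_coord i) (monom 1 i) = Polynomial.smult (inverse (g r)) (act [:- \<theta>, 1:] 1)"
      using True by (simp only: top_coord_def if_True simp_thms act_smult_left monom_0 pCons_one)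
    ultimately show ?thesis
      using True by (simp add: smult_diff_right monom_0 g_0 divide_inverse mult.commute)
  qed (simp add: top_coord_def act_const smult_monom minus_monom)
  then have "(\<Sum>i<r. act (top_coord i) (monom 1 i)) =
      Polynomial.smult (inverse (g r)) (\<phi> tvar) - (\<Sum>i<r. monom (g i / g r) i)"
    using r_pos by (simp add: sum_subtractf)
  also have "\<dots> = monom 1 r"
    using g_r by (auto simp: poly_eq_iff coeff_sum coeff_eq_0 divide_inverse not_less le_less)
  finally show ?thesis .
qed

text \<open>Column j holds the coordinates of tau^(j+1), which is again a basis element except in
  the last column.\<close>

definition tau_mat :: "'f poly mat" where
  "tau_mat = mat r r (\<lambda>(i, j). if Suc j = r then top_coord i else if i = Suc j then 1 else 0)"

lemma tau_mat_carrier [simp]: "tau_mat \<in> carrier_mat r r"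
  by (simp add: tau_mat_def)

lemma motive_coord_left_tau:
  "motive_coord (left_tau f) = tau_mat *\<^sub>v map_vec (frob_poly CARD('k)) (motive_coord f)"
proof -
  interpret M: coordinates UNIV "drinfeld_motive \<phi>" r motive_coord by (rule motive_coordinates)
  define v where "v = motive_coord f"
  have v: "v \<in> vecs UNIV r" unfolding v_def by (rule M.coord_vecs) (simp add: drinfeld_motive_def)
  have f: "f = of_vec v"
    unfolding v_def motive_coord_def
    by (rule f_inv_into_f[symmetric]) (use bij_of_vec in \<open>simp add: bij_betw_def\<close>)
  define w where "w i = frob_poly CARD('k) (v $ i)" for i
  have "left_tau f = (\<Sum>j<r. act (w j) (monom 1 (Suc j)))"
    by (simp add: f of_vec_def left_tau_sum left_tau_act left_tau_monom w_def)
  also have "\<dots> = (\<Sum>j<r. act (w j) (\<Sum>i<r. act (tau_mat $$ (i, j)) (monom 1 i)))"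
  proof (rule sum.cong[OF refl])
    fix j assume j: "j \<in> {..<r}"
    have "(\<Sum>i<r. act (tau_mat $$ (i, j)) (monom 1 i)) = monom 1 (Suc j)"
    proof (cases "Suc j = r")
      case True
      then show ?thesis using j sum_top_coord by (simp add: tau_mat_def)
    next
      case False
      then have "(\<Sum>i<r. act (tau_mat $$ (i, j)) (monom 1 i)) =
          (\<Sum>i<r. if i = Suc j then act 1 (monom 1 (Suc j)) else 0)"
        using j by (intro sum.cong) (auto simp: tau_mat_def)
      then show ?thesis using False j by (simp add: one_pCons act_const)
    qed
    then show "act (w j) (monom 1 (Suc j)) = act (w j) (\<Sum>i<r. act (tau_mat $$ (i, j)) (monom 1 i))"
        by simp
  qed
  also have "\<dots> = (\<Sum>j<r. \<Sum>i<r. act (tau_mat $$ (i, j) * w j) (monom 1 i))"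
    by (simp add: act_sum_right act_mult[symmetric] mult.commute)
  also have "\<dots> = (\<Sum>i<r. \<Sum>j<r. act (tau_mat $$ (i, j) * w j) (monom 1 i))" by (rule sum.swap)
  also have "\<dots> = (\<Sum>i<r. act (\<Sum>j<r. tau_mat $$ (i, j) * w j) (monom 1 i))"
  proof -
    have "act (sum p I) h = (\<Sum>i\<in>I. act (p i) h)" for p h and I :: "nat set"
      by (induction I rule: infinite_finite_induct) (auto simp: act_add_left)
    then show ?thesis by simp
  qed
  also have "\<dots> = of_vec (tau_mat *\<^sub>v map_vec (frob_poly CARD('k)) v)"
    unfolding of_vec_def
    by (intro sum.cong refl arg_cong[of _ _ "\<lambda>p. act p _"])
       (use v in \<open>simp add: w_def vecs_def tau_mat_def scalar_prod_def atLeast0LessThan\<close>)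
  finally have "motive_coord (left_tau f) = motive_coord (of_vec (tau_mat *\<^sub>v map_vec (frob_poly CARD('k)) v))"
    by simp
  also have "\<dots> = tau_mat *\<^sub>v map_vec (frob_poly CARD('k)) v"
    unfolding motive_coord_def
    by (rule inv_into_f_f)
       (use bij_of_vec v in \<open>auto simp: bij_betw_def vecs_def intro!:
           mult_mat_vec_carrier[OF tau_mat_carrier]\<close>)
  finally show ?thesis by (simp add: v_def)
qed

section \<open>The maps of the motive and of its dual\<close>

lemma drinfeld_motive_map_has_matrix:
  "has_matrix (drinfeld_motive_map \<gamma> \<phi>)
    (carrier (loc_theta \<gamma> (frob_pullback CARD('k) (drinfeld_motive \<phi>))))
    (loc_coord r (frob_coord CARD('k) r motive_coord))
    (carrier (loc_theta \<gamma> (drinfeld_motive \<phi>))) (loc_coord r motive_coord) (map_mat to_fract tau_mat)"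
proof -
  let ?M = "drinfeld_motive \<phi>" and ?\<Phi> = "map_mat to_fract tau_mat"
  let ?M' = "frob_pullback CARD('k) ?M" and ?\<kappa>' = "frob_coord CARD('k) r motive_coord"
  note M = motive_coordinates
  interpret M: coordinates UNIV ?M r motive_coord by (rule M)
  have M': "coordinates UNIV ?M' r ?\<kappa>'" by (rule pull_coordinates(1)[OF M])
  interpret L: coordinates R\<theta> "loc_theta \<gamma> ?M" r "loc_coord r motive_coord"
      by (rule loc_coordinates(1)[OF M])
  interpret L': coordinates R\<theta> "loc_theta \<gamma> ?M'" r "loc_coord r ?\<kappa>'" by (rule loc_coordinates(1)[OF M'])
  interpret P: coordinates_pair R\<theta> "loc_theta \<gamma> ?M'" r "loc_coord r ?\<kappa>'" R\<theta> "loc_theta \<gamma> ?M" r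
    "loc_coord r motive_coord" "\<lambda>s. s"
    by (intro coordinates_pair.intro coordinates_pair_axioms.intro L.coordinates_axioms
        L'.coordinates_axioms hom_on_ident)
  have mem: "f \<in> carrier ?M" for f by (simp add: drinfeld_motive_def)
  have \<Phi>: "?\<Phi> \<in> mats R\<theta> r r"
    using hom_onD(3)[OF hom_on_to_fract] by (auto simp: mats_def tau_mat_def)
  define G where "G = P.matrix_map ?\<Phi>"
  have Glin: "G \<in> linear_maps R\<theta> (loc_theta \<gamma> ?M') (loc_theta \<gamma> ?M)"
    unfolding G_def by (rule P.matrix_map_semilinear[OF \<Phi>])
  have Gc: "loc_coord r motive_coord (G x) = ?\<Phi> *\<^sub>v loc_coord r ?\<kappa>' x"
      if "x \<in> carrier (loc_theta \<gamma> ?M')" for x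
    unfolding G_def using P.coord_matrix_map[OF \<Phi> that] by (simp add: map_vec_ident)
  have pure: "loc_elem \<gamma> ?M' (frob_elem CARD('k) ?M f) \<in> carrier (loc_theta \<gamma> ?M')"
    "loc_coord r ?\<kappa>' (loc_elem \<gamma> ?M' (frob_elem CARD('k) ?M f)) =
      map_vec to_fract (map_vec (frob_poly CARD('k)) (motive_coord f))" for f
    using loc_coordinates(2,3)[OF M' pull_coordinates(2)[OF M mem]] pull_coordinates(3)[OF M mem]
        by simp_all
  have Gpure: "G (loc_elem \<gamma> ?M' (frob_elem CARD('k) ?M f)) =
      loc_elem \<gamma> ?M (tmult (frob CARD('k)) (monom 1 1) f)" for f
  proof (rule L.coord_inj)
    show "G (loc_elem \<gamma> ?M' (frob_elem CARD('k) ?M f)) \<in> carrier (loc_theta \<gamma> ?M)"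
      by (rule semilinear_mapsD(1)[OF Glin pure(1)])
    show "loc_elem \<gamma> ?M (tmult (frob CARD('k)) (monom 1 1) f) \<in> carrier (loc_theta \<gamma> ?M)"
      by (rule loc_coordinates(2)[OF M mem])
    have "loc_coord r motive_coord (G (loc_elem \<gamma> ?M' (frob_elem CARD('k) ?M f))) =
        map_vec to_fract (tau_mat *\<^sub>v map_vec (frob_poly CARD('k)) (motive_coord f))"
      unfolding Gc[OF pure(1)] pure(2)
      by (rule map_vec_mult_mat_vec[OF hom_on_to_fract subring_set_UNIV, symmetric])
         (use M.coord_carrier[OF mem] in \<open>auto simp: mats_def vecs_def tau_mat_def\<close>)
    then show "loc_coord r motive_coord (G (loc_elem \<gamma> ?M' (frob_elem CARD('k) ?M f))) =
        loc_coord r motive_coord (loc_elem \<gamma> ?M (tmult (frob CARD('k)) (monom 1 1) f))"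
      unfolding loc_coordinates(3)[OF M mem] motive_coord_left_tau[unfolded left_tau_def] .
  qed
  have "drinfeld_motive_map \<gamma> \<phi> = G"
    unfolding drinfeld_motive_map_def Let_def
  proof (rule the_equality)
    fix G' assume G': "G' \<in> linear_maps R\<theta> (loc_theta \<gamma> ?M') (loc_theta \<gamma> ?M) \<and>
      (\<forall>f. G' (loc_elem \<gamma> ?M' (frob_elem CARD('k) ?M f)) =
          loc_elem \<gamma> ?M (tmult (frob CARD('k)) (monom 1 1) f))"
    show "G' = G"
    proof (rule coordinates_semilinear_maps_eqI[OF L'.coordinates_axioms L.coordinates_axioms hom_on_ident _ Glin])
      show "G' \<in> linear_maps R\<theta> (loc_theta \<gamma> ?M') (loc_theta \<gamma> ?M)" using G' by blast
      fix j assume "j < r"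
      show "\<exists>x\<in>carrier (loc_theta \<gamma> ?M'). loc_coord r ?\<kappa>' x = unit_vec r j \<and> G' x = G x"
        using pure[of "M.basis_elem j"] G' Gpure
        by (intro bexI[of _ "loc_elem \<gamma> ?M' (frob_elem CARD('k) ?M (M.basis_elem j))"])
           (auto simp: map_vec_unit_vec[OF hom_on_frob_poly] map_vec_unit_vec[OF hom_on_to_fract])
    qed
  qed (use Glin Gpure in blast)
  then show ?thesis unfolding has_matrix_def using Gc semilinear_mapsD(1)[OF Glin] by auto
qed

text \<open>The first row of the transposed inverse of the matrix of tau; the pole at \<theta> is
  the inverse of the factor t - \<theta> in \<open>top_coord 0\<close>.\<close>

definition dual_coeff :: "nat \<Rightarrow> 'f poly fract" where
  "dual_coeff j = to_fract [:g j:] / to_fract [:- \<theta>, 1:]"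

text \<open>For k < r - 1 column k of \<Phi> is a unit vector, and the claim is immediate. In the
  last column g_(j+1)/(t - \<theta>) meets (t - \<theta>)/g_r and cancels against -g_(j+1)/g_r,
  except for j = r - 1, where the second term is missing and g_r/g_r = 1 remains.\<close>

lemma dual_mat_inverse:
  "transpose_mat (recurrence_mat r dual_coeff) * map_mat to_fract tau_mat = 1\<^sub>m r"
  "map_mat to_fract tau_mat * transpose_mat (recurrence_mat r dual_coeff) = 1\<^sub>m r"
proof -
  let ?\<Psi> = "recurrence_mat r dual_coeff" and ?\<Phi> = "map_mat to_fract tau_mat :: 'f poly fract mat"
  have nz: "to_fract [:- \<theta>, 1:] \<noteq> (0 :: 'f poly fract)" by simp
  have gr: "to_fract [:g r:] \<noteq> (0 :: 'f poly fract)" using g_r by simp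
  show eq: "transpose_mat ?\<Psi> * ?\<Phi> = 1\<^sub>m r"
  proof (rule eq_matI)
    fix j k assume "j < dim_row (1\<^sub>m r)" "k < dim_col (1\<^sub>m r)"
    then have jk: "j < r" "k < r" by auto
    have "(transpose_mat ?\<Psi> * ?\<Phi>) $$ (j, k) = (\<Sum>i<r. ?\<Psi> $$ (i, j) * ?\<Phi> $$ (i, k))"
      using jk by (simp add: tau_mat_def recurrence_mat_def scalar_prod_def atLeast0LessThan)
    also have "\<dots> = (\<Sum>i<r. (if i = 0 then dual_coeff (Suc j) * ?\<Phi> $$ (0, k) else 0)
        + (if i = Suc j then ?\<Phi> $$ (Suc j, k) else 0))"
      using jk by (intro sum.cong) (auto simp: recurrence_mat_def)
    also have "\<dots> = dual_coeff (Suc j) * ?\<Phi> $$ (0, k) + (if Suc j < r then ?\<Phi> $$ (Suc j, k) else 0)"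
      using r_pos by (simp add: sum.distrib)
    also have "\<dots> = (if j = k then 1 else 0)"
    proof (cases "Suc k = r")
      case False
      then show ?thesis using jk r_pos by (auto simp: tau_mat_def)
    next
      case True
      have top0: "to_fract (top_coord 0) = to_fract [:- \<theta>, 1:] / to_fract [:g r:]"
      proof -
        have "to_fract (top_coord 0) * to_fract [:g r:] = to_fract (top_coord 0 * [:g r:])"
          by (rule to_fract_mult[symmetric])
        also have "top_coord 0 * [:g r:] = [:- \<theta>, 1:]" using g_r by (simp add: top_coord_def)
        finally show ?thesis using gr by (simp add: eq_divide_eq)
      qed
      have topj: "to_fract [:- g (Suc j) / g r:] = - (to_fract [:g (Suc j):] / to_fract [:g r:])"
      proof -
        have "to_fract [:- g (Suc j) / g r:] * to_fract [:g r:] =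
            to_fract ([:- g (Suc j) / g r:] * [:g r:])"
          by (rule to_fract_mult[symmetric])
        also have "[:- g (Suc j) / g r:] * [:g r:] = - [:g (Suc j):]" using g_r by simp
        also have "to_fract (- [:g (Suc j):]) = - to_fract [:g (Suc j):]" by (rule to_fract_uminus)
        finally show ?thesis by (simp only: minus_divide_left nonzero_eq_divide_eq[OF gr])
      qed
      have "dual_coeff (Suc j) * ?\<Phi> $$ (0, k) = to_fract [:g (Suc j):] / to_fract [:g r:]"
        using True jk r_pos nz by (simp add: tau_mat_def top0 dual_coeff_def)
      moreover have "?\<Phi> $$ (Suc j, k) = - (to_fract [:g (Suc j):] / to_fract [:g r:])" if "Suc j < r"
        using that jk True topj by (simp add: tau_mat_def top_coord_def)
      moreover have "Suc j < r \<longleftrightarrow> j \<noteq> k" using True jk by auto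
      moreover have "to_fract [:g (Suc j):] / to_fract [:g r:] = 1" if "j = k"
        unfolding that True using gr by (rule divide_self)
      ultimately show ?thesis by (cases "j = k") simp_all
    qed
    finally show "(transpose_mat ?\<Psi> * ?\<Phi>) $$ (j, k) = 1\<^sub>m r $$ (j, k)" using jk by simp
  qed (auto simp: tau_mat_def recurrence_mat_def)
  \<comment> \<open>Over the field F(t) a left inverse of a square matrix is also a right
    inverse.\<close>
  show "?\<Phi> * transpose_mat ?\<Psi> = 1\<^sub>m r"
    by (rule mat_mult_left_right_inverse[OF _ _ eq]) (simp_all add: tau_mat_def)
qed

text \<open>Only the first row of \<Psi> is moved by Frobenius, since the other entries are 0 and 1;
  so each conjugate is again a recurrence matrix.\<close>

lemma dual_euler_factor:
  "euler_factor \<gamma> \<pp> (dual_module UNIV (drinfeld_motive \<phi>))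
     (dual_motive_map \<gamma> (drinfeld_motive \<phi>) (drinfeld_motive_map \<gamma> \<phi>)) =
   det (1\<^sub>m r - monom 1 1 ^ d \<cdot>\<^sub>m
     seq_prod r (\<lambda>m. recurrence_mat r (\<lambda>j. (frob_fract_poly CARD('k) ^^ m) [:dual_coeff j:])) d)"
proof -
  let ?M = "drinfeld_motive \<phi>" and ?\<Psi> = "recurrence_mat r dual_coeff"
  have "dual_coeff j \<in> R\<theta>" for j
    unfolding dual_coeff_def ring_theta_def localized_at_def \<theta>_def
    by (intro CollectI exI[of _ "[:g j:]"] exI[of _ "1::nat"]) simp
  then have \<Psi>: "?\<Psi> \<in> mats R\<theta> r r"
    using subring_setD(1,2)[OF subring_R\<theta>] by (auto simp: mats_def recurrence_mat_def)
  have \<Phi>: "map_mat to_fract tau_mat \<in> mats R\<theta> r r"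
    using hom_onD(3)[OF hom_on_to_fract] by (auto simp: mats_def tau_mat_def)
  interpret M: coordinates UNIV ?M r motive_coord by (rule motive_coordinates)
  have h: "map_mat (frob_fract_poly CARD('k) ^^ m) (map_mat (\<lambda>u. [:u:]) ?\<Psi>) =
      recurrence_mat r (\<lambda>j. (frob_fract_poly CARD('k) ^^ m) [:dual_coeff j:])" for m
  proof -
    interpret h: comm_ring_hom "frob_fract_poly CARD('k) ^^ m :: 'f poly fract poly \<Rightarrow> _"
      by (rule comm_ring_hom_frob_fract_poly_pow)
    show ?thesis by (rule eq_matI) (auto simp: recurrence_mat_def pCons_one)
  qed
  show ?thesis
    using euler_factor_eq_det[OF M.coordinates_dual_module
        dual_motive_map_has_matrix[OF motive_coordinates drinfeld_motive_map_has_matrix \<Phi> \<Psi> dual_mat_inverse] \<Psi>]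
    by (simp add: h monom_power)
qed

end


section \<open>The size of the twisted module\<close>

lemma comm_ring_hom_comp:
  assumes "comm_ring_hom f" "comm_ring_hom h"
  shows "comm_ring_hom (\<lambda>x. h (f x))"
proof -
  interpret f: comm_ring_hom f by fact
  interpret h: comm_ring_hom h by fact
  show ?thesis by unfold_locales (simp_all add: f.hom_add f.hom_mult h.hom_add h.hom_mult)
qed

lemma comm_ring_hom_map_poly:
  assumes "comm_ring_hom h"
  shows "comm_ring_hom (map_poly h)"
proof -
  interpret h: comm_ring_hom h by fact
  interpret map_poly_comm_ring_hom h ..
  show ?thesis by (rule comm_ring_hom_axioms)
qed

lemma comm_ring_hom_eval: "comm_ring_hom (\<lambda>p. poly p a)"
  by (rule poly_hom.comm_ring_hom_axioms)

lemma comm_ring_hom_const: "comm_ring_hom (\<lambda>c. [:c:])"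
  by unfold_locales (simp_all add: pCons_one)

lemma comm_ring_hom_to_fract: "comm_ring_hom to_fract"
  by unfold_locales simp_all

lemma index_det_scale_rows:
  "index_det I (\<lambda>i j. e i * f i j) = (\<Prod>i\<in>I. e i) * index_det I f"
  by (simp add: index_det_def prod.distrib sum_distrib_left mult_ac)

context drinfeld_setting
begin

section \<open>The twisted module as a free module over A[T]\<close>

definition emb :: "'k poly poly \<Rightarrow> 'f poly poly" where
  "emb a = poly (map_poly (map_poly (\<lambda>c. [:struct_map \<gamma> c:])) a) [:[:0, 1:]:]"

lemma comm_ring_hom_struct_const: "comm_ring_hom (\<lambda>c. [:struct_map \<gamma> c:])"
  by (rule comm_ring_hom_comp[OF struct.comm_ring_hom_axioms comm_ring_hom_const])

lemma comm_ring_hom_emb: "comm_ring_hom emb"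
  unfolding emb_def[abs_def]
  by (rule comm_ring_hom_comp[OF comm_ring_hom_map_poly[OF comm_ring_hom_map_poly[OF
          comm_ring_hom_struct_const]] comm_ring_hom_eval])

sublocale emb: comm_ring_hom emb by (rule comm_ring_hom_emb)

text \<open>The exponents are exchanged because T is the outer variable of A[T], while t is the
  outer variable of the module.\<close>

lemma coeff_emb: "coeff (coeff (emb a) n) m = struct_map \<gamma> (coeff (coeff a m) n)"
proof (induction a arbitrary: m)
  case (pCons b a)
  interpret h: comm_ring_hom "\<lambda>c. [:struct_map \<gamma> c:]" by (rule comm_ring_hom_struct_const)
  interpret hp: comm_ring_hom "map_poly (\<lambda>c. [:struct_map \<gamma> c:])"
    by (rule comm_ring_hom_map_poly[OF comm_ring_hom_struct_const])
  have "emb (pCons b a) = map_poly (\<lambda>c. [:struct_map \<gamma> c:]) b + [:[:0, 1:]:] * emb a"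
    by (simp add: emb_def hp.map_poly_pCons_hom)
  then have "coeff (emb (pCons b a)) n = [:struct_map \<gamma> (coeff b n):] + [:0, 1:] * coeff (emb a) n"
    by (simp add: h.coeff_map_poly_hom)
  then show ?case
    by (cases m) (simp_all add: pCons)
qed simp

definition twist_of_vec :: "'k poly poly vec \<Rightarrow> 'f poly poly" where
  "twist_of_vec v = (\<Sum>j<d. emb (v $ j) * [:[:\<theta> ^ j:]:])"

lemma coeff_twist_of_vec:
  "coeff (coeff (twist_of_vec v) n) m = \<gamma> (\<Sum>j<d. monom (coeff (coeff (v $ j) m) n) j)"
proof -
  have "coeff (coeff (twist_of_vec v) n) m = (\<Sum>j<d. struct_map \<gamma> (coeff (coeff (v $ j) m) n) * \<theta> ^ j)"
    by (simp add: twist_of_vec_def coeff_sum coeff_emb mult.commute)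
  also have "\<dots> = \<gamma> (\<Sum>j<d. monom (coeff (coeff (v $ j) m) n) j)"
  proof -
    have "\<gamma> (monom c j) = struct_map \<gamma> c * \<theta> ^ j" for c j
      by (simp add: gamma_eq_poly scalar_ext_def poly_monom)
    then show ?thesis by (simp only: gamma.hom_sum)
  qed
  finally show ?thesis .
qed

text \<open>By \<open>coeff_twist_of_vec\<close> each coefficient in F is the image under \<gamma>
  of a polynomial of degree below d. Coefficientwise, the claim is that such representatives exist
  and are unique.\<close>

lemma bij_twist_of_vec: "bij_betw twist_of_vec (vecs UNIV d) UNIV"
proof (rule bij_betwI')
  fix v w :: "'k poly poly vec" assume vw: "v \<in> vecs UNIV d" "w \<in> vecs UNIV d"
  have degs: "degree (\<Sum>j<d. monom (u j) j) < d" for u :: "nat \<Rightarrow> 'k"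
    by (rule degree_sum_less) (use d_pos in \<open>auto intro: le_less_trans[OF degree_monom_le]\<close>)
  show "twist_of_vec v = twist_of_vec w \<longleftrightarrow> v = w"
  proof
    assume eq: "twist_of_vec v = twist_of_vec w"
    have "coeff (coeff (v $ j) m) n = coeff (coeff (w $ j) m) n" if j: "j < d" for j m n
    proof -
      have "(\<Sum>j<d. monom (coeff (coeff (v $ j) m) n) j) = (\<Sum>j<d. monom (coeff (coeff (w $ j) m) n) j)"
        by (rule gamma_inj_degree_less[OF degs degs]) (simp only: coeff_twist_of_vec[symmetric] eq)
      then have "coeff (\<Sum>j<d. monom (coeff (coeff (v $ j) m) n) j) j =
          coeff (\<Sum>j<d. monom (coeff (coeff (w $ j) m) n) j) j" by simp
      then show ?thesis using j by (simp add: coeff_sum)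
    qed
    then show "v = w" using vw by (intro eq_vecI) (auto simp: vecs_def poly_eq_iff)
  qed simp
next
  fix x :: "'f poly poly"
  obtain rep where rep: "degree (rep z) < d" "\<gamma> (rep z) = z" for z
    using gamma_rep by metis
  \<comment> \<open>The double sum below stops at the degrees of x; that the representative of 0 is
    0 makes its coefficients right beyond them as well.\<close>
  have rep0: "rep 0 = 0" by (rule gamma_inj_degree_less) (use rep d_pos in auto)
  define w where "w j = (\<Sum>n\<le>degree x. \<Sum>m\<le>degree (coeff x n).
    monom (monom (coeff (rep (coeff (coeff x n) m)) j) n) m)" for j
  have cw: "coeff (coeff (w j) m) n = coeff (rep (coeff (coeff x n) m)) j" for j m n
  proof -
    have "coeff (coeff (w j) m) n = (\<Sum>n'\<le>degree x. \<Sum>m'\<le>degree (coeff x n').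
        if m' = m \<and> n' = n then coeff (rep (coeff (coeff x n) m)) j else 0)"
      unfolding w_def coeff_sum by (intro sum.cong refl) auto
    also have "\<dots> = (\<Sum>n'\<le>degree x. if n' = n then
        (\<Sum>m'\<le>degree (coeff x n). if m' = m then coeff (rep (coeff (coeff x n) m)) j else 0) else 0)"
      by (intro sum.cong refl) auto
    also have "\<dots> = coeff (rep (coeff (coeff x n) m)) j"
      by (auto simp: coeff_eq_0 rep0 not_le)
    finally show ?thesis .
  qed
  have "x = twist_of_vec (vec d w)"
  proof (intro poly_eqI)
    fix n m
    have "coeff (coeff (twist_of_vec (vec d w)) n) m =
        \<gamma> (\<Sum>j<d. monom (coeff (rep (coeff (coeff x n) m)) j) j)"
      unfolding coeff_twist_of_vec by (intro arg_cong[of _ _ \<gamma>] sum.cong) (simp_all add: cw)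
    also have "(\<Sum>j<d. monom (coeff (rep (coeff (coeff x n) m)) j) j) = rep (coeff (coeff x n) m)"
      using rep(1)[of "coeff (coeff x n) m"] by (auto simp: poly_eq_iff coeff_sum coeff_eq_0)
    finally show "coeff (coeff x n) m = coeff (coeff (twist_of_vec (vec d w)) n) m" by (simp add: rep)
  qed
  then show "\<exists>v\<in>vecs UNIV d. x = twist_of_vec v" by (intro bexI[of _ "vec d w"]) (auto simp: vecs_def)
qed simp

definition twist_coord :: "'f poly poly \<Rightarrow> 'k poly poly vec" where
  "twist_coord = inv_into (vecs UNIV d) twist_of_vec"

lemma twist_module_simps:
  "carrier (twist_module \<gamma>) = UNIV" "x \<oplus>\<^bsub>twist_module \<gamma>\<^esub> y = x + y" "\<zero>\<^bsub>twist_module \<gamma>\<^esub> = 0"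
  "s \<odot>\<^bsub>twist_module \<gamma>\<^esub> x = emb s * x"
  by (simp_all add: twist_module_def emb_def)

lemma twist_coordinates: "coordinates UNIV (twist_module \<gamma>) d twist_coord"
  unfolding twist_coord_def
proof (rule coordinates_inverse)
  show "twist_of_vec (v + w) = twist_of_vec v \<oplus>\<^bsub>twist_module \<gamma>\<^esub> twist_of_vec w"
    if "v \<in> vecs UNIV d" "w \<in> vecs UNIV d" for v w
    unfolding twist_module_simps twist_of_vec_def sum.distrib[symmetric]
    by (rule sum.cong) (use that in \<open>auto simp: vecs_def emb.hom_add smult_add_right\<close>)
  show "twist_of_vec (s \<cdot>\<^sub>v v) = s \<odot>\<^bsub>twist_module \<gamma>\<^esub> twist_of_vec v"
    if "v \<in> vecs UNIV d" for s v
    unfolding twist_module_simps twist_of_vec_def sum_distrib_left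
    by (rule sum.cong) (use that in \<open>auto simp: vecs_def emb.hom_mult\<close>)
qed (simp_all add: twist_module_simps bij_twist_of_vec, simp add: twist_of_vec_def)

text \<open>The inclusion of A \<otimes> F[T] into F(t)[T], making T the outer variable again.
  Composed with \<open>emb\<close> it is the inclusion of A[T] used in the statement, so
  determinants can be computed in the ring of the Euler factor.\<close>

definition iota :: "'f poly poly \<Rightarrow> 'f poly fract poly" where
  "iota x = poly (map_poly (map_poly (\<lambda>c. to_fract [:c:])) x) [:to_fract tvar:]"

lemma comm_ring_hom_fract_const: "comm_ring_hom (\<lambda>c. to_fract [:c :: 'f:])"
  by (rule comm_ring_hom_comp[OF comm_ring_hom_const comm_ring_hom_to_fract])

sublocale iota: comm_ring_hom iota
  unfolding iota_def[abs_def]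
  by (rule comm_ring_hom_comp[OF comm_ring_hom_map_poly[OF comm_ring_hom_map_poly[OF
          comm_ring_hom_fract_const]] comm_ring_hom_eval])

sublocale AT: comm_ring_hom "AT_to_ApTF \<gamma>"
  unfolding AT_to_ApTF_def
  by (intro comm_ring_hom_map_poly comm_ring_hom_comp[OF _ comm_ring_hom_to_fract])
     (auto simp: scalar_ext_def[abs_def] intro: comm_ring_hom_map_poly struct.comm_ring_hom_axioms)

lemma iota_const: "iota [:p:] = map_poly (\<lambda>c. to_fract [:c:]) p"
proof -
  interpret h: comm_ring_hom "map_poly (\<lambda>c. to_fract [:c :: 'f:])"
    by (rule comm_ring_hom_map_poly[OF comm_ring_hom_fract_const])
  show ?thesis by (simp add: iota_def h.map_poly_pCons_hom)
qed

lemma iota_tvar: "iota tvar = [:to_fract tvar:]"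
proof -
  interpret h: comm_ring_hom "map_poly (\<lambda>c. to_fract [:c :: 'f:])"
    by (rule comm_ring_hom_map_poly[OF comm_ring_hom_fract_const])
  show ?thesis by (simp add: iota_def h.map_poly_pCons_hom)
qed

lemma iota_emb: "iota (emb a) = AT_to_ApTF \<gamma> a"
proof (induction a)
  case (pCons b a)
  interpret hp: comm_ring_hom "map_poly (\<lambda>c. [:struct_map \<gamma> c:])"
    by (rule comm_ring_hom_map_poly[OF comm_ring_hom_struct_const])
  interpret hc: comm_ring_hom "\<lambda>c. [:struct_map \<gamma> c:]" by (rule comm_ring_hom_struct_const)
  interpret s: comm_ring_hom "\<lambda>a. to_fract (scalar_ext \<gamma> a)"
    by (rule comm_ring_hom_comp[OF _ comm_ring_hom_to_fract])
       (auto simp: scalar_ext_def[abs_def] intro: comm_ring_hom_map_poly struct.comm_ring_hom_axioms)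
  interpret fc: comm_ring_hom "\<lambda>c. to_fract [:c :: 'f:]" by (rule comm_ring_hom_fract_const)
  have b: "iota (map_poly (\<lambda>c. [:struct_map \<gamma> c:]) b) = [:to_fract (scalar_ext \<gamma> b):]"
  proof (induction b)
    case (pCons c b)
    have 1: "map_poly (\<lambda>c. [:struct_map \<gamma> c:]) (pCons c b) =
        [:[:struct_map \<gamma> c:]:] + tvar * map_poly (\<lambda>c. [:struct_map \<gamma> c:]) b"
      by (simp add: hc.map_poly_pCons_hom)
    have 2: "scalar_ext \<gamma> (pCons c b) = [:struct_map \<gamma> c:] + tvar * scalar_ext \<gamma> b"
      by (simp add: scalar_ext_def struct.map_poly_pCons_hom)
    have 3: "iota [:[:struct_map \<gamma> c:]:] = [:to_fract [:struct_map \<gamma> c:]:]"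
      by (simp add: iota_const fc.map_poly_pCons_hom)
    have 4: "[:x:] + [:y:] * [:z:] = [:x + y * z:]" for x y z :: "'f poly fract"
      by (simp add: mult.commute)
    show ?case
      unfolding 1 2 iota.hom_add iota.hom_mult pCons 3 iota_tvar 4 to_fract_add to_fract_mult ..
  qed (simp add: scalar_ext_def)
  have T: "iota [:[:0, 1:]:] = [:0, 1:]"
    by (simp add: iota_const fc.map_poly_pCons_hom pCons_one)
  have "emb (pCons b a) = map_poly (\<lambda>c. [:struct_map \<gamma> c:]) b + [:[:0, 1:]:] * emb a"
    by (simp add: emb_def hp.map_poly_pCons_hom)
  then have "iota (emb (pCons b a)) = [:to_fract (scalar_ext \<gamma> b):] + [:0, 1:] * AT_to_ApTF \<gamma> a"
    by (simp only: iota.hom_add iota.hom_mult b T pCons)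
  also have "\<dots> = AT_to_ApTF \<gamma> (pCons b a)"
    by (simp add: AT_to_ApTF_def s.map_poly_pCons_hom)
  finally show ?case .
qed simp

abbreviation fc :: "'f \<Rightarrow> 'f poly fract poly" where
  "fc z \<equiv> [:to_fract [:z:]:]"

lemma comm_ring_hom_fc: "comm_ring_hom fc"
  by (rule comm_ring_hom_comp[OF comm_ring_hom_fract_const comm_ring_hom_const])

lemma frob_fract_poly_pow_AT:
  "(frob_fract_poly CARD('k) ^^ m) (AT_to_ApTF \<gamma> a) = AT_to_ApTF \<gamma> a"
proof (induction m)
  case (Suc m)
  interpret s: comm_ring_hom "\<lambda>a. to_fract (scalar_ext \<gamma> a)"
    by (rule comm_ring_hom_comp[OF _ comm_ring_hom_to_fract])
       (auto simp: scalar_ext_def[abs_def] intro: comm_ring_hom_map_poly struct.comm_ring_hom_axioms)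
  have "frob_fract_poly CARD('k) (AT_to_ApTF \<gamma> a) = AT_to_ApTF \<gamma> a"
    by (simp add: poly_eq_iff AT_to_ApTF_def s.coeff_map_poly_hom frob_fract_to_fract)
  then show ?case using Suc by simp
qed simp

lemma frob_poly_linear: "frob_poly CARD('k) [:a :: 'f, b:] = [:frob CARD('k) a, frob CARD('k) b:]"
  by (simp add: frob_poly_def frob.map_poly_pCons_hom)

lemma frob_fract_poly_pow_linear:
  "(frob_fract_poly CARD('k) ^^ m) [:to_fract [:a :: 'f, b:]:] =
    [:to_fract [:(frob CARD('k) ^^ m) a, (frob CARD('k) ^^ m) b:]:]"
  by (induction m) (simp_all add: frob_fract_to_fract frob_poly_linear del: pCons_one)

lemma frob_pow_mod: "(frob CARD('k) ^^ n) (x :: 'f) = (frob CARD('k) ^^ (n mod d)) x"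
  by (rule funpow_mod_eq[OF frob_pow_d, symmetric])

text \<open>A kernel vector is the coefficient vector of a polynomial of degree below d that
  vanishes at d distinct conjugates.\<close>

lemma vandermonde_nonzero: "det (mat d d (\<lambda>(m, j). conj_root m ^ j)) \<noteq> 0"
proof
  let ?V = "mat d d (\<lambda>(m, j). conj_root m ^ j)"
  assume "det ?V = 0"
  then obtain v where v: "v \<in> carrier_vec d" "v \<noteq> 0\<^sub>v d" "?V *\<^sub>v v = 0\<^sub>v d"
    using det_0_iff_vec_prod_zero_field[of ?V d] by auto
  define P where "P = (\<Sum>j<d. monom (v $ j) j)"
  have "P = 0"
  proof (rule poly_eq_0_if_card_roots[of P "conj_root ` {..<d}"])
    have "degree P < d"
      unfolding P_def by (rule degree_sum_less) (use d_pos
          in \<open>auto intro: le_less_trans[OF degree_monom_le]\<close>)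
    then show "degree P < card (conj_root ` {..<d})" by (simp add: card_image[OF inj_conj_root])
    fix x assume "x \<in> conj_root ` {..<d}"
    then obtain m where m: "m < d" "x = conj_root m" by auto
    have "poly P x = (\<Sum>j<d. ?V $$ (m, j) * v $ j)"
      unfolding P_def poly_sum using m by (intro sum.cong) (auto simp: poly_monom mult.commute)
    also have "\<dots> = (?V *\<^sub>v v) $ m" by (rule mult_mat_vec_index_sum[symmetric]) (use v m in auto)
    finally show "poly P x = 0" using m v(3) by simp
  qed
  then have "coeff P j = 0" for j by simp
  then have "v $ j = 0" if "j < d" for j using that[THEN less_imp_le] that
      by (simp add: P_def coeff_sum) (metis that)
  then have "v = 0\<^sub>v d" using v(1) by (intro eq_vecI) auto
  with v(2) show False ..
qed

end

context drinfeld_module_setting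
begin

section \<open>Conjugating the matrix of the twisted action\<close>

definition twist_endo :: "('k poly \<Rightarrow> 'f poly poly) \<Rightarrow> 'f poly poly \<Rightarrow> 'f poly poly" where
  "twist_endo \<psi> x = tvar * x - map_poly (tact (frob_poly CARD('k)) (\<psi> tvar)) x"

lemma tact_add:
  "tact (frob_poly CARD('k)) u (x + y :: 'f poly) =
      tact (frob_poly CARD('k)) u x + tact (frob_poly CARD('k)) u y"
proof -
  interpret h: comm_ring_hom "frob_poly CARD('k) ^^ i :: 'f poly \<Rightarrow> 'f poly" for i
    by (rule comm_ring_hom_funpow) (rule frob_poly.comm_ring_hom_axioms)
  show ?thesis by (simp add: tact_def h.hom_add distrib_left sum.distrib)
qed

lemma tact_0 [simp]: "tact (frob_poly CARD('k)) u (0 :: 'f poly) = 0"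
  using tact_add[of u 0 0] by (metis add_cancel_right_right)

lemma tact_mult_fixed:
  assumes "frob_poly CARD('k) p = (p :: 'f poly)"
  shows "tact (frob_poly CARD('k)) u (p * x) = p * tact (frob_poly CARD('k)) u x"
proof -
  interpret h: comm_ring_hom "frob_poly CARD('k) ^^ i :: 'f poly \<Rightarrow> 'f poly" for i
    by (rule comm_ring_hom_funpow) (rule frob_poly.comm_ring_hom_axioms)
  have "(frob_poly CARD('k) ^^ i) p = p" for i by (induction i) (simp_all add: assms)
  then show ?thesis by (simp add: tact_def h.hom_mult sum_distrib_left mult_ac)
qed

text \<open>The powers of t only index coefficients. The coefficients of a scalar of A[T] lie in the
  small field, hence are fixed by Frobenius and pass through the twisted polynomial.\<close>

lemma twist_endo_linear: "twist_endo \<psi> \<in> linear_maps UNIV (twist_module \<gamma>) (twist_module \<gamma>)"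
proof -
  let ?L = "tact (frob_poly CARD('k)) (\<psi> tvar) :: 'f poly \<Rightarrow> 'f poly"
  have sum: "?L (sum f I) = (\<Sum>i\<in>I. ?L (f i))" for f and I :: "nat set"
    by (induction I rule: infinite_finite_induct) (simp_all add: tact_add)
  have add: "map_poly ?L (x + y) = map_poly ?L x + map_poly ?L y" for x y
    by (simp add: poly_eq_iff coeff_map_poly tact_add)
  have fixed: "frob_poly CARD('k) (coeff (emb s) i) = coeff (emb s) i" for s i
    by (simp add: poly_eq_iff frob_poly_def coeff_emb)
  have mult: "map_poly ?L (emb s * x) = emb s * map_poly ?L x" for s x
    by (rule poly_eqI) (simp add: coeff_map_poly coeff_mult sum tact_mult_fixed[OF fixed])
  show ?thesis
    by (auto simp: semilinear_maps_def twist_module_simps twist_endo_def add mult distrib_left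
        right_diff_distrib
        mult.left_commute[of tvar])
qed

text \<open>Every entry subtracts a sum because several j can reach the same column modulo d when r
  > d.\<close>

definition conj_mat :: "'f poly fract poly mat" where
  "conj_mat = mat d d (\<lambda>(m, m'). (if m = m' then [:to_fract [:- conj_root m, 1:]:] else 0) -
    (\<Sum>j<r. if m' = (m + Suc j) mod d
      then monom (to_fract [:(frob CARD('k) ^^ m) (g (Suc j)):]) (Suc j) else 0))"

context
  fixes \<psi> :: "'k poly \<Rightarrow> 'f poly poly"
  assumes twist: "T_twist \<gamma> \<phi> \<psi>"
begin

lemma coeff_psi: "coeff (\<psi> tvar) i = monom (g i) i"
proof -
  have "coeff (\<psi> tvar) i = (\<Sum>j\<le>r. if j = i then monom (g i) i else 0)"
    using twist by (auto simp: T_twist_def coeff_sum intro!: sum.cong)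
  then show ?thesis by (simp add: coeff_eq_0)
qed

lemma degree_psi: "degree (\<psi> tvar) = r"
proof (rule antisym)
  show "degree (\<psi> tvar) \<le> r" by (rule degree_le) (simp add: coeff_psi coeff_eq_0)
  show "r \<le> degree (\<psi> tvar)" by (rule le_degree) (use g_r in \<open>simp add: coeff_psi\<close>)
qed

lemma iota_twist_endo_const:
  "iota (twist_endo \<psi> [:[:z:]:]) = [:to_fract tvar:] * fc z -
    (\<Sum>i\<le>r. monom (to_fract [:g i * (frob CARD('k) ^^ i) z:]) i)"
proof -
  interpret fc: comm_ring_hom "\<lambda>c. to_fract [:c :: 'f:]" by (rule comm_ring_hom_fract_const)
  have pow: "(frob_poly CARD('k) ^^ i) [:z:] = [:(frob CARD('k) ^^ i) z:]" for i
    by (induction i) (simp_all add: frob_poly_def frob.map_poly_pCons_hom)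
  have "tact (frob_poly CARD('k)) (\<psi> tvar) [:z:] = (\<Sum>i\<le>r. monom (g i * (frob CARD('k) ^^ i) z) i)"
    by (simp add: tact_def degree_psi coeff_psi pow smult_monom mult.commute)
  moreover have "map_poly (tact (frob_poly CARD('k)) (\<psi> tvar)) [:[:z:]:] =
      [:tact (frob_poly CARD('k)) (\<psi> tvar) [:z:]:]"
    by (cases "z = 0") (simp_all add: map_poly_pCons)
  ultimately have "twist_endo \<psi> [:[:z:]:] =
      tvar * [:[:z:]:] - [:\<Sum>i\<le>r. monom (g i * (frob CARD('k) ^^ i) z) i:]"
    by (simp only: twist_endo_def)
  moreover have "iota [:\<Sum>i\<le>r. monom (g i * (frob CARD('k) ^^ i) z) i:] =
      (\<Sum>i\<le>r. monom (to_fract [:g i * (frob CARD('k) ^^ i) z:]) i)"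
  proof -
    interpret h: comm_ring_hom "map_poly (\<lambda>c. to_fract [:c :: 'f:])"
      by (rule comm_ring_hom_map_poly[OF comm_ring_hom_fract_const])
    show ?thesis by (simp only: iota_const h.hom_sum fc.map_poly_hom_monom)
  qed
  moreover have "iota [:[:z:]:] = fc z" by (simp add: iota_const fc.map_poly_pCons_hom)
  ultimately show ?thesis by (simp only: iota.hom_minus iota.hom_mult iota_tvar)
qed

text \<open>
  Conjugating the matrix of \<open>t - \<phi>\<^sup>\<sim>\<^sub>t\<close> in the basis \<open>\<theta>\<^sup>j\<close> by the Vandermonde matrix of the
  conjugates of \<open>\<theta>\<close> diagonalizes multiplication by scalars of \<open>F\<close> and turns \<open>\<tau>\<close> into a cyclic shift.
\<close>

lemma AT_twist_size: "AT_to_ApTF \<gamma> (twist_size \<gamma> \<psi>) = det conj_mat"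
proof -
  interpret W: coordinates UNIV "twist_module \<gamma>" d twist_coord by (rule twist_coordinates)
  interpret WW: coordinates_pair UNIV "twist_module \<gamma>" d twist_coord UNIV "twist_module \<gamma>" d
      twist_coord "\<lambda>s. s"
    by (intro coordinates_pair.intro coordinates_pair_axioms.intro W.coordinates_axioms hom_on_ident)
  interpret fch: comm_ring_hom fc by (rule comm_ring_hom_fc)
  interpret S: comm_ring_hom "frob_fract_poly CARD('k) ^^ m :: 'f poly fract poly \<Rightarrow> 'f poly fract poly" for m
    by (rule comm_ring_hom_frob_fract_poly_pow)
  interpret sg: comm_ring_hom "frob CARD('k) ^^ m :: 'f \<Rightarrow> 'f" for m by (rule tw.funpow_hom)
  obtain C where C: "C \<in> mats UNIV d d"
    and DC: "\<And>x. x \<in> carrier (twist_module \<gamma>) \<Longrightarrow> twist_coord (twist_endo \<psi> x) =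
        C *\<^sub>v map_vec (\<lambda>s. s) (twist_coord x)"
    using WW.semilinear_maps_matrix[OF twist_endo_linear] by blast
  have Cc: "C \<in> carrier_mat d d" using C by (simp add: mats_def)
  have "twist_size \<gamma> \<psi> = endo_det UNIV (twist_module \<gamma>) (twist_endo \<psi>)"
    by (simp add: twist_size_def twist_endo_def[abs_def])
  also have "\<dots> = det C"
    by (rule W.endo_det_eq_det[OF _ C]) (simp_all add: DC map_vec_ident twist_module_simps)
  finally have size: "twist_size \<gamma> \<psi> = det C" .
  have ofc: "twist_of_vec (twist_coord x) = x" for x
    unfolding twist_coord_def by (rule f_inv_into_f) (use bij_twist_of_vec in \<open>simp add: bij_betw_def\<close>)
  have cof: "twist_coord (twist_of_vec v) = v" if "v \<in> vecs UNIV d" for v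
    unfolding twist_coord_def by (rule inv_into_f_f) (use bij_twist_of_vec that
        in \<open>auto simp: bij_betw_def\<close>)
  have basis: "twist_of_vec (unit_vec d j) = [:[:\<theta> ^ j:]:]" if "j < d" for j
  proof -
    have "twist_of_vec (unit_vec d j) = (\<Sum>i<d. if i = j then [:[:\<theta> ^ j:]:] else 0)"
      unfolding twist_of_vec_def by (rule sum.cong) (use that in \<open>auto simp: unit_vec_def\<close>)
    then show ?thesis using that by simp
  qed
  define A where "A = map_mat (AT_to_ApTF \<gamma>) C"
  have Ac: "A \<in> carrier_mat d d" using Cc by (simp add: A_def)
  have D: "twist_endo \<psi> [:[:\<theta> ^ j:]:] = (\<Sum>i<d. emb (C $$ (i, j)) * [:[:\<theta> ^ i:]:])" if j: "j < d" for j
  proof -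
    have "twist_coord (twist_endo \<psi> [:[:\<theta> ^ j:]:]) = col C j"
      using DC[of "[:[:\<theta> ^ j:]:]"] cof[of "unit_vec d j"] mult_mat_unit_vec[OF Cc j]
      by (simp add: twist_module_simps map_vec_ident basis[OF j] vecs_def)
    then have "twist_endo \<psi> [:[:\<theta> ^ j:]:] = twist_of_vec (col C j)" by (metis ofc)
    also have "\<dots> = (\<Sum>i<d. emb (C $$ (i, j)) * [:[:\<theta> ^ i:]:])"
      unfolding twist_of_vec_def by (rule sum.cong) (use Cc j in auto)
    finally show ?thesis .
  qed
  have iota_c: "iota [:[:z:]:] = fc z" for z
  proof -
    interpret fc: comm_ring_hom "\<lambda>c. to_fract [:c :: 'f:]" by (rule comm_ring_hom_fract_const)
    show ?thesis by (simp add: iota_const fc.map_poly_pCons_hom)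
  qed
  have root: "(frob CARD('k) ^^ m) (\<theta> ^ j) = conj_root m ^ j" for m j
    by (simp add: conj_root_def sg.hom_power)
  have Spow: "(frob_fract_poly CARD('k) ^^ m) (fc z) = fc ((frob CARD('k) ^^ m) z)" for m and z :: 'f
    using frob_fract_poly_pow_linear[of m z 0] by simp
  have St: "(frob_fract_poly CARD('k) ^^ m) [:to_fract tvar :: 'f poly fract:] = [:to_fract tvar:]" for m
    using frob_fract_poly_pow_linear[of m 0 1] by simp
  have Smon: "(frob_fract_poly CARD('k) ^^ m) (monom (to_fract [:z:]) i) =
      monom (to_fract [:(frob CARD('k) ^^ m) z:]) i" for m i and z :: 'f
  proof -
    have "(frob_fract_poly CARD('k) ^^ m) (monom (to_fract [:z:]) i) =
        (frob_fract_poly CARD('k) ^^ m) (fc z * monom 1 i)" by (simp add: smult_monom)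
    also have "\<dots> = fc ((frob CARD('k) ^^ m) z) * (frob_fract_poly CARD('k) ^^ m) (monom 1 i)"
      by (simp only: S.hom_mult Spow)
    also have "(frob_fract_poly CARD('k) ^^ m) (monom 1 i :: 'f poly fract poly) = monom 1 i"
      by (induction m) (simp_all add: frob_fract_poly_def)
    finally show ?thesis by (simp add: smult_monom)
  qed
  \<comment> \<open>Row m comes from applying sigma^m to the expansion of the image of \<theta>^j:
    the entries of the matrix \<open>A\<close> have coefficients fixed by Frobenius, whereas
    \<theta> becomes its m-th conjugate. On the right side the powers of sigma combine modulo
    d.\<close>
  have row: "(\<Sum>i<d. A $$ (i, j) * fc (conj_root m ^ i)) = [:to_fract tvar:] * fc (conj_root m ^ j) -
      (\<Sum>i\<le>r. monom (to_fract [:(frob CARD('k) ^^ m) (g i) * conj_root ((m + i) mod d) ^ j:]) i)"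
    if j: "j < d" for m j
  proof -
    have "(\<Sum>i<d. A $$ (i, j) * fc (\<theta> ^ i)) = iota (twist_endo \<psi> [:[:\<theta> ^ j:]:])"
      unfolding D[OF j] iota.hom_sum iota.hom_mult iota_emb iota_c
      by (rule sum.cong) (use Cc j in \<open>auto simp: A_def\<close>)
    also have "\<dots> = [:to_fract tvar:] * fc (\<theta> ^ j) -
        (\<Sum>i\<le>r. monom (to_fract [:g i * (frob CARD('k) ^^ i) (\<theta> ^ j):]) i)"
      by (rule iota_twist_endo_const)
    finally have "(frob_fract_poly CARD('k) ^^ m) (\<Sum>i<d. A $$ (i, j) * fc (\<theta> ^ i)) =
        (frob_fract_poly CARD('k) ^^ m) ([:to_fract tvar:] * fc (\<theta> ^ j) -
        (\<Sum>i\<le>r. monom (to_fract [:g i * (frob CARD('k) ^^ i) (\<theta> ^ j):]) i))" by simp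
    moreover have "(frob_fract_poly CARD('k) ^^ m) (A $$ (i, j)) = A $$ (i, j)" if "i < d" for i
      using that j Cc by (simp add: A_def frob_fract_poly_pow_AT)
    moreover have "(frob CARD('k) ^^ m) (g i * (frob CARD('k) ^^ i) (\<theta> ^ j)) =
        (frob CARD('k) ^^ m) (g i) * conj_root ((m + i) mod d) ^ j" for i
    proof -
      have "(frob CARD('k) ^^ m) ((frob CARD('k) ^^ i) (\<theta> ^ j)) =
          (frob CARD('k) ^^ ((m + i) mod d)) (\<theta> ^ j)"
        by (metis comp_apply Nat.funpow_add frob_pow_mod)
      then show ?thesis by (simp only: sg.hom_mult root)
    qed
    ultimately show ?thesis
      by (simp only: S.hom_sum S.hom_mult S.hom_minus St Spow Smon root) simp
  qed
  define B where "B = mat d d (\<lambda>(m, j). fc (conj_root m ^ j))"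
  have Bc: "B \<in> carrier_mat d d" and Yc: "conj_mat \<in> carrier_mat d d"
      by (simp_all add: B_def conj_mat_def)
  have BA: "B * A = conj_mat * B"
  proof (rule eq_matI)
    fix m j assume "m < dim_row (conj_mat * B)" "j < dim_col (conj_mat * B)"
    then have m: "m < d" and j: "j < d" using Bc Yc by auto
    \<comment> \<open>The term i = 0 is separated because g_0 = \<theta>: it merges with t into the
      diagonal entry t - \<theta>_m.\<close>
    have split: "(\<Sum>i\<le>r. F i) = F 0 + (\<Sum>i<r. F (Suc i))" for F :: "nat \<Rightarrow> 'f poly fract poly"
      by (rule sum.atMost_shift)
    have "(B * A) $$ (m, j) = (\<Sum>i<d. B $$ (m, i) * A $$ (i, j))"
      by (rule mat_mult_index_sum[OF Bc Ac m j, symmetric])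
    also have "\<dots> = (\<Sum>i<d. A $$ (i, j) * fc (conj_root m ^ i))"
      by (rule sum.cong) (use m in \<open>auto simp: B_def mult.commute\<close>)
    also have "\<dots> = [:to_fract [:- conj_root m, 1:]:] * fc (conj_root m ^ j) -
        (\<Sum>i<r. monom (to_fract [:(frob CARD('k) ^^ m) (g (Suc i)) * conj_root ((m +
            Suc i) mod d) ^ j:]) (Suc i))"
    proof -
      have t: "to_fract tvar * to_fract [:z:] - to_fract [:w * z:] =
          to_fract [:- w, 1:] * (to_fract [:z:] :: 'f poly fract)" for w z :: 'f
        by (simp only: to_fract_mult[symmetric] to_fract_diff[symmetric]) simp
      have "(frob CARD('k) ^^ m) (g 0) = conj_root m" by (simp add: g_0 conj_root_def)
      then have "[:to_fract tvar:] * fc (conj_root m ^ j) -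
          monom (to_fract [:(frob CARD('k) ^^ m) (g 0) * conj_root ((m + 0) mod d) ^ j:]) 0 =
          [:to_fract tvar * to_fract [:conj_root m ^ j:] - to_fract [:conj_root m * conj_root m ^ j:]:]"
        using m by (simp add: monom_0)
      then show ?thesis unfolding row[OF j] split t by (simp add: diff_diff_eq[symmetric] mult.commute)
    qed
    also have "\<dots> = (\<Sum>m'<d. conj_mat $$ (m, m') * B $$ (m', j))"
    proof -
      have "(\<Sum>m'<d. conj_mat $$ (m, m') * B $$ (m', j)) =
          (\<Sum>m'<d. (if m' = m then [:to_fract [:- conj_root m, 1:]:] * fc (conj_root m ^ j) else 0) -
            (\<Sum>i<r. if m' = (m + Suc i) mod d then monom (to_fract
                [:(frob CARD('k) ^^ m) (g (Suc i)):]) (Suc i)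
              * fc (conj_root m' ^ j) else 0))"
      proof (rule sum.cong[OF refl])
        fix m' assume "m' \<in> {..<d}"
        then have "conj_mat $$ (m, m') * B $$ (m', j) =
            ((if m = m' then [:to_fract [:- conj_root m, 1:]:] else 0) -
              (\<Sum>i<r. if m' = (m + Suc i) mod d
                then monom (to_fract [:(frob CARD('k) ^^ m) (g (Suc i)):]) (Suc i) else 0)) * fc
                    (conj_root m' ^ j)"
          using m j by (simp only: conj_mat_def B_def) simp
        also have "\<dots> = (if m = m' then [:to_fract [:- conj_root m, 1:]:] else 0) * fc (conj_root m' ^ j) -
              (\<Sum>i<r. (if m' = (m + Suc i) mod d
                then monom (to_fract [:(frob CARD('k) ^^ m) (g (Suc i)):]) (Suc i) else 0) * fc
                    (conj_root m' ^ j))"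
          by (simp only: left_diff_distrib sum_distrib_right)
        also have "\<dots> = (if m' = m then [:to_fract [:- conj_root m, 1:]:] * fc (conj_root m ^ j) else 0) -
            (\<Sum>i<r. if m' = (m + Suc i) mod d then monom (to_fract
                [:(frob CARD('k) ^^ m) (g (Suc i)):]) (Suc i)
              * fc (conj_root m' ^ j) else 0)"
          by (intro arg_cong2[of _ _ _ _ "(-)"] sum.cong refl) (simp_all split: if_split)
        finally show "conj_mat $$ (m, m') * B $$ (m', j) =
            (if m' = m then [:to_fract [:- conj_root m, 1:]:] * fc (conj_root m ^ j) else 0) -
            (\<Sum>i<r. if m' = (m + Suc i) mod d then monom (to_fract
                [:(frob CARD('k) ^^ m) (g (Suc i)):]) (Suc i)
              * fc (conj_root m' ^ j) else 0)" .
      qed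
      also have "\<dots> = [:to_fract [:- conj_root m, 1:]:] * fc (conj_root m ^ j) -
          (\<Sum>i<r. \<Sum>m'<d. if m' = (m + Suc i) mod d then monom (to_fract
              [:(frob CARD('k) ^^ m) (g (Suc i)):]) (Suc i)
              * fc (conj_root m' ^ j) else 0)"
        using m unfolding sum_subtractf by (subst sum.swap[of _ "{..<r}"]) simp
      also have "\<dots> = [:to_fract [:- conj_root m, 1:]:] * fc (conj_root m ^ j) -
          (\<Sum>i<r. monom (to_fract [:(frob CARD('k) ^^ m) (g (Suc i)):]) (Suc i)
              * fc (conj_root ((m + Suc i) mod d) ^ j))"
        using d_pos by simp
      also have "(\<Sum>i<r. monom (to_fract [:(frob CARD('k) ^^ m) (g (Suc i)):]) (Suc i)
              * fc (conj_root ((m + Suc i) mod d) ^ j)) =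
          (\<Sum>i<r. monom (to_fract [:(frob CARD('k) ^^ m) (g (Suc i)) * conj_root ((m +
              Suc i) mod d) ^ j:]) (Suc i))"
      proof (rule sum.cong[OF refl])
        have fm: "to_fract [:x:] * to_fract [:y:] = (to_fract [:x * y:] :: 'f poly fract)" for x y :: 'f
          by (simp only: to_fract_mult[symmetric]) simp
        show "monom (to_fract [:x:]) k * fc y = monom (to_fract [:x * y:]) k" for x y k
          by (simp add: smult_monom fm mult.commute)
      qed
      finally show ?thesis by simp
    qed
    also have "\<dots> = (conj_mat * B) $$ (m, j)" by (rule mat_mult_index_sum[OF Yc Bc m j])
    finally show "(B * A) $$ (m, j) = (conj_mat * B) $$ (m, j)" .
  qed (use Ac Bc Yc in auto)
  have "B = map_mat fc (mat d d (\<lambda>(m, j). conj_root m ^ j))"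
    by (rule eq_matI) (auto simp: B_def)
  then have "det B = fc (det (mat d d (\<lambda>(m, j). conj_root m ^ j)))"
    by (simp only: fch.hom_det)
  then have "det B \<noteq> 0" using vandermonde_nonzero by simp
  moreover have "det B * det A = det conj_mat * det B"
    using det_mult[OF Bc Ac] det_mult[OF Yc Bc] BA by metis
  ultimately have "det A = det conj_mat" by auto
  then show ?thesis by (simp add: size A_def AT.hom_det)
qed

end

text \<open>Multiplying sigma^m(g_j / (t - \<theta>)) by t - \<theta>_m restores sigma^m(g_j), so
  row m of \<open>conj_mat\<close> is t - \<theta>_m times row m of \<open>Y\<close>. The
  determinant of \<open>Y\<close> is that of the cyclic system with coefficients a_j,m = sigma^m(g_j
  / (t - \<theta>)) and parameter T.\<close>

lemma det_conj_mat:
  "det conj_mat = [:to_fract (scalar_ext \<gamma> \<pp>):] *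
    det (1\<^sub>m r - monom 1 1 ^ d \<cdot>\<^sub>m
      seq_prod r (\<lambda>m. recurrence_mat r (\<lambda>j. (frob_fract_poly CARD('k) ^^ m) [:dual_coeff j:])) d)"
proof -
  define a where "a = (\<lambda>j m. (frob_fract_poly CARD('k) ^^ m) [:dual_coeff j:])"
  define e :: "nat \<Rightarrow> 'f poly fract poly" where "e m = [:to_fract [:- conj_root m, 1:]:]" for m
  interpret S: comm_ring_hom "frob_fract_poly CARD('k) ^^ m :: 'f poly fract poly \<Rightarrow> 'f poly fract poly" for m
    by (rule comm_ring_hom_frob_fract_poly_pow)
  interpret sg: comm_ring_hom "frob CARD('k) ^^ m :: 'f \<Rightarrow> 'f" for m by (rule tw.funpow_hom)
  have ea: "e m * a j m = fc ((frob CARD('k) ^^ m) (g j))" for m j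
  proof -
    have "[:to_fract [:- \<theta>, 1:]:] * [:dual_coeff j:] = fc (g j)"
      by (simp add: dual_coeff_def)
    then have "(frob_fract_poly CARD('k) ^^ m) [:to_fract [:- \<theta>, 1:]:] * a j m =
        (frob_fract_poly CARD('k) ^^ m) (fc (g j))"
      unfolding a_def by (simp only: S.hom_mult[symmetric])
    moreover have "(frob_fract_poly CARD('k) ^^ m) [:to_fract [:- \<theta>, 1:]:] = e m"
      unfolding frob_fract_poly_pow_linear by (simp add: e_def conj_root_def sg.hom_uminus)
    moreover have "(frob_fract_poly CARD('k) ^^ m) (fc (g j)) = fc ((frob CARD('k) ^^ m) (g j))"
      using frob_fract_poly_pow_linear[of m "g j" 0] by simp
    ultimately show ?thesis by simp
  qed
  define Y where "Y m m' = (if m = m' then 1 else 0) -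
    (\<Sum>j<r. if m' = (m + Suc j) mod d then monom 1 1 ^ Suc j * a (Suc j) m else 0)" for m m'
  have "det conj_mat = index_det {..<d} (\<lambda>m m'. conj_mat $$ (m, m'))"
    by (rule det_eq_index_det) (simp add: conj_mat_def)
  also have "\<dots> = index_det {..<d} (\<lambda>m m'. e m * Y m m')"
  proof (rule index_det_cong)
    fix m m' assume m: "m \<in> {..<d}" "m' \<in> {..<d}"
    have "e m * (monom 1 1 ^ Suc j * a (Suc j) m) =
        monom (to_fract [:(frob CARD('k) ^^ m) (g (Suc j)):]) (Suc j)" for j
    proof -
      have "e m * (monom 1 1 ^ Suc j * a (Suc j) m) = monom 1 (Suc j) * (e m * a (Suc j) m)"
        by (simp only: monom_power mult_ac) simp
      then show ?thesis unfolding ea by (simp add: smult_monom mult.commute)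
    qed
    then show "conj_mat $$ (m, m') = e m * Y m m'"
      using m by (simp add: conj_mat_def Y_def right_diff_distrib sum_distrib_left
          if_distrib[of "\<lambda>z. e m * z"]
          del: power_Suc cong: if_cong) (simp add: e_def)
  qed
  also have "\<dots> = (\<Prod>m<d. e m) * det (mat d d (\<lambda>(m, m'). Y m m'))"
    by (simp add: index_det_scale_rows index_det_eq_det)
  also have "(\<Prod>m<d. e m) = [:to_fract (scalar_ext \<gamma> \<pp>):]"
  proof -
    interpret h: comm_ring_hom "\<lambda>p :: 'f poly. [:to_fract p:]"
      by (rule comm_ring_hom_comp[OF comm_ring_hom_to_fract comm_ring_hom_const])
    show ?thesis unfolding scalar_ext_pp h.hom_prod e_def ..
  qed
  also have "det (mat d d (\<lambda>(m, m'). Y m m')) =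
      det (1\<^sub>m r - monom 1 1 ^ d \<cdot>\<^sub>m seq_prod r (\<lambda>m. recurrence_mat r (\<lambda>j. a j m)) d)"
    unfolding Y_def index_det_cyclic_system_eq_shift[OF d_pos r_pos, symmetric]
    by (rule index_det_cyclic_system_eq_monodromy[OF d_pos r_pos])
  finally show ?thesis by (simp only: a_def)
qed

end


theorem theoremA10:
  fixes \<gamma> :: "'k::{field,finite} poly \<Rightarrow> 'f::{field,finite}"
    and \<pp> :: "'k poly"
    and \<phi> :: "'k poly \<Rightarrow> 'f poly"
    and \<psi> :: "'k poly \<Rightarrow> 'f poly poly"
  assumes "\<gamma> \<in> ring_hom type_ring type_ring"
    and "lead_coeff \<pp> = 1"
    and "{a. \<gamma> a = 0} = {a. \<pp> dvd a}"
    and "degree \<pp> = vector_space.dim (\<lambda>c x. struct_map \<gamma> c * x) (UNIV :: 'f set)"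
    and "drinfeld_module \<gamma> \<phi>"
    and "T_twist \<gamma> \<phi> \<psi>"
  shows "euler_factor \<gamma> \<pp> (dual_module UNIV (drinfeld_motive \<phi>))
           (dual_motive_map \<gamma> (drinfeld_motive \<phi>) (drinfeld_motive_map \<gamma> \<phi>)) =
         Polynomial.smult (inverse (to_fract (scalar_ext \<gamma> \<pp>))) (AT_to_ApTF \<gamma> (twist_size \<gamma> \<psi>))"
proof -
  interpret drinfeld_module_setting \<gamma> \<pp> \<phi>
    using assms by unfold_locales
  show ?thesis
    unfolding AT_twist_size[OF assms(6)] det_conj_mat dual_euler_factor
    using scalar_ext_pp_nonzero by simp
qed

end
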